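(* Let $(\mathfrak g_i,\langle\cdot,\cdot\rangle_i,\Phi_i)$, $i=1,2$, be weak extrinsic symmetric triples and let $M_i=M_{\mathfrak g_i,\Phi_i}\hookrightarrow(\mathfrak g_i)_-$ be the associated extrinsic symmetric spaces. Then $M_1\hookrightarrow(\mathfrak g_1)_-$ and $M_2\hookrightarrow(\mathfrak g_2)_-$ are (extrinsically) isometric if and only if $(\mathfrak g_1,\langle\cdot,\cdot\rangle_1,\Phi_1)$ and $(\mathfrak g_2,\langle\cdot,\cdot\rangle_2,\Phi_2)$ are isomorphic.
   Context: All vector spaces and Lie algebras are real and finite-dimensional. Inner product spaces. An inner product space is a finite-dimensional real affine space whose associated vector space $V$ carries a symmetric bilinear form $\langle\cdot,\cdot\rangle$, possibly degenerate. An isometry $V_1\to V_2$ is an invertible affine map preserving the bilinear forms. Two submanifolds $M_1\hookrightarrow V_1$, $M_2\hookrightarrow V_2$ are (extrinsically) isometric if there is an affine isometry $V_1\to V_2$ mapping $M_1$ onto $M_2$. Weak extrinsic symmetric triples. For a Lie algebra $\mathfrak g$ with involution $\theta$, $\mathfrak g_\pm$ are the $\pm1$-eigenspaces of $\theta$. If $D$ is a derivation of $\mathfrak g$ with $D^3=-D$ and $D\theta=-\theta D$, put $\mathfrak g^+=\ker D$, $\mathfrak g^-=\{X\mid D^2X=-X\}$, and $\mathfrak g_+^+=\mathfrak g_+\cap\mathfrak g^+$, $\mathfrak g_+^-=\mathfrak g_+\cap\mathfrak g^-$, $\mathfrak g_-^+=\mathfrak g_-\cap\mathfrak g^+$, $\mathfrak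 g_-^-=\mathfrak g_-\cap\mathfrak g^-$. A weak extrinsic symmetric triple $(\mathfrak g,\langle\cdot,\cdot\rangle,\Phi)$ consists of a Lie algebra $\mathfrak g$, an $\operatorname{ad}(\mathfrak g)$-invariant symmetric bilinear form $\langle\cdot,\cdot\rangle$ on $\mathfrak g$ (possibly degenerate) and a pair $\Phi=(D,\theta)$, where $\theta$ is an involutive automorphism of $\mathfrak g$ preserving $\langle\cdot,\cdot\rangle$ and $D$ is a derivation, anti-symmetric with respect to $\langle\cdot,\cdot\rangle$, with $D^3=-D$, $D\theta=-\theta D$ and $[\mathfrak g_+^-,\mathfrak g_+^-]=\mathfrak g_+^+$, such that $\langle\cdot,\cdot\rangle$ is non-degenerate on $\mathfrak g_+\oplus\mathfrak g_-^-$. Two weak extrinsic symmetric triples $(\mathfrak g_i,\langle\cdot,\cdot\rangle_i,\Phi_i)$ with $\Phi_i=(D_i,\theta_i)$ are isomorphic if there is a Lie algebra isomorphism $h:\mathfrak g_1\to\mathfrak g_2$ with $\langle\cdot,\cdot\rangle_1=h^*\langle\cdot,\cdot\rangle_2$, $D_2=hD_1h^{-1}$ and $\theta_2=h\theta_1h^{-1}$. The space $M_{\mathfrak g,\Phi}$. Regard $\mathfrak g_-$ with the restriction of $\langle\cdot,\cdot\rangle$ as an inner product space, with isometry group $\mathrm{Iso}(\mathfrak g_-)=\mathrm O(\mathfrak g_-)\ltimes\mathfrak g_-$. The map $\phi:\mathfrak g_+\to\mathfrak{iso}(\mathfrak g_-)=\mathfrak{so}(\mathfrak g_-)\ltimes\mathfrak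 g_-$, $\phi(X)=(\operatorname{ad}(X)|_{\mathfrak g_-},-D(X))$, is an injective Lie algebra homomorphism. $G_+\subset\mathrm{Iso}(\mathfrak g_-)$ is the group generated by all $\exp(\phi(X))$, $X\in\mathfrak g_+$, and $M_{\mathfrak g,\Phi}:=G_+(0)\subset\mathfrak g_-$ is the orbit of $0$. It is an extrinsic symmetric space in $\mathfrak g_-$, i.e. a connected submanifold with non-degenerate tangent spaces that is invariant under the affine reflection at each of its affine normal spaces. *)

theory Defs
  imports "HOL-Analysis.Analysis" "HOL-Algebra.Bij" "HOL-Algebra.Generated_Groups"
begin

section \<open>Inner product spaces and extrinsic isometry\<close>

text \<open>
  An inner product space is given by a subspace \<open>V\<close> and a bilinear form \<open>B\<close> (of which only the
  values on \<open>V\<close> matter); no definiteness or non-degeneracy is asked for. The linear part \<open>L\<close> is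
  required to be linear on the whole type, which is no restriction: every linear map defined on a
  subspace extends.
\<close>

definition affine_isometry ::
  "'a::real_vector set \<Rightarrow> ('a \<Rightarrow> 'a \<Rightarrow> real) \<Rightarrow> 'b::real_vector set \<Rightarrow> ('b \<Rightarrow> 'b \<Rightarrow> real)
    \<Rightarrow> ('a \<Rightarrow> 'b) \<Rightarrow> bool" where
  "affine_isometry V1 B1 V2 B2 f \<longleftrightarrow>
     (\<exists>L c. linear L \<and> c \<in> V2 \<and> (\<forall>v\<in>V1. f v = L v + c) \<and> bij_betw L V1 V2 \<and>
        (\<forall>u\<in>V1. \<forall>v\<in>V1. B2 (L u) (L v) = B1 u v))"

definition extrinsically_isometric ::
  "'a::real_vector set \<Rightarrow> 'a set \<Rightarrow> ('a \<Rightarrow> 'a \<Rightarrow> real)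
    \<Rightarrow> 'b::real_vector set \<Rightarrow> 'b set \<Rightarrow> ('b \<Rightarrow> 'b \<Rightarrow> real) \<Rightarrow> bool" where
  "extrinsically_isometric M1 V1 B1 M2 V2 B2 \<longleftrightarrow>
     (\<exists>f. affine_isometry V1 B1 V2 B2 f \<and> f ` M1 = M2)"

definition Iso :: "'a::real_vector set \<Rightarrow> ('a \<Rightarrow> 'a \<Rightarrow> real) \<Rightarrow> ('a \<Rightarrow> 'a) monoid" where
  "Iso V B = (BijGroup V)\<lparr>carrier := {f \<in> extensional V. affine_isometry V B V B f}\<rparr>"

section \<open>Weak extrinsic symmetric triples\<close>

text \<open>
  The underlying vector space of a triple is the whole type \<open>'a\<close>; it is allowed to be zero.
\<close>

record 'a triple =
  bracket :: "'a \<Rightarrow> 'a \<Rightarrow> 'a"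
  form :: "'a \<Rightarrow> 'a \<Rightarrow> real"
  der :: "'a \<Rightarrow> 'a"
  invol :: "'a \<Rightarrow> 'a"

definition finite_dimensional :: "'a::real_vector itself \<Rightarrow> bool" where
  "finite_dimensional _ \<longleftrightarrow> (\<exists>S::'a set. finite S \<and> span S = UNIV)"

definition lie_bracket :: "('a::real_vector \<Rightarrow> 'a \<Rightarrow> 'a) \<Rightarrow> bool" where
  "lie_bracket br \<longleftrightarrow> bilinear br \<and> (\<forall>x. br x x = 0) \<and>
     (\<forall>x y z. br x (br y z) + br y (br z x) + br z (br x y) = 0)"

definition invariant_symmetric_form ::
  "('a::real_vector \<Rightarrow> 'a \<Rightarrow> 'a) \<Rightarrow> ('a \<Rightarrow> 'a \<Rightarrow> real) \<Rightarrow> bool" where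
  "invariant_symmetric_form br B \<longleftrightarrow> bilinear B \<and> (\<forall>x y. B x y = B y x) \<and>
     (\<forall>x y z. B (br x y) z + B y (br x z) = 0)"

definition involutive_isometric_automorphism ::
  "('a::real_vector \<Rightarrow> 'a \<Rightarrow> 'a) \<Rightarrow> ('a \<Rightarrow> 'a \<Rightarrow> real) \<Rightarrow> ('a \<Rightarrow> 'a) \<Rightarrow> bool" where
  "involutive_isometric_automorphism br B \<theta> \<longleftrightarrow> linear \<theta> \<and> (\<forall>x. \<theta> (\<theta> x) = x) \<and>
     (\<forall>x y. \<theta> (br x y) = br (\<theta> x) (\<theta> y)) \<and> (\<forall>x y. B (\<theta> x) (\<theta> y) = B x y)"

definition antisymmetric_derivation ::
  "('a::real_vector \<Rightarrow> 'a \<Rightarrow> 'a) \<Rightarrow> ('a \<Rightarrow> 'a \<Rightarrow> real) \<Rightarrow> ('a \<Rightarrow> 'a) \<Rightarrow> bool" where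
  "antisymmetric_derivation br B D \<longleftrightarrow> linear D \<and>
     (\<forall>x y. D (br x y) = br (D x) y + br x (D y)) \<and> (\<forall>x y. B (D x) y = - B x (D y))"

definition nondegenerate_on :: "('a::real_vector \<Rightarrow> 'a \<Rightarrow> real) \<Rightarrow> 'a set \<Rightarrow> bool" where
  "nondegenerate_on B W \<longleftrightarrow> (\<forall>x\<in>W. (\<forall>y\<in>W. B x y = 0) \<longrightarrow> x = 0)"

text \<open>
  Lower signs refer to the eigenspaces of the involution; upper signs, written \<open>up\<close> in the names,
  to the kernel of \<open>D\<close> and the kernel of \<open>D\<^sup>2 + 1\<close>.
\<close>

definition plus_space :: "'a::real_vector triple \<Rightarrow> 'a set" where
  "plus_space T = {x. invol T x = x}"

definition minus_space :: "'a::real_vector triple \<Rightarrow> 'a set" where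
  "minus_space T = {x. invol T x = - x}"

definition up_plus_space :: "'a::real_vector triple \<Rightarrow> 'a set" where
  "up_plus_space T = {x. der T x = 0}"

definition up_minus_space :: "'a::real_vector triple \<Rightarrow> 'a set" where
  "up_minus_space T = {x. der T (der T x) = - x}"

definition weak_extrinsic_symmetric_triple :: "'a::real_vector triple \<Rightarrow> bool" where
  "weak_extrinsic_symmetric_triple T \<longleftrightarrow>
     finite_dimensional TYPE('a) \<and>
     lie_bracket (bracket T) \<and>
     invariant_symmetric_form (bracket T) (form T) \<and>
     involutive_isometric_automorphism (bracket T) (form T) (invol T) \<and>
     antisymmetric_derivation (bracket T) (form T) (der T) \<and>
     (\<forall>x. der T (der T (der T x)) = - der T x) \<and>
     (\<forall>x. der T (invol T x) = - invol T (der T x)) \<and>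
     span {bracket T x y | x y. x \<in> plus_space T \<inter> up_minus_space T \<and>
                                y \<in> plus_space T \<inter> up_minus_space T}
       = plus_space T \<inter> up_plus_space T \<and>
     nondegenerate_on (form T)
       {x + y | x y. x \<in> plus_space T \<and> y \<in> minus_space T \<inter> up_minus_space T}"

definition isomorphic_triples :: "'a::real_vector triple \<Rightarrow> 'b::real_vector triple \<Rightarrow> bool" where
  "isomorphic_triples T1 T2 \<longleftrightarrow>
     (\<exists>h. linear h \<and> bij h \<and>
        (\<forall>x y. h (bracket T1 x y) = bracket T2 (h x) (h y)) \<and>
        (\<forall>x y. form T1 x y = form T2 (h x) (h y)) \<and>
        der T2 = h \<circ> der T1 \<circ> inv_into UNIV h \<and>
        invol T2 = h \<circ> invol T1 \<circ> inv_into UNIV h)"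

section \<open>The associated orbit\<close>

text \<open>
  A pair \<open>(A, b)\<close> of a linear endomorphism and a translation part corresponds to the endomorphism
  \<open>(v, s) \<mapsto> (A v + s b, 0)\<close> of the space extended by one dimension, and its affine exponential is
  the action of the ordinary exponential of the latter on the hyperplane \<open>s = 1\<close>. The norm of the
  type is used for nothing but the convergence of this series; in finite dimension the choice of
  the norm is immaterial.
\<close>

definition homogenize :: "('a::real_vector \<Rightarrow> 'a) \<times> 'a \<Rightarrow> 'a \<times> real \<Rightarrow> 'a \<times> real" where
  "homogenize = (\<lambda>(A, b) (v, s). (A v + s *\<^sub>R b, 0))"

definition exp_linear :: "('a::real_normed_vector \<Rightarrow> 'a) \<Rightarrow> 'a \<Rightarrow> 'a" where
  "exp_linear A v = (\<Sum>n. (A ^^ n) v /\<^sub>R fact n)"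

definition exp_affine :: "('a::real_normed_vector \<Rightarrow> 'a) \<times> 'a \<Rightarrow> 'a \<Rightarrow> 'a" where
  "exp_affine Ab v = fst (exp_linear (homogenize Ab) (v, 1))"

text \<open>
  For \<open>x\<close> in the plus space, \<open>bracket T x\<close> maps the minus space to itself and \<open>der T x\<close> lies in
  the minus space. The restriction to the minus space is carried out on the exponentials, in
  \<open>transvection_group\<close>.
\<close>

definition phi :: "'a::real_vector triple \<Rightarrow> 'a \<Rightarrow> ('a \<Rightarrow> 'a) \<times> 'a" where
  "phi T x = (bracket T x, - der T x)"

definition transvection_group :: "'a::real_normed_vector triple \<Rightarrow> ('a \<Rightarrow> 'a) set" where
  "transvection_group T =
     generate (Iso (minus_space T) (form T))
       {restrict (exp_affine (phi T x)) (minus_space T) | x. x \<in> plus_space T}"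

definition extrinsic_orbit :: "'a::real_normed_vector triple \<Rightarrow> 'a set" where
  "extrinsic_orbit T = {g 0 | g. g \<in> transvection_group T}"

end

theory Submission
  imports Defs
begin

text \<open>
  Isomorphic triples have isometric orbits for a formal reason: an isomorphism intertwines the
  one-parameter groups that generate the two transvection groups, so it carries one orbit of 0 onto
  the other (\<open>isomorphic_imp_isometric\<close>).

  Conversely, let an affine isometry map one orbit onto the other. Composed with an element of the
  second transvection group it becomes a linear isometry \<open>L\<close> that fixes 0 and still maps the orbit
  \<open>M\<^sub>1\<close> onto \<open>M\<^sub>2\<close> (\<open>move_to_zero\<close>). The triple can be read off from the 2-jet of the orbit at
  0: the tangent space is \<open>\<gg>\<^sub>-\<^sup>-\<close>, and the second fundamental form sends \<open>u, v\<close> to \<open>[D u, v]\<close>. Hence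
  \<open>L\<close> respects both (\<open>tangent_and_curvature\<close>, \<open>second_form\<close>). Normal spaces and shape operators
  are determined by these data and the form, which is non-degenerate on tangent spaces, so \<open>L\<close>
  intertwines the infinitesimal transvections \<open>ad(X)\<close> for \<open>X \<in> \<gg>\<^sub>+\<^sup>-\<close> (\<open>intertwines\<close>). As
  \<open>\<gg>\<^sub>+\<^sup>-\<close> generates \<open>\<gg>\<^sub>+\<close> and \<open>\<phi>\<close> is faithful, \<open>L\<close> induces an isomorphism of \<open>\<gg>\<^sub>+\<close>, and
  invariance of the form together with its non-degeneracy on \<open>\<gg>\<^sub>+\<close> settles the brackets of
  elements of \<open>\<gg>\<^sub>-\<close>.

  The analytic difficulty is that \<open>M\<^sub>2\<close> is merely a set, namely the orbit of a group generated by
  exponentials, whereas \<open>L\<close> is only known to map curves inside the set \<open>M\<^sub>1\<close> to curves inside the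
  set \<open>M\<^sub>2\<close>. A priori such a curve might run across the leaves of an immersed submanifold. That it
  does not is \<open>curve_in_orbit_is_tangent\<close>. It is stated in the extension of \<open>\<gg>\<close> by \<open>D\<close>, where the
  orbit becomes the orbit of the single element \<open>D\<close> under \<open>exp(ad(\<gg>\<^sub>+))\<close>; each point \<open>m\<close> of it
  satisfies \<open>ad(m)\<^sup>3 = - ad(m)\<close>, and a tangent vector \<open>\<tau>\<close> at \<open>m\<close> satisfies the polynomial
  equation \<open>[m, [m, \<tau>]] = - \<tau>\<close>. For a curve \<open>c\<close> in the orbit, each \<open>c(t)\<close> is the result of a
  finite product of exponentials. Uncountably many parameters share the number of factors, so some
  \<open>c(t)\<close> is approached by points \<open>c(t')\<close> whose factors converge to those of \<open>c(t)\<close>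
  (\<open>recurring_word\<close>). Such points are joined to \<open>c(t)\<close> by a short path that moves along the orbit
  infinitesimally, and a short path of this kind ends close to the tangent space, compared with its
  displacement (\<open>orbit_path_stays_tangential\<close>). Thus \<open>c\<close> has a tangential velocity at \<open>t\<close>; such
  \<open>t\<close> are dense, and tangency is a closed condition. Differentiating the tangency equation once
  more gives the second fundamental form.
\<close>

section \<open>One-parameter groups of linear maps\<close>

text \<open>
  The one-parameter group of \<open>A\<close>. The exponential is given by its pointwise series; the group
  properties are derived from the differential equation that it solves.
\<close>

definition flow :: "('v::real_normed_vector \<Rightarrow> 'v) \<Rightarrow> real \<Rightarrow> 'v \<Rightarrow> 'v" where
  "flow A t v = exp_linear (\<lambda>x. t *\<^sub>R A x) v"

lemma flow_1: "flow A 1 v = exp_linear A v"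
  by (simp add: flow_def)

lemma linear_funpow:
  fixes A :: "'v::real_vector \<Rightarrow> 'v"
  shows "linear A \<Longrightarrow> linear (A ^^ n)"
proof (induction n)
  case 0 then show ?case by (simp add: linear_iff)
next
  case (Suc n) then show ?case using linear_compose[of "A ^^ n" A] by (simp add: o_def)
qed

lemma funpow_scaleR_linear:
  fixes A :: "'v::real_vector \<Rightarrow> 'v"
  assumes "linear A"
  shows "((\<lambda>x. t *\<^sub>R A x) ^^ n) v = t ^ n *\<^sub>R (A ^^ n) v"
  by (induction n) (simp_all add: linear_scale[OF assms])

lemma funpow_norm_le:
  fixes A :: "'v::real_normed_vector \<Rightarrow> 'v"
  assumes "\<And>v. norm (A v) \<le> K * norm v" "0 \<le> K"
  shows "norm ((A ^^ n) v) \<le> K ^ n * norm v"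
proof (induction n)
  case (Suc n)
  have "norm ((A ^^ Suc n) v) \<le> K * norm ((A ^^ n) v)" using assms(1) by simp
  also have "\<dots> \<le> K * (K ^ n * norm v)" using Suc assms(2) by (rule mult_left_mono)
  finally show ?case by simp
qed simp

lemma exp_linear_sums:
  fixes A :: "'v::euclidean_space \<Rightarrow> 'v"
  assumes "linear A"
  shows "(\<lambda>n. (A ^^ n) v /\<^sub>R fact n) sums exp_linear A v"
proof -
  obtain K where K: "0 < K" "\<And>v. norm (A v) \<le> K * norm v"
    using linear_bounded_pos[OF assms] by blast
  have "norm ((A ^^ n) v /\<^sub>R fact n) \<le> inverse (fact n) * K ^ n * norm v" for n
    using mult_left_mono[OF funpow_norm_le[of A K n v], of "inverse (fact n)"] K
    by (simp add: mult.assoc)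
  then have "summable (\<lambda>n. (A ^^ n) v /\<^sub>R fact n)"
    by (rule summable_comparison_test'[OF summable_mult2[OF summable_exp], of 0])
  then show ?thesis by (simp add: exp_linear_def summable_sums)
qed

lemma flow_sums:
  fixes A :: "'v::euclidean_space \<Rightarrow> 'v"
  assumes "linear A"
  shows "(\<lambda>n. (t ^ n / fact n) *\<^sub>R (A ^^ n) v) sums flow A t v"
  using exp_linear_sums[of "\<lambda>x. t *\<^sub>R A x" v] assms
  by (simp add: flow_def funpow_scaleR_linear linear_compose_scale_right divide_inverse mult.commute)

lemma flow_0:
  fixes A :: "'v::euclidean_space \<Rightarrow> 'v"
  assumes "linear A"
  shows "flow A 0 v = v"
proof -
  have "(\<lambda>n. (0 ^ n / fact n) *\<^sub>R (A ^^ n) v) sums v"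
    using sums_finite[of "{0::nat}" "\<lambda>n. (0 ^ n / fact n) *\<^sub>R (A ^^ n) v"] by simp
  with flow_sums[OF assms, of 0 v] show ?thesis by (rule sums_unique2)
qed

lemma linear_flow:
  fixes A :: "'v::euclidean_space \<Rightarrow> 'v"
  assumes A: "linear A"
  shows "linear (flow A t)"
proof
  fix u v c
  note L = linear_funpow[OF A]
  from sums_add[OF flow_sums[OF A, of t u] flow_sums[OF A, of t v]]
  have "(\<lambda>n. (t ^ n / fact n) *\<^sub>R (A ^^ n) (u + v)) sums (flow A t u + flow A t v)"
    by (simp add: linear_add[OF L] scaleR_add_right)
  with flow_sums[OF A] show "flow A t (u + v) = flow A t u + flow A t v"
    by (rule sums_unique2)
  from sums_scaleR_right[OF flow_sums[OF A, of t u], of c]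
  have "(\<lambda>n. (t ^ n / fact n) *\<^sub>R (A ^^ n) (c *\<^sub>R u)) sums (c *\<^sub>R flow A t u)"
    by (simp add: linear_scale[OF L] mult.commute[of c])
  with flow_sums[OF A] show "flow A t (c *\<^sub>R u) = c *\<^sub>R flow A t u"
    by (rule sums_unique2)
qed

lemma flow_commute:
  fixes A :: "'v::euclidean_space \<Rightarrow> 'v"
  assumes A: "linear A"
  shows "flow A t (A v) = A (flow A t v)"
proof -
  have "(\<lambda>n. A ((t ^ n / fact n) *\<^sub>R (A ^^ n) v)) sums A (flow A t v)"
    using A by (intro bounded_linear.sums[OF _ flow_sums] linear_conv_bounded_linear[THEN iffD1])
  then have "(\<lambda>n. (t ^ n / fact n) *\<^sub>R (A ^^ n) (A v)) sums A (flow A t v)"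
    by (simp add: linear_scale[OF A] funpow_swap1)
  with flow_sums[OF A] show ?thesis by (rule sums_unique2)
qed

text \<open>
  Each component is an everywhere convergent real power series, which may be differentiated
  term by term.
\<close>

lemma flow_has_vector_derivative_at:
  fixes A :: "'v::euclidean_space \<Rightarrow> 'v"
  assumes A: "linear A"
  shows "((\<lambda>t. flow A t v) has_vector_derivative A (flow A t v)) (at t within S)"
proof -
  have "((\<lambda>t. flow A t v \<bullet> b) has_real_derivative (flow A t (A v) \<bullet> b)) (at t)" for b
  proof -
    define c where "c = (\<lambda>n. ((A ^^ n) v \<bullet> b) / fact n)"
    have inner_sums: "(\<lambda>n. ((A ^^ n) w \<bullet> b) / fact n * s ^ n) sums (flow A s w \<bullet> b)" for w s
      using bounded_linear.sums[OF bounded_linear_inner_left flow_sums[OF A, of s w], of b]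
      by (simp add: mult.commute)
    have "diffs c = (\<lambda>n. ((A ^^ n) (A v) \<bullet> b) / fact n)"
    proof
      fix n
      have "diffs c n = real (Suc n) * (((A ^^ Suc n) v \<bullet> b) / (real (Suc n) * fact n))"
        by (simp only: diffs_def c_def fact_Suc)
      also have "\<dots> = ((A ^^ n) (A v) \<bullet> b) / fact n"
        by (simp only: funpow_Suc_right o_apply) (simp del: of_nat_Suc)
      finally show "diffs c n = ((A ^^ n) (A v) \<bullet> b) / fact n" .
    qed
    moreover have "((\<lambda>s. \<Sum>n. c n * s ^ n) has_field_derivative (\<Sum>n. diffs c n * t ^ n)) (at t)"
      by (rule termdiffs_strong_converges_everywhere)
        (unfold c_def, rule sums_summable[OF inner_sums])
    ultimately show ?thesis
      by (simp only: c_def sums_unique[OF inner_sums, symmetric])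
  qed
  then have "((\<lambda>t. flow A t v \<bullet> b) has_derivative (\<lambda>x. (x *\<^sub>R flow A t (A v)) \<bullet> b)) (at t)" for b
    unfolding has_field_derivative_def inner_scaleR_left mult.commute[of _ "flow A t (A v) \<bullet> b"] .
  then have "((\<lambda>t. flow A t v) has_vector_derivative flow A t (A v)) (at t)"
    unfolding has_vector_derivative_def
    by (rule has_derivative_componentwise_within[THEN iffD2, rule_format])
  then show ?thesis
    unfolding flow_commute[OF A] by (rule has_vector_derivative_at_within)
qed

text \<open>
  The product rule for applying a moving linear map to a moving vector: expanding the vector in a
  basis reduces it to the product rule for scalar multiples.
\<close>

lemma flow_has_vector_derivative:
  fixes A :: "'v::euclidean_space \<Rightarrow> 'v"
  assumes A: "linear A" and r: "(r has_vector_derivative r') (at t within S)"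
  shows "((\<lambda>t. flow A t (r t)) has_vector_derivative A (flow A t (r t)) + flow A t r') (at t within S)"
proof -
  note L = linear_flow[OF A]
  have expand: "flow A s w = (\<Sum>b\<in>Basis. (w \<bullet> b) *\<^sub>R flow A s b)" for s w
  proof -
    have "flow A s w = flow A s (\<Sum>b\<in>Basis. (w \<bullet> b) *\<^sub>R b)"
      by (simp add: euclidean_representation)
    then show ?thesis by (simp add: linear_sum[OF L] linear_scale[OF L])
  qed
  have inner: "((\<lambda>t. r t \<bullet> b) has_field_derivative (r' \<bullet> b)) (at t within S)" for b
    using bounded_linear.has_vector_derivative[OF bounded_linear_inner_left r, of b]
    by (simp add: has_real_derivative_iff_has_vector_derivative)
  have "((\<lambda>t. \<Sum>b\<in>Basis. (r t \<bullet> b) *\<^sub>R flow A t b) has_vector_derivative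
     (\<Sum>b\<in>Basis. (r t \<bullet> b) *\<^sub>R A (flow A t b) + (r' \<bullet> b) *\<^sub>R flow A t b)) (at t within S)"
    by (intro has_vector_derivative_sum has_vector_derivative_scaleR inner
        flow_has_vector_derivative_at[OF A])
  moreover have "(\<Sum>b\<in>Basis. (r t \<bullet> b) *\<^sub>R A (flow A t b)) = A (flow A t (r t))"
    by (subst (2) expand) (simp add: linear_sum[OF A] linear_scale[OF A])
  ultimately show ?thesis
    by (simp add: sum.distrib flip: expand)
qed

lemma has_vector_derivative_flow_minus:
  fixes A :: "'v::euclidean_space \<Rightarrow> 'v"
  assumes A: "linear A" and r: "(r has_vector_derivative r') (at t within S)"
  shows "((\<lambda>t. flow A (- t) (r t)) has_vector_derivative flow A (- t) (r' - A (r t))) (at t within S)"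
proof -
  have minus: "linear (\<lambda>x. - A x)" using A by (simp add: linear_compose_neg)
  have eq: "flow A (- s) w = flow (\<lambda>x. - A x) s w" for s w
    by (simp add: flow_def)
  show ?thesis
    using flow_has_vector_derivative[OF minus r]
    by (simp add: eq linear_diff[OF linear_flow[OF minus]] linear_neg[OF linear_flow[OF minus]]
        flow_commute[OF minus, symmetric])
qed

text \<open>
  Transporting a solution back along the flow gives a curve with vanishing derivative.
\<close>

lemma flow_solves_ode_unique:
  fixes A :: "'v::euclidean_space \<Rightarrow> 'v"
  assumes A: "linear A" and S: "convex S" "0 \<in> S" "t \<in> S"
    and r: "\<And>t. t \<in> S \<Longrightarrow> (r has_vector_derivative A (r t)) (at t within S)"
  shows "flow A (- t) (r t) = r 0"
proof -
  have "((\<lambda>t. flow A (- t) (r t)) has_vector_derivative 0) (at t within S)" if "t \<in> S" for t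
    using has_vector_derivative_flow_minus[OF A r[OF that]]
    by (simp add: linear_0[OF linear_flow[OF A]])
  then obtain c where "\<And>t. t \<in> S \<Longrightarrow> flow A (- t) (r t) = c"
    using has_vector_derivative_zero_constant[OF S(1)] by metis
  then show ?thesis using S flow_0[OF A] by (metis minus_zero)
qed

lemma flow_minus_flow:
  fixes A :: "'v::euclidean_space \<Rightarrow> 'v"
  assumes A: "linear A"
  shows "flow A (- t) (flow A t v) = v" "flow A t (flow A (- t) v) = v"
proof -
  show *: "flow A (- t) (flow A t v) = v" for t v
    using flow_solves_ode_unique[OF A, of UNIV t "\<lambda>t. flow A t v"]
      flow_has_vector_derivative_at[OF A] by (simp add: flow_0[OF A])
  show "flow A t (flow A (- t) v) = v" using *[of "- t"] by simp
qed

lemma flow_unique: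
  fixes A :: "'v::euclidean_space \<Rightarrow> 'v"
  assumes A: "linear A" and S: "convex S" "0 \<in> S" "t \<in> S"
    and r: "\<And>t. t \<in> S \<Longrightarrow> (r has_vector_derivative A (r t)) (at t within S)"
  shows "r t = flow A t (r 0)"
  using flow_solves_ode_unique[OF assms] flow_minus_flow[OF A] by metis

lemma flow_norm_le:
  fixes A :: "'v::euclidean_space \<Rightarrow> 'v"
  assumes A: "linear A" and K: "\<And>v. norm (A v) \<le> K * norm v" "0 \<le> K"
  shows "norm (flow A t v) \<le> exp (\<bar>t\<bar> * K) * norm v"
proof -
  have le: "norm ((t ^ n / fact n) *\<^sub>R (A ^^ n) v) \<le> (\<bar>t\<bar> * K) ^ n /\<^sub>R fact n * norm v" for n
    using mult_left_mono[OF funpow_norm_le[OF K, of n v], of "\<bar>t\<bar> ^ n / fact n"]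
    by (simp add: power_abs power_mult_distrib field_simps)
  have "(\<lambda>n. (\<bar>t\<bar> * K) ^ n /\<^sub>R fact n * norm v) sums (exp (\<bar>t\<bar> * K) * norm v)"
    by (intro sums_mult2 exp_converges)
  then show ?thesis
    using norm_suminf_le[of _ "\<lambda>n. (\<bar>t\<bar> * K) ^ n /\<^sub>R fact n * norm v", OF le] flow_sums[OF A, of t v]
    by (auto simp: sums_iff)
qed

lemma flow_in_subspace:
  fixes A :: "'v::euclidean_space \<Rightarrow> 'v"
  assumes A: "linear A" and S: "subspace S" "\<And>x. x \<in> S \<Longrightarrow> A x \<in> S" and v: "v \<in> S"
  shows "flow A t v \<in> S"
proof -
  have "(A ^^ n) v \<in> S" for n by (induction n) (use S v in auto)
  then have "(\<Sum>i<n. (t ^ i / fact i) *\<^sub>R (A ^^ i) v) \<in> S" for n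
    using S by (intro subspace_sum subspace_scale)
  moreover have "(\<lambda>n. \<Sum>i<n. (t ^ i / fact i) *\<^sub>R (A ^^ i) v) \<longlonglongrightarrow> flow A t v"
    using flow_sums[OF A] by (simp add: sums_def)
  ultimately show ?thesis
    by (rule closed_sequentially[OF closed_subspace[OF S(1)]])
qed

text \<open>
  A linear map out of a Euclidean space is continuous whatever the norm of its target, so it
  carries the convergent series over. This is how statements about
  exponentials reach a finite-dimensional space with an arbitrary norm.
\<close>

lemma exp_linear_intertwine:
  fixes A :: "'v::euclidean_space \<Rightarrow> 'v" and A' :: "'w::real_normed_vector \<Rightarrow> 'w"
  assumes A: "linear A" and F: "linear F" and comm: "\<And>x. F (A x) = A' (F x)"
  shows "F (exp_linear A v) = exp_linear A' (F v)"
proof -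
  have pow: "F ((A ^^ n) x) = (A' ^^ n) (F x)" for n x
    by (induction n) (simp_all add: comm)
  have "(\<lambda>n. F ((A ^^ n) v /\<^sub>R fact n)) sums F (exp_linear A v)"
    using F by (intro bounded_linear.sums[OF _ exp_linear_sums[OF A]] linear_conv_bounded_linear[THEN iffD1])
  then have "(\<lambda>n. (A' ^^ n) (F v) /\<^sub>R fact n) sums F (exp_linear A v)"
    by (simp add: linear_scale[OF F] pow)
  then show ?thesis by (simp add: exp_linear_def sums_iff)
qed

lemma vector_differentiable_bound:
  fixes r :: "real \<Rightarrow> 'v::real_normed_vector"
  assumes "\<And>t. t \<in> {0..1} \<Longrightarrow> (r has_vector_derivative r' t) (at t within {0..1})"
    and "\<And>t. t \<in> {0..1} \<Longrightarrow> norm (r' t) \<le> B" and "t \<in> {0..1}"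
  shows "norm (r t - r 0) \<le> B"
proof -
  have B: "0 \<le> B" using order_trans[OF norm_ge_zero assms(2)[of 0]] by simp
  have "norm (r t - r 0) \<le> B * norm (t - 0)"
  proof (rule differentiable_bound[of "{0..1}" r "\<lambda>t h. h *\<^sub>R r' t"])
    show "onorm (\<lambda>h. h *\<^sub>R r' x) \<le> B" if "x \<in> {0..1}" for x
      using assms(2)[OF that] by (intro onorm_le) (simp add: mult.commute[of B] mult_left_mono)
  qed (use assms in \<open>auto simp: has_vector_derivative_def\<close>)
  also have "\<dots> \<le> B * 1" using assms(3) B by (intro mult_left_mono) auto
  finally show ?thesis by simp
qed

text \<open>
  A form of Gronwall's inequality; with \<open>e = 0\<close> it is a uniqueness statement.
\<close>

lemma linear_ode_growth:
  fixes A :: "'v::euclidean_space \<Rightarrow> 'v"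
  assumes A: "linear A" and K: "\<And>v. norm (A v) \<le> K * norm v" "0 \<le> K"
    and r: "\<And>t. t \<in> {0..1} \<Longrightarrow> (r has_vector_derivative A (r t) + f t) (at t within {0..1})"
    and f: "\<And>t. t \<in> {0..1} \<Longrightarrow> norm (f t) \<le> e" and "r 0 = 0" "t \<in> {0..1}"
  shows "norm (r t) \<le> exp (2 * K) * e"
proof -
  have flow_le: "norm (flow A s w) \<le> exp K * norm w" if "\<bar>s\<bar> \<le> 1" for s w
  proof -
    have "\<bar>s\<bar> * K \<le> K" using that K(2) by (simp add: mult_left_le_one_le)
    then show ?thesis
      using flow_norm_le[OF A K, of s w] mult_right_mono[of "exp (\<bar>s\<bar> * K)" "exp K" "norm w"] by simp
  qed
  have "norm (flow A (- t) (r t) - flow A (- 0) (r 0)) \<le> exp K * e"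
  proof (rule vector_differentiable_bound[OF _ _ \<open>t \<in> {0..1}\<close>])
    fix s :: real assume s: "s \<in> {0..1}"
    show "((\<lambda>s. flow A (- s) (r s)) has_vector_derivative flow A (- s) (f s)) (at s within {0..1})"
      using has_vector_derivative_flow_minus[OF A r[OF s]] by simp
    have "norm (flow A (- s) (f s)) \<le> exp K * norm (f s)" using s by (intro flow_le) auto
    also have "\<dots> \<le> exp K * e" using f[OF s] by simp
    finally show "norm (flow A (- s) (f s)) \<le> exp K * e" .
  qed
  then have *: "norm (flow A (- t) (r t)) \<le> exp K * e"
    using \<open>r 0 = 0\<close> by (simp add: flow_0[OF A])
  have "norm (r t) = norm (flow A t (flow A (- t) (r t)))" by (simp add: flow_minus_flow[OF A])
  also have "\<dots> \<le> exp K * norm (flow A (- t) (r t))" using \<open>t \<in> {0..1}\<close> by (intro flow_le) auto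
  also have "\<dots> \<le> exp K * (exp K * e)" using * by simp
  also have "\<dots> = exp (2 * K) * e" by (simp only: mult_2 exp_add mult.assoc)
  finally show ?thesis .
qed

section \<open>Accumulation in uncountable sets\<close>

text \<open>
  Otherwise each point of \<open>S\<close> would be isolated by a member of a countable basis.
\<close>

lemma uncountable_has_limit_point:
  fixes S :: "'a::second_countable_topology set"
  assumes "uncountable S"
  obtains x where "x \<in> S" "\<And>U. open U \<Longrightarrow> x \<in> U \<Longrightarrow> \<exists>y\<in>S. y \<in> U \<and> y \<noteq> x"
proof -
  obtain B :: "'a set set" where B: "countable B" "topological_basis B"
    using ex_countable_basis by blast
  show thesis
  proof (rule ccontr)
    assume "\<not> thesis"
    with that have "\<forall>x\<in>S. \<exists>U. open U \<and> x \<in> U \<and> (\<forall>y\<in>S. y \<in> U \<longrightarrow> y = x)" by metis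
    then have "\<forall>x\<in>S. \<exists>V\<in>B. x \<in> V \<and> (\<forall>y\<in>S. y \<in> V \<longrightarrow> y = x)"
      using topological_basisE[OF B(2)] by (metis subsetD)
    then obtain V where V: "\<And>x. x \<in> S \<Longrightarrow> V x \<in> B \<and> x \<in> V x \<and> (\<forall>y\<in>S. y \<in> V x \<longrightarrow> y = x)"
      by metis
    then have "inj_on V S" by (metis inj_onI)
    moreover have "V ` S \<subseteq> B" using V by blast
    ultimately have "countable S" using B(1) countable_image_inj_on countable_subset by metis
    with assms show False by contradiction
  qed
qed

section \<open>Lie algebras with an involution and their exponentials\<close>

lemma exp_linear_zero:
  fixes v :: "'v::euclidean_space"
  shows "exp_linear (\<lambda>x. 0) v = v"
proof -
  have "linear (\<lambda>x. 0 :: 'v)" by (rule linear_zero)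
  from flow_0[OF this, of v] show ?thesis by (simp add: flow_def)
qed

text \<open>
  The common setting of all analytic arguments: \<open>K + P\<close> is an eigenspace decomposition under an
  involution (the sum need not exhaust the Lie algebra), and \<open>ad(base)\<close> has eigenvalues \<open>0, \<plusminus>i\<close>.
\<close>

locale symmetric_lie_algebra =
  fixes br :: "'v::euclidean_space \<Rightarrow> 'v \<Rightarrow> 'v" and K P :: "'v set" and base :: 'v
  assumes lie: "lie_bracket br"
    and subspace_K: "subspace K" and subspace_P: "subspace P"
    and KK: "\<And>x y. x \<in> K \<Longrightarrow> y \<in> K \<Longrightarrow> br x y \<in> K"
    and KP: "\<And>x y. x \<in> K \<Longrightarrow> y \<in> P \<Longrightarrow> br x y \<in> P"
    and PP: "\<And>x y. x \<in> P \<Longrightarrow> y \<in> P \<Longrightarrow> br x y \<in> K"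
    and base_P: "base \<in> P"
    and base_cube: "\<And>x. br base (br base (br base x)) = - br base x"
begin

lemma bilinear_br: "bilinear br" and br_self: "br x x = 0"
  and jacobi: "br x (br y z) + br y (br z x) + br z (br x y) = 0"
  using lie by (auto simp: lie_bracket_def)

lemma linear_br: "linear (br x)"
  using bilinear_br by (simp add: bilinear_def)

lemmas br_simps = bilinear_ladd[OF bilinear_br] bilinear_radd[OF bilinear_br]
  bilinear_lsub[OF bilinear_br] bilinear_rsub[OF bilinear_br]
  bilinear_lneg[OF bilinear_br] bilinear_rneg[OF bilinear_br]
  bilinear_lmul[OF bilinear_br] bilinear_rmul[OF bilinear_br]
  bilinear_lzero[OF bilinear_br] bilinear_rzero[OF bilinear_br]

lemma br_anti: "br x y = - br y x"
proof -
  have "br x y + br y x = br (x + y) (x + y)" by (simp add: br_simps br_self[of x] br_self[of y])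
  also have "\<dots> = 0" by (rule br_self)
  finally have "br x y + br y x = 0" .
  then show ?thesis by (simp add: eq_neg_iff_add_eq_0)
qed

lemma br_derivation: "br x (br y z) = br (br x y) z + br y (br x z)"
proof -
  have "br x (br y z) = - br z (br x y) - br y (br z x)"
    using jacobi[of x y z] by (simp add: algebra_simps eq_neg_iff_add_eq_0)
  then show ?thesis
    using br_anti[of z "br x y"] br_anti[of z x] by (simp add: br_simps)
qed

lemma bounded_bilinear_br: "bounded_bilinear br"
  using bilinear_br by (simp add: bilinear_conv_bounded_bilinear)

text \<open>
  A fixed operator bound for the bracket, so that the many estimates below share one constant.
\<close>

definition br_bound :: real where
  "br_bound = (SOME c. 0 < c \<and> (\<forall>x y. norm (br x y) \<le> c * norm x * norm y))"

lemma br_bound_pos: "0 < br_bound" and norm_br_le: "norm (br x y) \<le> br_bound * norm x * norm y"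
proof -
  have "\<exists>c>0. \<forall>x y. norm (br x y) \<le> c * norm x * norm y"
    using bilinear_bounded_pos[OF bilinear_br] by blast
  then have "\<exists>c. 0 < c \<and> (\<forall>x y. norm (br x y) \<le> c * norm x * norm y)" by blast
  then have "0 < br_bound \<and> (\<forall>x y. norm (br x y) \<le> br_bound * norm x * norm y)"
    unfolding br_bound_def by (rule someI_ex)
  then show "0 < br_bound" "norm (br x y) \<le> br_bound * norm x * norm y" by blast+
qed

lemma norm_br_le': "norm x \<le> a \<Longrightarrow> norm y \<le> b \<Longrightarrow> norm (br x y) \<le> br_bound * a * b"
proof -
  assume *: "norm x \<le> a" "norm y \<le> b"
  have "norm (br x y) \<le> br_bound * norm x * norm y" by (rule norm_br_le)
  also have "\<dots> \<le> br_bound * a * b"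
    using * br_bound_pos order_trans[OF norm_ge_zero *(1)] by (intro mult_mono) auto
  finally show ?thesis .
qed

abbreviation ead :: "'v \<Rightarrow> 'v \<Rightarrow> 'v" where
  "ead X \<equiv> exp_linear (br X)"

lemma ead_flow: "ead X v = flow (br X) 1 v"
  by (simp add: flow_1)

lemma linear_ead: "linear (ead X)"
proof -
  have "ead X = flow (br X) 1" by (simp add: fun_eq_iff ead_flow)
  then show ?thesis by (simp add: linear_flow[OF linear_br])
qed

lemma flow_br_norm_le:
  assumes "\<bar>t\<bar> \<le> 1"
  shows "norm (flow (br X) t v) \<le> exp (br_bound * norm X) * norm v"
proof -
  have "norm (flow (br X) t v) \<le> exp (\<bar>t\<bar> * (br_bound * norm X)) * norm v"
    using br_bound_pos by (intro flow_norm_le linear_br norm_br_le) auto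
  also have "\<bar>t\<bar> * (br_bound * norm X) \<le> br_bound * norm X"
    using assms br_bound_pos by (intro mult_left_le_one_le) auto
  then have "exp (\<bar>t\<bar> * (br_bound * norm X)) * norm v \<le> exp (br_bound * norm X) * norm v"
    by (intro mult_right_mono) auto
  finally show ?thesis .
qed

lemma ead_norm_le: "norm (ead X v) \<le> exp (br_bound * norm X) * norm v"
  using flow_br_norm_le[of 1] by (simp add: ead_flow)

lemma flow_br_bracket:
  "flow (br X) t (br u v) = br (flow (br X) t u) (flow (br X) t v)"
proof -
  define r where "r = (\<lambda>t. br (flow (br X) t u) (flow (br X) t v))"
  have "(r has_vector_derivative br X (r t)) (at t within UNIV)" for t
    using bounded_bilinear.has_vector_derivative[OF bounded_bilinear_br
        flow_has_vector_derivative_at[OF linear_br, of X u t UNIV]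
        flow_has_vector_derivative_at[OF linear_br, of X v t UNIV]]
    by (simp add: r_def br_derivation[of X] add.commute)
  then have "r t = flow (br X) t (r 0)"
    by (intro flow_unique[OF linear_br, of UNIV]) auto
  then show ?thesis by (simp add: r_def flow_0[OF linear_br])
qed

lemma ead_bracket: "ead X (br u v) = br (ead X u) (ead X v)"
  using flow_br_bracket[of X 1] by (simp add: ead_flow)

lemma ead_K: "X \<in> K \<Longrightarrow> v \<in> K \<Longrightarrow> ead X v \<in> K"
  unfolding ead_flow by (rule flow_in_subspace[OF linear_br subspace_K KK])

lemma ead_P: "X \<in> K \<Longrightarrow> v \<in> P \<Longrightarrow> ead X v \<in> P"
  unfolding ead_flow by (rule flow_in_subspace[OF linear_br subspace_P KP])

lemma ead_minus: "ead (- X) (ead X v) = v" "ead X (ead (- X) v) = v"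
proof -
  have "ead (- X) w = flow (br X) (- 1) w" for w
  proof -
    have "br (- X) = (\<lambda>x. (- 1) *\<^sub>R br X x)" by (simp add: fun_eq_iff br_simps)
    then show ?thesis unfolding flow_def by simp
  qed
  then show "ead (- X) (ead X v) = v" "ead X (ead (- X) v) = v"
    using flow_minus_flow[OF linear_br, of X 1 v] by (simp_all add: ead_flow)
qed

lemma ead_zero: "ead 0 v = v"
proof -
  have "br 0 = (\<lambda>x. 0)" by (simp add: fun_eq_iff br_simps)
  then show ?thesis by (simp add: exp_linear_zero)
qed

section \<open>The derivative of the exponential map\<close>

text \<open>
  The solution of \<open>Z' = [X, Z] + H\<close>, \<open>Z(0) = 0\<close>. Doubling the space turns this
  inhomogeneous equation into a linear one, so that existence and linearity in \<open>H\<close> come for free.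
\<close>

definition dexp_curve :: "'v \<Rightarrow> 'v \<Rightarrow> real \<Rightarrow> 'v" where
  "dexp_curve X H t = fst (flow (\<lambda>(z, h). (br X z + h, 0)) t (0, H))"

text \<open>
  The value at 1 is \<open>(e\<^bsup>ad X\<^esup> - 1) / ad X\<close> applied to \<open>H\<close>, the right logarithmic derivative
  of the exponential map at \<open>X\<close> in direction \<open>H\<close>.
\<close>

definition dexp :: "'v \<Rightarrow> 'v \<Rightarrow> 'v" where
  "dexp X H = dexp_curve X H 1"

lemma linear_dexp_generator: "linear (\<lambda>(z, h). (br X z + h, 0 :: 'v))"
  by (rule linearI) (auto simp: br_simps algebra_simps)

lemma dexp_curve_0: "dexp_curve X H 0 = 0"
  by (simp add: dexp_curve_def flow_0[OF linear_dexp_generator])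

lemma dexp_curve_deriv:
  "(dexp_curve X H has_vector_derivative br X (dexp_curve X H t) + H) (at t within S)"
proof -
  define A where "A = (\<lambda>(z, h). (br X z + h, 0 :: 'v))"
  have A: "linear A" unfolding A_def by (rule linear_dexp_generator)
  have "snd (flow A t (0, H)) = H"
    unfolding flow_def
    by (subst exp_linear_intertwine[where A' = "\<lambda>_. 0" and F = snd])
      (use A in \<open>auto simp: A_def exp_linear_zero linear_compose_scale_right linear_snd\<close>)
  then have "fst (A (flow A t (0, H))) = br X (dexp_curve X H t) + H"
    by (simp add: A_def dexp_curve_def case_prod_beta)
  with bounded_linear.has_vector_derivative[OF bounded_linear_fst
      flow_has_vector_derivative_at[OF A, of "(0, H)" t S]]
  show ?thesis by (simp add: dexp_curve_def[abs_def] A_def)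
qed

lemma linear_dexp: "linear (dexp X)"
proof -
  have "linear (\<lambda>H. (0 :: 'v, H))" by (rule linearI) auto
  from linear_compose[OF linear_compose[OF this linear_flow[OF linear_dexp_generator]] linear_fst]
  have "linear (\<lambda>H. dexp X H)" by (simp add: dexp_def dexp_curve_def o_def)
  then show ?thesis .
qed

lemma dexp_K:
  assumes "X \<in> K" "H \<in> K"
  shows "dexp X H \<in> K"
proof -
  have "flow (\<lambda>(z, h). (br X z + h, 0 :: 'v)) 1 (0, H) \<in> K \<times> K"
    using assms subspace_K subspace_0[OF subspace_K]
    by (intro flow_in_subspace linear_dexp_generator subspace_Times)
      (auto intro: subspace_add KK)
  then show ?thesis by (auto simp: dexp_def dexp_curve_def)
qed

lemma dexp_norm_le: "norm (dexp X H) \<le> exp (2 * (br_bound * norm X)) * norm H"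
  unfolding dexp_def
  by (rule linear_ode_growth[where r = "dexp_curve X H" and f = "\<lambda>_. H", OF linear_br norm_br_le])
    (use br_bound_pos dexp_curve_deriv in \<open>auto simp: dexp_curve_0\<close>)

lemma dexp_minus_id_norm_le:
  "norm (dexp X H - H) \<le> exp (2 * (br_bound * norm X)) * (br_bound * norm X * norm H)"
proof -
  define r where "r = (\<lambda>t. dexp_curve X H t - t *\<^sub>R H)"
  have "norm (r 1) \<le> exp (2 * (br_bound * norm X)) * (br_bound * norm X * norm H)"
  proof (rule linear_ode_growth[where f = "\<lambda>t. t *\<^sub>R br X H", OF linear_br norm_br_le])
    fix t :: real assume t: "t \<in> {0..1}"
    show "(r has_vector_derivative br X (r t) + t *\<^sub>R br X H) (at t within {0..1})"
      unfolding r_def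
      by (auto intro!: derivative_eq_intros dexp_curve_deriv simp: br_simps)
    show "norm (t *\<^sub>R br X H) \<le> br_bound * norm X * norm H"
      using t norm_br_le[of X H] mult_left_le_one_le[of "norm (br X H)" t] by auto
  qed (use br_bound_pos in \<open>auto simp: r_def dexp_curve_0\<close>)
  then show ?thesis by (simp add: r_def dexp_def)
qed

lemma flow_br_diff_norm_le:
  assumes "t \<in> {0..1}"
  shows "norm (flow (br (X + H)) t v - flow (br X) t v)
    \<le> exp (2 * (br_bound * norm X)) * (br_bound * norm H * (exp (br_bound * norm (X + H)) * norm v))"
proof (rule linear_ode_growth[where r = "\<lambda>t. flow (br (X + H)) t v - flow (br X) t v"
      and f = "\<lambda>t. br H (flow (br (X + H)) t v)", OF linear_br norm_br_le])
  fix t :: real assume t: "t \<in> {0..1}"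
  show "((\<lambda>t. flow (br (X + H)) t v - flow (br X) t v) has_vector_derivative
      br X (flow (br (X + H)) t v - flow (br X) t v) + br H (flow (br (X + H)) t v)) (at t within {0..1})"
    by (auto intro!: derivative_eq_intros flow_has_vector_derivative_at linear_br simp: br_simps)
  show "norm (br H (flow (br (X + H)) t v))
      \<le> br_bound * norm H * (exp (br_bound * norm (X + H)) * norm v)"
    using t by (intro norm_br_le' flow_br_norm_le) auto
qed (use assms br_bound_pos in \<open>auto simp: flow_0[OF linear_br]\<close>)

lemma ead_diff_norm_le:
  "norm (ead (X + H) v - ead X v)
    \<le> exp (2 * (br_bound * norm X)) * (br_bound * norm H * (exp (br_bound * norm (X + H)) * norm v))"
  using flow_br_diff_norm_le[of 1] by (simp add: ead_flow)

text \<open>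
  With \<open>u(t) = e\<^bsup>t ad(X + H)\<^esup> v\<close> and \<open>w(t) = e\<^bsup>t ad X\<^esup> v\<close>, the Jacobi identity shows that the
  error \<open>r = u - w - [Z, w]\<close> solves \<open>r' = [X, r] + [H, u - w]\<close>, whose inhomogeneity is of second
  order in \<open>H\<close>.
\<close>

lemma ead_second_order:
  "norm (ead (X + H) v - ead X v - br (dexp X H) (ead X v))
    \<le> exp (2 * (br_bound * norm X)) * (br_bound * norm H * (exp (2 * (br_bound * norm X)) *
        (br_bound * norm H * (exp (br_bound * norm (X + H)) * norm v))))"
proof -
  define u where "u = (\<lambda>t. flow (br (X + H)) t v)"
  define w where "w = (\<lambda>t. flow (br X) t v)"
  define r where "r = (\<lambda>t. u t - w t - br (dexp_curve X H t) (w t))"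
  have "norm (r 1) \<le> exp (2 * (br_bound * norm X)) * (br_bound * norm H * (exp (2 * (br_bound * norm X)) *
        (br_bound * norm H * (exp (br_bound * norm (X + H)) * norm v))))"
  proof (rule linear_ode_growth[where f = "\<lambda>t. br H (u t - w t)", OF linear_br norm_br_le])
    fix t :: real assume t: "t \<in> {0..1}"
    have "(r has_vector_derivative
        br (X + H) (u t) - br X (w t) -
         (br (dexp_curve X H t) (br X (w t)) + br (br X (dexp_curve X H t) + H) (w t))) (at t within {0..1})"
      unfolding r_def u_def w_def
      by (intro has_vector_derivative_diff flow_has_vector_derivative_at linear_br dexp_curve_deriv
          bounded_bilinear.has_vector_derivative[OF bounded_bilinear_br])
    moreover have "br (X + H) (u t) - br X (w t) -
         (br (dexp_curve X H t) (br X (w t)) + br (br X (dexp_curve X H t) + H) (w t))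
        = br X (r t) + br H (u t - w t)"
      using br_derivation[of X "dexp_curve X H t" "w t"]
      by (simp add: r_def br_simps)
    ultimately show "(r has_vector_derivative br X (r t) + br H (u t - w t)) (at t within {0..1})"
      by simp
    show "norm (br H (u t - w t)) \<le> br_bound * norm H * (exp (2 * (br_bound * norm X)) *
        (br_bound * norm H * (exp (br_bound * norm (X + H)) * norm v)))"
      unfolding u_def w_def using t by (intro norm_br_le' flow_br_diff_norm_le) auto
  qed (use br_bound_pos in \<open>auto simp: r_def u_def w_def dexp_curve_0 flow_0[OF linear_br] br_simps\<close>)
  then show ?thesis by (simp add: r_def u_def w_def ead_flow dexp_def)
qed

lemma ead_has_derivative:
  "((\<lambda>X. ead X v) has_derivative (\<lambda>H. br (dexp X H) (ead X v))) (at X)"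
proof (rule has_derivativeI_sandwich[of 1])
  define C where "C = exp (2 * (br_bound * norm X)) * (br_bound * (exp (2 * (br_bound * norm X)) *
        (br_bound * (exp (br_bound * (norm X + 1)) * norm v))))"
  show "bounded_linear (\<lambda>H. br (dexp X H) (ead X v))"
    unfolding linear_conv_bounded_linear[symmetric]
    by (rule linearI) (simp_all add: linear_add[OF linear_dexp] linear_scale[OF linear_dexp] br_simps)
  show "norm (ead Y v - ead X v - br (dexp X (Y - X)) (ead X v)) / norm (Y - X) \<le> C * norm (Y - X)"
    if "Y \<noteq> X" "dist Y X < 1" for Y
  proof -
    have "norm Y \<le> norm X + 1"
      using that norm_triangle_ineq2[of Y X] by (simp add: dist_norm)
    then have "exp (br_bound * norm Y) \<le> exp (br_bound * (norm X + 1))"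
      using br_bound_pos by simp
    then have "exp (2 * (br_bound * norm X)) * (br_bound * norm (Y - X) * (exp (2 * (br_bound * norm X)) *
        (br_bound * norm (Y - X) * (exp (br_bound * norm Y) * norm v))))
      \<le> exp (2 * (br_bound * norm X)) * (br_bound * norm (Y - X) * (exp (2 * (br_bound * norm X)) *
        (br_bound * norm (Y - X) * (exp (br_bound * (norm X + 1)) * norm v))))"
      using br_bound_pos by (intro mult_left_mono mult_right_mono) auto
    also have "\<dots> = C * norm (Y - X) * norm (Y - X)" by (simp add: C_def)
    finally have "norm (ead Y v - ead X v - br (dexp X (Y - X)) (ead X v)) \<le> C * norm (Y - X) * norm (Y - X)"
      using ead_second_order[of X "Y - X" v] by simp
    then show ?thesis using that by (simp add: divide_le_eq)
  qed
  show "((\<lambda>Y. C * norm (Y - X)) \<longlongrightarrow> 0) (at X)"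
    by (auto intro!: tendsto_eq_intros)
qed simp

text \<open>
  The derivative consists of an infinitesimal motion \<open>[Z, \<cdot>]\<close> with \<open>Z\<close> in the acting subalgebra
  and the transported derivative of \<open>v\<close>; curves moving along the orbit therefore stay such curves
  when exponentials with variable exponents are applied.
\<close>

lemma ead_has_vector_derivative:
  assumes X: "(X has_vector_derivative X') (at s within S)"
    and v: "(v has_vector_derivative v') (at s within S)"
  shows "((\<lambda>s. ead (X s) (v s)) has_vector_derivative
    br (dexp (X s) X') (ead (X s) (v s)) + ead (X s) v') (at s within S)"
proof -
  have expand: "ead Y w = (\<Sum>b\<in>Basis. (w \<bullet> b) *\<^sub>R ead Y b)" for Y w
  proof -
    have "ead Y w = ead Y (\<Sum>b\<in>Basis. (w \<bullet> b) *\<^sub>R b)"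
      by (simp add: euclidean_representation)
    then show ?thesis by (simp add: linear_sum[OF linear_ead] linear_scale[OF linear_ead])
  qed
  have inner: "((\<lambda>s. v s \<bullet> b) has_field_derivative (v' \<bullet> b)) (at s within S)" for b
    using bounded_linear.has_vector_derivative[OF bounded_linear_inner_left v, of b]
    by (simp add: has_real_derivative_iff_has_vector_derivative)
  have chain: "((\<lambda>s. ead (X s) b) has_vector_derivative br (dexp (X s) X') (ead (X s) b)) (at s within S)" for b
    using has_derivative_compose[OF X[unfolded has_vector_derivative_def] ead_has_derivative]
    by (simp add: has_vector_derivative_def linear_scale[OF linear_dexp] br_simps)
  have "((\<lambda>s. \<Sum>b\<in>Basis. (v s \<bullet> b) *\<^sub>R ead (X s) b) has_vector_derivative
     (\<Sum>b\<in>Basis. (v s \<bullet> b) *\<^sub>R br (dexp (X s) X') (ead (X s) b) + (v' \<bullet> b) *\<^sub>R ead (X s) b)) (at s within S)"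
    by (intro has_vector_derivative_sum has_vector_derivative_scaleR inner chain)
  moreover have "(\<Sum>b\<in>Basis. (v s \<bullet> b) *\<^sub>R br (dexp (X s) X') (ead (X s) b))
      = br (dexp (X s) X') (ead (X s) (v s))"
    by (subst (2) expand) (simp add: linear_sum[OF linear_br] linear_scale[OF linear_br])
  ultimately show ?thesis
    by (simp add: sum.distrib flip: expand)
qed

section \<open>The orbit of the base point\<close>

inductive_set orbit :: "'v set" where
  base_orbit: "base \<in> orbit"
| ead_orbit: "X \<in> K \<Longrightarrow> m \<in> orbit \<Longrightarrow> ead X m \<in> orbit"

lemma orbit_P: "m \<in> orbit \<Longrightarrow> m \<in> P"
  by (induction rule: orbit.induct) (auto intro: base_P ead_P)

text \<open>
  The exponentials act by automorphisms, so the identity holds at each point once it holds at the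
  base point.
\<close>

lemma orbit_cube: "m \<in> orbit \<Longrightarrow> br m (br m (br m x)) = - br m x"
proof (induction arbitrary: x rule: orbit.induct)
  case base_orbit show ?case by (rule base_cube)
next
  case (ead_orbit X m)
  define y where "y = ead (- X) x"
  have x: "x = ead X y" by (simp add: y_def ead_minus)
  show ?case
    by (simp add: x ead_orbit.IH linear_neg[OF linear_ead] flip: ead_bracket)
qed

text \<open>
  Tangent vectors \<open>[k, m]\<close> of the orbit satisfy an equation that is polynomial in \<open>m\<close> and makes
  no reference to the group; this is what makes tangency a closed condition.
\<close>

lemma orbit_tangent:
  assumes "m \<in> orbit"
  shows "br m (br m (br k m)) = - br k m"
  using orbit_cube[OF assms, of k] br_anti[of k m] by (simp add: br_simps)

text \<open>
  A path whose velocity is an infinitesimal motion at each time. In contrast to an arbitrary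
  differentiable curve inside the set \<open>orbit\<close>, it cannot leave the leaf in which it starts.
\<close>

definition orbit_path :: "(real \<Rightarrow> 'v) \<Rightarrow> (real \<Rightarrow> 'v) \<Rightarrow> bool" where
  "orbit_path m m' \<longleftrightarrow> (\<forall>s\<in>{0..1}. m s \<in> orbit \<and>
     (m has_vector_derivative m' s) (at s within {0..1}) \<and> (\<exists>k\<in>K. m' s = br k (m s)))"

lemma orbit_path_tangent:
  "orbit_path m m' \<Longrightarrow> s \<in> {0..1} \<Longrightarrow> br (m s) (br (m s) (m' s)) = - m' s"
  unfolding orbit_path_def using orbit_tangent by metis

lemma orbit_path_ead:
  assumes m: "orbit_path m m'"
    and X: "\<And>s. s \<in> {0..1} \<Longrightarrow> X s \<in> K" "\<And>s. s \<in> {0..1} \<Longrightarrow> X' s \<in> K"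
      "\<And>s. s \<in> {0..1} \<Longrightarrow> (X has_vector_derivative X' s) (at s within {0..1})"
  shows "orbit_path (\<lambda>s. ead (X s) (m s))
    (\<lambda>s. br (dexp (X s) (X' s)) (ead (X s) (m s)) + ead (X s) (m' s))"
  unfolding orbit_path_def
proof (intro ballI conjI)
  fix s :: real assume s: "s \<in> {0..1}"
  from m s obtain k where k: "m s \<in> orbit" "k \<in> K" "m' s = br k (m s)"
    "(m has_vector_derivative m' s) (at s within {0..1})"
    unfolding orbit_path_def by blast
  show "ead (X s) (m s) \<in> orbit" using X(1)[OF s] k(1) by (rule ead_orbit)
  show "((\<lambda>s. ead (X s) (m s)) has_vector_derivative
      br (dexp (X s) (X' s)) (ead (X s) (m s)) + ead (X s) (m' s)) (at s within {0..1})"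
    by (rule ead_has_vector_derivative[OF X(3)[OF s] k(4)])
  show "\<exists>k\<in>K. br (dexp (X s) (X' s)) (ead (X s) (m s)) + ead (X s) (m' s) = br k (ead (X s) (m s))"
  proof (rule bexI)
    show "br (dexp (X s) (X' s)) (ead (X s) (m s)) + ead (X s) (m' s)
        = br (dexp (X s) (X' s) + ead (X s) k) (ead (X s) (m s))"
      by (simp add: k(3) ead_bracket br_simps)
    show "dexp (X s) (X' s) + ead (X s) k \<in> K"
      using X s k(2) by (intro subspace_add[OF subspace_K] dexp_K ead_K) auto
  qed
qed

section \<open>A contraction towards the base point\<close>

text \<open>
  Near the base point, \<open>xi m\<close> measures the tangential displacement of \<open>m\<close>: it vanishes on the
  kernel of \<open>ad(base)\<close> and lies in \<open>K\<close> for \<open>m \<in> P\<close>.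
\<close>

definition xi :: "'v \<Rightarrow> 'v" where
  "xi m = br m base"

text \<open>
  The projection onto the kernel of \<open>ad(base)\<close> along its image.
\<close>

definition normal_part :: "'v \<Rightarrow> 'v" where
  "normal_part x = x + br base (br base x)"

text \<open>
  A Newton step inside the group: to first order, the exponential of \<open>xi m\<close> removes the
  tangential displacement of \<open>m\<close>.
\<close>

definition newton :: "'v \<Rightarrow> 'v" where
  "newton m = ead (xi m) m"

lemma linear_normal_part: "linear normal_part"
  by (rule linearI) (simp_all add: normal_part_def br_simps scaleR_add_right)

lemma linear_xi: "linear xi"
  by (rule linearI) (simp_all add: xi_def br_simps)

lemma xi_diff: "xi m = br (m - base) base"
  by (simp add: xi_def br_simps br_self)

lemma xi_norm_le: "norm (xi m) \<le> br_bound * norm base * norm (m - base)"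
  using norm_br_le[of "m - base" base] by (simp add: xi_diff mult_ac)

lemma normal_part_norm_le: "norm (normal_part x) \<le> (1 + (br_bound * norm base)\<^sup>2) * norm x"
proof -
  have "norm (br base (br base x)) \<le> br_bound * norm base * (br_bound * norm base * norm x)"
    by (intro norm_br_le' norm_br_le order_refl)
  then have "norm (normal_part x) \<le> norm x + br_bound * norm base * (br_bound * norm base * norm x)"
    unfolding normal_part_def by (rule norm_triangle_le[OF add_left_mono])
  then show ?thesis by (simp add: power2_eq_square algebra_simps)
qed

lemma dexp_0: "dexp 0 H = H"
  using dexp_minus_id_norm_le[of 0 H] by simp

lemma ead_near:
  assumes "norm X \<le> R"
  shows "norm (ead X v - v) \<le> br_bound * exp (br_bound * R) * norm X * norm v"
proof -
  have "norm (ead X v - v) \<le> br_bound * norm X * (exp (br_bound * norm X) * norm v)"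
    using ead_diff_norm_le[of 0 X v] by (simp add: ead_zero)
  also have "\<dots> \<le> br_bound * norm X * (exp (br_bound * R) * norm v)"
    using br_bound_pos assms by (intro mult_left_mono mult_right_mono) auto
  finally show ?thesis by (simp add: mult_ac)
qed

lemma ead_near2:
  assumes "norm X \<le> R"
  shows "norm (ead X v - v - br X v)
    \<le> br_bound * br_bound * exp (br_bound * R) * norm X * norm X * norm v"
proof -
  have "norm (ead X v - v - br X v)
      \<le> br_bound * norm X * (br_bound * norm X * (exp (br_bound * norm X) * norm v))"
    using ead_second_order[of 0 X v] by (simp add: ead_zero dexp_0)
  also have "\<dots> \<le> br_bound * norm X * (br_bound * norm X * (exp (br_bound * R) * norm v))"
    using br_bound_pos assms by (intro mult_left_mono mult_right_mono) auto
  finally show ?thesis by (simp add: mult_ac)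
qed

lemma norm_near_base: "norm (m - base) \<le> 1 \<Longrightarrow> norm m \<le> norm base + 1"
  using norm_triangle_ineq2[of m base] by simp

lemma xi_norm_le_1:
  assumes "norm (m - base) \<le> 1"
  shows "norm (xi m) \<le> br_bound * norm base"
proof -
  have "norm (xi m) \<le> br_bound * norm base * norm (m - base)" by (rule xi_norm_le)
  also have "\<dots> \<le> br_bound * norm base * 1" using assms br_bound_pos by (intro mult_left_mono) auto
  finally show ?thesis by simp
qed

lemma newton_displacement:
  "\<exists>C\<ge>0. \<forall>m. norm (m - base) \<le> 1 \<longrightarrow> norm (newton m - m) \<le> C * norm (xi m)"
proof (intro exI conjI allI impI)
  let ?E = "br_bound * exp (br_bound * (br_bound * norm base))"
  show "0 \<le> ?E * (norm base + 1)" using br_bound_pos by auto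
  fix m assume m: "norm (m - base) \<le> 1"
  have "norm (newton m - m) \<le> ?E * norm (xi m) * norm m"
    unfolding newton_def by (rule ead_near[OF xi_norm_le_1[OF m]])
  also have "\<dots> \<le> ?E * norm (xi m) * (norm base + 1)"
    using br_bound_pos norm_near_base[OF m] by (intro mult_left_mono) auto
  finally show "norm (newton m - m) \<le> ?E * (norm base + 1) * norm (xi m)"
    by (simp add: mult_ac)
qed

lemma newton_remainder:
  "\<exists>C\<ge>0. \<forall>m. norm (m - base) \<le> 1 \<longrightarrow>
     norm (newton m - m - br (xi m) m) \<le> C * (norm (m - base) * norm (xi m))"
proof (intro exI conjI allI impI)
  let ?E = "br_bound * br_bound * exp (br_bound * (br_bound * norm base))"
  let ?n = "br_bound * norm base"
  show "0 \<le> ?E * (?n * (norm base + 1))" using br_bound_pos by auto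
  fix m assume m: "norm (m - base) \<le> 1"
  have "norm (newton m - m - br (xi m) m) \<le> ?E * norm (xi m) * norm (xi m) * norm m"
    unfolding newton_def by (rule ead_near2[OF xi_norm_le_1[OF m]])
  also have "\<dots> \<le> ?E * norm (xi m) * (?n * norm (m - base)) * (norm base + 1)"
    using br_bound_pos norm_near_base[OF m] xi_norm_le[of m]
    by (intro mult_mono mult_left_mono) auto
  finally show "norm (newton m - m - br (xi m) m)
      \<le> ?E * (?n * (norm base + 1)) * (norm (m - base) * norm (xi m))"
    by (simp add: mult_ac)
qed

lemma xi_xi: "br (xi m) base = br base (br base m)" and xi_xi_xi: "br (br (xi m) base) base = - xi m"
proof -
  show *: "br (xi m) base = br base (br base m)"
    using br_anti[of m base] br_anti[of "br base m" base] by (simp add: xi_def br_simps)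
  show "br (br (xi m) base) base = - xi m"
    unfolding * using base_cube[of m] br_anti[of "br base (br base m)" base] br_anti[of m base]
    by (simp add: xi_def)
qed

text \<open>
  The terms of first order cancel because \<open>[[xi m, base], base] = - xi m\<close>.
\<close>

lemma newton_tangential:
  "\<exists>C\<ge>0. \<forall>m. norm (m - base) \<le> 1 \<longrightarrow> norm (xi (newton m)) \<le> C * (norm (m - base) * norm (xi m))"
proof -
  obtain F where F: "0 \<le> F" "\<And>m. norm (m - base) \<le> 1 \<Longrightarrow>
     norm (newton m - m - br (xi m) m) \<le> F * (norm (m - base) * norm (xi m))"
    using newton_remainder by blast
  let ?C = "br_bound * br_bound * norm base + br_bound * F * norm base"
  show ?thesis
  proof (intro exI conjI allI impI)
    show "0 \<le> ?C" using br_bound_pos F by auto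
    fix m assume m: "norm (m - base) \<le> 1"
    define r where "r = newton m - m - br (xi m) m"
    have N: "newton m = m + br (xi m) base + br (xi m) (m - base) + r"
      by (simp add: r_def br_simps)
    have "xi (newton m) = xi m + br (br (xi m) base) base + br (br (xi m) (m - base)) base + br r base"
      unfolding N by (simp add: xi_def br_simps)
    then have "xi (newton m) = br (br (xi m) (m - base)) base + br r base"
      by (simp add: xi_xi_xi)
    also have "norm \<dots> \<le> br_bound * (br_bound * norm (xi m) * norm (m - base)) * norm base
        + br_bound * (F * (norm (m - base) * norm (xi m))) * norm base"
      using F(2)[OF m] by (intro norm_triangle_mono norm_br_le' norm_br_le) (auto simp: r_def)
    finally show "norm (xi (newton m)) \<le> ?C * (norm (m - base) * norm (xi m))"
      by (simp add: algebra_simps)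
  qed
qed

text \<open>
  The first-order part \<open>[xi m, base]\<close> of the step lies in the image of \<open>ad(base)\<close>, so it has no
  normal part.
\<close>

lemma newton_normal:
  "\<exists>C\<ge>0. \<forall>m. norm (m - base) \<le> 1 \<longrightarrow>
     norm (normal_part (newton m - m)) \<le> C * (norm (m - base) * norm (xi m))"
proof -
  obtain F where F: "0 \<le> F" "\<And>m. norm (m - base) \<le> 1 \<Longrightarrow>
     norm (newton m - m - br (xi m) m) \<le> F * (norm (m - base) * norm (xi m))"
    using newton_remainder by blast
  let ?L = "1 + (br_bound * norm base)\<^sup>2"
  show ?thesis
  proof (intro exI conjI allI impI)
    show "0 \<le> ?L * (br_bound + F)" using br_bound_pos F by auto
    fix m assume m: "norm (m - base) \<le> 1"
    define r where "r = newton m - m - br (xi m) m"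
    have N: "newton m - m = br (xi m) base + (br (xi m) (m - base) + r)"
      by (simp add: r_def br_simps)
    have "normal_part (br (xi m) base) = 0"
      unfolding xi_xi normal_part_def using base_cube[of m] by (simp add: br_simps)
    then have "normal_part (newton m - m) = normal_part (br (xi m) (m - base) + r)"
      unfolding N by (simp add: linear_add[OF linear_normal_part])
    also have "norm \<dots> \<le> ?L * norm (br (xi m) (m - base) + r)" by (rule normal_part_norm_le)
    also have "\<dots> \<le> ?L * (br_bound * norm (xi m) * norm (m - base) + F * (norm (m - base) * norm (xi m)))"
      using F(2)[OF m] by (intro mult_left_mono norm_triangle_mono norm_br_le) (auto simp: r_def)
    finally show "norm (normal_part (newton m - m)) \<le> ?L * (br_bound + F) * (norm (m - base) * norm (xi m))"
      by (simp add: algebra_simps)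
  qed
qed

text \<open>
  At the base point the tangency equation says that the normal part vanishes; nearby the
  defect is proportional to the distance of \<open>m\<close> to the base point.
\<close>

lemma tangent_error:
  assumes tang: "br m (br m m') = - m'" and m: "norm (m - base) \<le> 1"
  shows "norm (normal_part m') \<le> br_bound * br_bound * (2 * norm base + 1) * norm (m - base) * norm m'"
proof -
  define d where "d = m - base"
  have d: "m = base + d" by (simp add: d_def)
  have "br m (br m m') = br base (br base m') + br d (br base m') + br m (br d m')"
    by (simp add: d br_simps)
  with tang have "normal_part m' = - (br d (br base m') + br m (br d m'))"
    by (simp add: normal_part_def algebra_simps eq_neg_iff_add_eq_0)
  then have "norm (normal_part m') = norm (br d (br base m') + br m (br d m'))"
    by (metis norm_minus_cancel)
  also have "\<dots> \<le> br_bound * norm d * (br_bound * norm base * norm m')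
      + br_bound * (norm base + 1) * (br_bound * norm d * norm m')"
    using norm_near_base[OF m] by (intro norm_triangle_mono norm_br_le' norm_br_le) auto
  finally show ?thesis by (simp add: d_def algebra_simps)
qed

lemma tangent_norm_le:
  assumes tang: "br m (br m m') = - m'" and m: "norm (m - base) \<le> 1"
    and small: "br_bound * br_bound * (2 * norm base + 1) * norm (m - base) \<le> 1 / 2"
  shows "norm m' \<le> 2 * br_bound * norm base * norm (xi m')"
proof -
  have "br base (br base m') = - br base (xi m')"
    using br_anti[of m' base] by (simp add: xi_def br_simps)
  then have "m' = br base (xi m') + normal_part m'"
    by (simp add: normal_part_def)
  then have "norm m' \<le> norm (br base (xi m')) + norm (normal_part m')"
    by (metis norm_triangle_ineq)
  also have "norm (br base (xi m')) \<le> br_bound * norm base * norm (xi m')" by (rule norm_br_le)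
  also have "norm (normal_part m') \<le> 1 / 2 * norm m'"
    using tangent_error[OF tang m] mult_right_mono[OF small, of "norm m'"] by simp
  finally show ?thesis by simp
qed

text \<open>
  The derivative of the Newton step along a path contracts tangential velocities, for the same
  reason for which the step itself contracts tangential displacements.
\<close>

lemma newton_derivative:
  assumes "0 \<le> C1"
  shows "\<exists>C\<ge>0. \<forall>m m'. norm (m - base) \<le> 1 \<longrightarrow> norm m' \<le> C1 * norm (xi m') \<longrightarrow>
     norm (xi (br (dexp (xi m) (xi m')) (newton m) + ead (xi m) m')) \<le> C * (norm (m - base) * norm (xi m'))"
proof -
  obtain C2 where C2: "0 \<le> C2" "\<And>m. norm (m - base) \<le> 1 \<Longrightarrow> norm (newton m - m) \<le> C2 * norm (xi m)"
    using newton_displacement by blast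
  let ?c = "br_bound" and ?n = "br_bound * norm base"
  let ?E = "exp (2 * (?c * ?n))" and ?E' = "?c * exp (?c * ?n)"
  let ?Y = "norm base + (1 + C2 * ?n)"
  let ?C = "?c * (?c * (?E * (?c * ?n)) * ?Y + ?c * (1 + C2 * ?n) + ?E' * ?n * C1) * norm base"
  have regroup: "c * (c * (e * (c * (n * d) * x)) * y + c * x * (w * d) + f * (n * d) * (a * x)) * b
      = c * (c * (e * (c * n)) * y + c * w + f * n * a) * b * (d * x)"
    for a b c d e f n w x y :: real
    by (simp add: algebra_simps)
  show ?thesis
  proof (intro exI[of _ ?C] conjI allI impI)
    show "0 \<le> ?C" using br_bound_pos assms C2 by auto
    fix m m' assume m: "norm (m - base) \<le> 1" and m': "norm m' \<le> C1 * norm (xi m')"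
    let ?d = "norm (m - base)" and ?x = "norm (xi m')"
    define Z where "Z = dexp (xi m) (xi m')"
    define y where "y = newton m"
    have xi_le: "norm (xi m) \<le> ?n * ?d" by (rule xi_norm_le)
    have "norm (y - base) \<le> norm (newton m - m) + norm (m - base)"
      using norm_triangle_ineq[of "newton m - m" "m - base"] by (simp add: y_def)
    also have "\<dots> \<le> C2 * (?n * ?d) + ?d"
      using C2(2)[OF m] mult_left_mono[OF xi_le C2(1)] by linarith
    finally have y_base: "norm (y - base) \<le> (1 + C2 * ?n) * ?d" by (simp add: algebra_simps)
    also have "\<dots> \<le> (1 + C2 * ?n) * 1"
      using m br_bound_pos C2(1) by (intro mult_left_mono) auto
    finally have y_le: "norm y \<le> ?Y"
      using norm_triangle_ineq2[of y base] by simp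
    have Z_le: "norm (Z - xi m') \<le> ?E * (?c * (?n * ?d) * ?x)"
    proof -
      have "norm (Z - xi m') \<le> exp (2 * (?c * norm (xi m))) * (?c * norm (xi m) * ?x)"
        unfolding Z_def by (rule dexp_minus_id_norm_le)
      also have "\<dots> \<le> ?E * (?c * (?n * ?d) * ?x)"
        using br_bound_pos xi_le xi_norm_le_1[OF m]
        by (intro mult_mono mult_right_mono mult_left_mono) auto
      finally show ?thesis .
    qed
    have e_le: "norm (ead (xi m) m' - m') \<le> ?E' * (?n * ?d) * (C1 * ?x)"
    proof -
      have "norm (ead (xi m) m' - m') \<le> ?E' * norm (xi m) * norm m'"
        by (rule ead_near[OF xi_norm_le_1[OF m]])
      also have "\<dots> \<le> ?E' * (?n * ?d) * (C1 * ?x)"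
        using br_bound_pos xi_le m' by (intro mult_mono mult_left_mono) auto
      finally show ?thesis .
    qed
    define e where "e = br (Z - xi m') y + br (xi m') (y - base) + (ead (xi m) m' - m')"
    have "br Z y + ead (xi m) m' = br (xi m') base + m' + e"
      by (simp add: e_def br_simps)
    then have "xi (br Z y + ead (xi m) m') = br (br (xi m') base) base + xi m' + br e base"
      by (simp add: xi_def br_simps)
    then have eq: "xi (br Z y + ead (xi m) m') = br e base"
      by (simp add: xi_xi_xi)
    have "norm (br e base) \<le> ?c * (?c * (?E * (?c * (?n * ?d) * ?x)) * ?Y + ?c * ?x * ((1 + C2 * ?n) * ?d)
        + ?E' * (?n * ?d) * (C1 * ?x)) * norm base"
      unfolding e_def
      by (intro norm_br_le' norm_triangle_mono norm_br_le e_le Z_le y_le y_base order_refl)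
    then have "norm (br e base) \<le> ?C * (?d * ?x)" unfolding regroup .
    with eq show "norm (xi (br (dexp (xi m) (xi m')) (newton m) + ead (xi m) m')) \<le> ?C * (?d * ?x)"
      by (simp add: Z_def y_def)
  qed
qed

lemma newton_constants:
  obtains C \<rho> where "0 < C" "0 < \<rho>"
    "\<And>m. norm (m - base) \<le> \<rho> \<Longrightarrow> norm (xi m) \<le> C * norm (m - base)"
    "\<And>m. norm (m - base) \<le> \<rho> \<Longrightarrow> norm (newton m - m) \<le> C * norm (xi m)"
    "\<And>m. norm (m - base) \<le> \<rho> \<Longrightarrow> norm (xi (newton m)) \<le> C * (norm (m - base) * norm (xi m))"
    "\<And>m. norm (m - base) \<le> \<rho> \<Longrightarrow> norm (normal_part (newton m - m)) \<le> C * (norm (m - base) * norm (xi m))"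
    "\<And>m m'. norm (m - base) \<le> \<rho> \<Longrightarrow> br m (br m m') = - m' \<Longrightarrow>
       norm (normal_part m') \<le> C * (norm (m - base) * norm (xi m'))"
    "\<And>m m'. norm (m - base) \<le> \<rho> \<Longrightarrow> br m (br m m') = - m' \<Longrightarrow>
       norm (xi (br (dexp (xi m) (xi m')) (newton m) + ead (xi m) m')) \<le> C * (norm (m - base) * norm (xi m'))"
proof -
  let ?C1 = "br_bound * norm base" and ?B = "br_bound * br_bound * (2 * norm base + 1)"
  \<comment> \<open>Within this radius the error in the tangency equation is at most half of the velocity.\<close>
  define \<rho> where "\<rho> = min 1 (1 / (2 * ?B))"
  have B: "0 < ?B" using br_bound_pos by (simp add: add_nonneg_pos)
  have \<rho>: "0 < \<rho>" "\<rho> \<le> 1" using B by (auto simp: \<rho>_def)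
  have small: "?B * norm (m - base) \<le> 1 / 2" if "norm (m - base) \<le> \<rho>" for m
  proof -
    have "norm (m - base) \<le> 1 / (2 * ?B)" using that by (simp add: \<rho>_def)
    then have "norm (m - base) * (2 * ?B) \<le> 1" using B by (simp add: pos_le_divide_eq)
    then show ?thesis by (simp add: algebra_simps)
  qed
  obtain C2 where C2: "0 \<le> C2" "\<And>m. norm (m - base) \<le> 1 \<Longrightarrow> norm (newton m - m) \<le> C2 * norm (xi m)"
    using newton_displacement by blast
  obtain C3 where C3: "0 \<le> C3" "\<And>m. norm (m - base) \<le> 1 \<Longrightarrow>
      norm (xi (newton m)) \<le> C3 * (norm (m - base) * norm (xi m))"
    using newton_tangential by blast
  obtain C4 where C4: "0 \<le> C4" "\<And>m. norm (m - base) \<le> 1 \<Longrightarrow>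
      norm (normal_part (newton m - m)) \<le> C4 * (norm (m - base) * norm (xi m))"
    using newton_normal by blast
  let ?D = "2 * ?C1"
  have "0 \<le> ?D" using br_bound_pos by simp
  from newton_derivative[OF this]
  obtain C6 where "0 \<le> C6" and "\<forall>m m'. norm (m - base) \<le> 1 \<longrightarrow> norm m' \<le> ?D * norm (xi m') \<longrightarrow>
     norm (xi (br (dexp (xi m) (xi m')) (newton m) + ead (xi m) m')) \<le> C6 * (norm (m - base) * norm (xi m'))"
    by (elim exE conjE)
  note C6 = this(1) this(2)[rule_format]
  let ?C5 = "?B * ?D"
  have C1: "0 \<le> ?C1" and C5: "0 \<le> ?C5" using br_bound_pos by auto
  define C where "C = ?C1 + C2 + C3 + C4 + ?C5 + C6 + 1"
  have le: "?C1 \<le> C" "C2 \<le> C" "C3 \<le> C" "C4 \<le> C" "?C5 \<le> C" "C6 \<le> C"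
    unfolding C_def using C1 C2(1) C3(1) C4(1) C5 C6(1) by linarith+
  have raise: "x \<le> C * a" if "x \<le> c * a" "c \<le> C" "0 \<le> a" for x c a
    using that mult_right_mono[of c C a] by linarith
  have tang: "norm m' \<le> ?D * norm (xi m')"
    if "norm (m - base) \<le> \<rho>" "br m (br m m') = - m'" for m m'
    using tangent_norm_le[OF that(2) _ small[OF that(1)]] that \<rho> by (simp add: mult_ac)
  show thesis
  proof (rule that[of C \<rho>])
    show "0 < C" unfolding C_def using C1 C2(1) C3(1) C4(1) C5 C6(1) by linarith
    show "0 < \<rho>" by fact
    fix m assume m: "norm (m - base) \<le> \<rho>"
    then have m1: "norm (m - base) \<le> 1" using \<rho> by simp
    show "norm (xi m) \<le> C * norm (m - base)" by (rule raise[OF xi_norm_le le(1)]) simp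
    show "norm (newton m - m) \<le> C * norm (xi m)" by (rule raise[OF C2(2)[OF m1] le(2)]) simp
    show "norm (xi (newton m)) \<le> C * (norm (m - base) * norm (xi m))"
      by (rule raise[OF C3(2)[OF m1] le(3)]) simp
    show "norm (normal_part (newton m - m)) \<le> C * (norm (m - base) * norm (xi m))"
      by (rule raise[OF C4(2)[OF m1] le(4)]) simp
    fix m' assume t: "br m (br m m') = - m'"
    have "norm (normal_part m') \<le> ?B * norm (m - base) * norm m'"
      by (rule tangent_error[OF t m1])
    also have "\<dots> \<le> ?B * norm (m - base) * (?D * norm (xi m'))"
      using B tang[OF m t] by (intro mult_left_mono) auto
    finally have "norm (normal_part m') \<le> ?C5 * (norm (m - base) * norm (xi m'))"
      by (simp only: mult_ac)
    then show "norm (normal_part m') \<le> C * (norm (m - base) * norm (xi m'))"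
      by (rule raise[OF _ le(5)]) simp
    show "norm (xi (br (dexp (xi m) (xi m')) (newton m) + ead (xi m) m')) \<le> C * (norm (m - base) * norm (xi m'))"
      by (rule raise[OF C6(2)[OF m1 tang[OF m t]] le(6)]) simp
  qed
qed

text \<open>
  A quantitative substitute for the fact that the orbit is locally a submanifold tangent to the
  image of \<open>ad(base)\<close>. A Newton step applied to the whole path at once yields a path of the same
  kind that starts at the base point, while its tangential displacement and velocity are halved
  and the normal part of its end point changes little. Iterating, the normal part of the end point
  is bounded by a geometric series in \<open>xi (m 1)\<close> plus the normal part of a path that hardly moves.
\<close>

lemma orbit_path_stays_tangential:
  assumes e: "0 < e"
  obtains \<rho> where "0 < \<rho>"
    "\<And>m m'. orbit_path m m' \<Longrightarrow> bounded (m' ` {0..1}) \<Longrightarrow> m 0 = base \<Longrightarrow>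
      (\<And>s. s \<in> {0..1} \<Longrightarrow> norm (m s - base) \<le> \<rho>) \<Longrightarrow>
      norm (normal_part (m 1 - base)) \<le> e * norm (xi (m 1))"
proof -
  obtain C \<rho>0 where C: "0 < C" and \<rho>0: "0 < \<rho>0"
    and xi_le: "\<And>m. norm (m - base) \<le> \<rho>0 \<Longrightarrow> norm (xi m) \<le> C * norm (m - base)"
    and disp: "\<And>m. norm (m - base) \<le> \<rho>0 \<Longrightarrow> norm (newton m - m) \<le> C * norm (xi m)"
    and tang: "\<And>m. norm (m - base) \<le> \<rho>0 \<Longrightarrow> norm (xi (newton m)) \<le> C * (norm (m - base) * norm (xi m))"
    and norml: "\<And>m. norm (m - base) \<le> \<rho>0 \<Longrightarrow> norm (normal_part (newton m - m)) \<le> C * (norm (m - base) * norm (xi m))"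
    and dnorml: "\<And>m m'. norm (m - base) \<le> \<rho>0 \<Longrightarrow> br m (br m m') = - m' \<Longrightarrow>
       norm (normal_part m') \<le> C * (norm (m - base) * norm (xi m'))"
    and dtang: "\<And>m m'. norm (m - base) \<le> \<rho>0 \<Longrightarrow> br m (br m m') = - m' \<Longrightarrow>
       norm (xi (br (dexp (xi m) (xi m')) (newton m) + ead (xi m) m')) \<le> C * (norm (m - base) * norm (xi m'))"
    by (rule newton_constants) (rule that; assumption)
  \<comment> \<open>The radius makes a Newton step halve displacements and keeps the final factor below \<open>e\<close>.\<close>
  define \<rho>1 where "\<rho>1 = min \<rho>0 (min (1 / (2 * C)) (e / (2 * C)))"
  have \<rho>1: "0 < \<rho>1" "\<rho>1 \<le> \<rho>0" "\<rho>1 \<le> 1 / (2 * C)" "\<rho>1 \<le> e / (2 * C)"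
    using C \<rho>0 e by (auto simp: \<rho>1_def)
  have C\<rho>: "C * \<rho>1 \<le> 1 / 2" "2 * C * \<rho>1 \<le> e"
    using \<rho>1(3,4) C by (auto simp: field_simps)
  have half: "C * (a * b) \<le> b / 2" if "a \<le> \<rho>1" "0 \<le> b" for a b
  proof -
    have "C * (a * b) \<le> C * (\<rho>1 * b)" using that C by (intro mult_left_mono mult_right_mono) auto
    also have "\<dots> = C * \<rho>1 * b" by simp
    also have "\<dots> \<le> 1 / 2 * b" using C\<rho>(1) that(2) by (rule mult_right_mono)
    finally show ?thesis by simp
  qed
  \<comment> \<open>The weight \<open>2 C\<close> of \<open>xi\<close> absorbs the displacement by one Newton step, so the hypothesis is inherited.\<close>
  have claim: "norm (normal_part (m 1 - base)) \<le> 2 * C * \<rho>1 * norm (xi (m 1)) + C * \<rho>1 * b / 2 ^ k"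
    if "orbit_path m m'" "m 0 = base"
      "\<And>s. s \<in> {0..1} \<Longrightarrow> norm (m s - base) + 2 * C * norm (xi (m s)) \<le> \<rho>1"
      "\<And>s. s \<in> {0..1} \<Longrightarrow> norm (xi (m' s)) \<le> b"
    for m m' b k
    using that
  proof (induction k arbitrary: m m' b)
    case (0 m m' b)
    have m_le: "norm (m s - base) \<le> \<rho>1" if "s \<in> {0..1}" for s
      using 0(3)[OF that] C by (smt (verit) mult_nonneg_nonneg norm_ge_zero)
    have "norm (normal_part (m 1) - normal_part (m 0)) \<le> C * (\<rho>1 * b)"
    proof (rule vector_differentiable_bound)
      fix s :: real assume s: "s \<in> {0..1}"
      have "(m has_vector_derivative m' s) (at s within {0..1})"
        using 0(1) s by (simp add: orbit_path_def)
      then show "((\<lambda>s. normal_part (m s)) has_vector_derivative normal_part (m' s)) (at s within {0..1})"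
        by (rule bounded_linear.has_vector_derivative[OF linear_normal_part[unfolded linear_conv_bounded_linear]])
      have "norm (normal_part (m' s)) \<le> C * (norm (m s - base) * norm (xi (m' s)))"
        using m_le[OF s] \<rho>1 by (intro dnorml orbit_path_tangent[OF 0(1) s]) simp
      also have "\<dots> \<le> C * (\<rho>1 * b)"
        using m_le[OF s] 0(4)[OF s] C \<rho>1 by (intro mult_left_mono mult_mono) auto
      finally show "norm (normal_part (m' s)) \<le> C * (\<rho>1 * b)" .
    qed simp
    then have "norm (normal_part (m 1 - base)) \<le> C * \<rho>1 * b"
      by (simp add: 0(2) linear_diff[OF linear_normal_part] mult_ac)
    moreover have "0 \<le> 2 * C * \<rho>1 * norm (xi (m 1))" using C \<rho>1 by simp
    ultimately show ?case by simp
  next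
    case (Suc k m m' b)
    define X where "X = (\<lambda>s. xi (m s))"
    define X' where "X' = (\<lambda>s. xi (m' s))"
    define y where "y = (\<lambda>s. newton (m s))"
    define y' where "y' = (\<lambda>s. br (dexp (X s) (X' s)) (y s) + ead (X s) (m' s))"
    have m_le: "norm (m s - base) \<le> \<rho>1" if "s \<in> {0..1}" for s
      using Suc.prems(3)[OF that] C by (smt (verit) mult_nonneg_nonneg norm_ge_zero)
    have m_le0: "norm (m s - base) \<le> \<rho>0" if "s \<in> {0..1}" for s
      using m_le[OF that] \<rho>1 by simp
    have y: "y = (\<lambda>s. ead (X s) (m s))" by (simp add: y_def newton_def X_def)
    have path_y: "orbit_path y y'"
      unfolding y'_def y
    proof (rule orbit_path_ead[OF Suc.prems(1)])
      fix s :: real assume s: "s \<in> {0..1}"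
      with Suc.prems(1) obtain k where k: "m s \<in> orbit" "k \<in> K" "m' s = br k (m s)"
        "(m has_vector_derivative m' s) (at s within {0..1})"
        unfolding orbit_path_def by blast
      show "X s \<in> K" using k(1) by (simp add: X_def xi_def PP orbit_P base_P)
      show "X' s \<in> K" using k by (simp add: X'_def xi_def PP KP orbit_P base_P)
      show "(X has_vector_derivative X' s) (at s within {0..1})"
        unfolding X_def X'_def using k(4)
        by (rule bounded_linear.has_vector_derivative[OF linear_xi[unfolded linear_conv_bounded_linear]])
    qed
    have y0: "y 0 = base"
      by (simp add: y_def newton_def xi_def Suc.prems(2) br_self ead_zero)
    have y_le: "norm (y s - base) + 2 * C * norm (xi (y s)) \<le> \<rho>1" if s: "s \<in> {0..1}" for s
    proof -
      have "norm (xi (y s)) \<le> norm (xi (m s)) / 2"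
        unfolding y_def using tang[OF m_le0[OF s]] half[OF m_le[OF s], of "norm (xi (m s))"] by simp
      then have "2 * C * norm (xi (y s)) \<le> 2 * C * (norm (xi (m s)) / 2)"
        using C by (intro mult_left_mono) auto
      moreover have "norm (y s - base) \<le> norm (m s - base) + C * norm (xi (m s))"
        using disp[OF m_le0[OF s]] norm_triangle_ineq[of "y s - m s" "m s - base"]
        by (simp add: y_def)
      ultimately show ?thesis using Suc.prems(3)[OF s] by simp
    qed
    have y'_le: "norm (xi (y' s)) \<le> b / 2" if s: "s \<in> {0..1}" for s
      using dtang[OF m_le0[OF s] orbit_path_tangent[OF Suc.prems(1) s]]
        half[OF m_le[OF s], of "norm (xi (m' s))"] Suc.prems(4)[OF s]
      by (simp add: y'_def y_def X_def X'_def)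
    have 1: "(1 :: real) \<in> {0..1}" by simp
    have "norm (normal_part (y 1 - base)) \<le> 2 * C * \<rho>1 * norm (xi (y 1)) + C * \<rho>1 * (b / 2) / 2 ^ k"
      by (rule Suc.IH[OF path_y y0 y_le y'_le])
    also have "2 * C * \<rho>1 * norm (xi (y 1)) \<le> 2 * C * \<rho>1 * (norm (xi (m 1)) / 2)"
      unfolding y_def using tang[OF m_le0[OF 1]] half[OF m_le[OF 1], of "norm (xi (m 1))"] C \<rho>1
      by (intro mult_left_mono) auto
    finally have IH: "norm (normal_part (y 1 - base)) \<le> C * \<rho>1 * norm (xi (m 1)) + C * \<rho>1 * b / 2 ^ Suc k"
      by simp
    have "norm (normal_part (y 1 - m 1)) \<le> C * (norm (m 1 - base) * norm (xi (m 1)))"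
      unfolding y_def by (rule norml[OF m_le0[OF 1]])
    also have "\<dots> \<le> C * (\<rho>1 * norm (xi (m 1)))"
      using m_le[OF 1] C by (intro mult_left_mono mult_right_mono) auto
    finally have step: "norm (normal_part (y 1 - m 1)) \<le> C * \<rho>1 * norm (xi (m 1))" by simp
    have "normal_part (m 1 - base) = normal_part (y 1 - base) - normal_part (y 1 - m 1)"
      by (simp add: linear_diff[OF linear_normal_part, symmetric])
    then have "norm (normal_part (m 1 - base)) \<le> norm (normal_part (y 1 - base)) + norm (normal_part (y 1 - m 1))"
      by (simp add: norm_triangle_ineq4)
    with IH step show ?case by simp
  qed
  define \<rho> where "\<rho> = \<rho>1 / (1 + 2 * C * C)"
  have den: "0 < 1 + 2 * C * C" using C by (simp add: add_pos_nonneg)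
  have \<rho>: "0 < \<rho>" "\<rho> * (1 + 2 * C * C) = \<rho>1" "\<rho> \<le> \<rho>1"
    using \<rho>1 C den by (auto simp: \<rho>_def divide_le_eq mult_le_cancel_left1)
  show thesis
  proof (rule that[OF \<rho>(1)])
    fix m m' assume path: "orbit_path m m'" and bdd: "bounded (m' ` {0..1})" and m0: "m 0 = base"
      and m_le: "\<And>s. s \<in> {0..1} \<Longrightarrow> norm (m s - base) \<le> \<rho>"
    from bdd obtain B where "\<forall>s\<in>{0..1}. norm (m' s) \<le> B"
      unfolding bounded_iff by auto
    then have B: "norm (m' s) \<le> B" if "s \<in> {0..1}" for s using that by blast
    have m_le': "norm (m s - base) + 2 * C * norm (xi (m s)) \<le> \<rho>1" if s: "s \<in> {0..1}" for s
    proof -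
      have "norm (xi (m s)) \<le> C * norm (m s - base)"
        using m_le[OF s] \<rho> \<rho>1 by (intro xi_le) simp
      then have "2 * C * norm (xi (m s)) \<le> 2 * C * (C * norm (m s - base))"
        using C by (intro mult_left_mono) auto
      then have "norm (m s - base) + 2 * C * norm (xi (m s)) \<le> norm (m s - base) * (1 + 2 * C * C)"
        by (simp add: algebra_simps)
      also have "\<dots> \<le> \<rho> * (1 + 2 * C * C)" using m_le[OF s] den by (intro mult_right_mono) auto
      finally show ?thesis using \<rho>(2) by simp
    qed
    have m'_le: "norm (xi (m' s)) \<le> br_bound * B * norm base" if "s \<in> {0..1}" for s
      unfolding xi_def using B[OF that] by (intro norm_br_le') auto
    define a where "a = 2 * C * \<rho>1 * norm (xi (m 1))"
    define d where "d = C * \<rho>1 * (br_bound * B * norm base)"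
    have le: "norm (normal_part (m 1 - base)) \<le> a + d * (1 / 2) ^ k" for k
      using claim[OF path m0 m_le' m'_le, of k] by (simp add: a_def d_def power_one_over)
    have "(\<lambda>k. a + d * (1 / 2) ^ k) \<longlonglongrightarrow> a + d * 0"
      by (intro tendsto_intros LIMSEQ_power_zero) simp
    then have "norm (normal_part (m 1 - base)) \<le> a + d * 0"
      by (rule LIMSEQ_le_const) (use le in blast)
    also have "\<dots> \<le> e * norm (xi (m 1))"
      using mult_right_mono[OF C\<rho>(2), of "norm (xi (m 1))"] by (simp add: a_def)
    finally show "norm (normal_part (m 1 - base)) \<le> e * norm (xi (m 1))" .
  qed
qed

section \<open>Differentiable curves inside an orbit\<close>

primrec word :: "'v list \<Rightarrow> 'v \<Rightarrow> 'v" where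
  "word [] m = m"
| "word (X # xs) m = ead X (word xs m)"

lemma linear_word: "linear (word xs)"
proof (induction xs)
  case Nil show ?case by (rule linearI) auto
next
  case (Cons X xs)
  from linear_compose[OF this linear_ead] have "linear (\<lambda>m. word (X # xs) m)"
    by (simp add: o_def)
  then show ?case .
qed

lemma word_bracket: "word xs (br u v) = br (word xs u) (word xs v)"
  by (induction xs) (simp_all add: ead_bracket)

lemma word_append: "word (xs @ ys) m = word xs (word ys m)"
  by (induction xs) simp_all

lemma word_K: "set xs \<subseteq> K \<Longrightarrow> k \<in> K \<Longrightarrow> word xs k \<in> K"
  by (induction xs) (auto intro: ead_K)

lemma word_orbit: "set xs \<subseteq> K \<Longrightarrow> m \<in> orbit \<Longrightarrow> word xs m \<in> orbit"
  by (induction xs) (auto intro: ead_orbit)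

lemma orbit_word:
  assumes "m \<in> orbit"
  shows "\<exists>xs. set xs \<subseteq> K \<and> m = word xs base"
  using assms
proof (induction rule: orbit.induct)
  case base_orbit
  have "set [] \<subseteq> K \<and> base = word [] base" by simp
  then show ?case by blast
next
  case (ead_orbit X m)
  then obtain xs where "set xs \<subseteq> K" "m = word xs base" by blast
  with ead_orbit.hyps have "set (X # xs) \<subseteq> K \<and> ead X m = word (X # xs) base" by simp
  then show ?case by blast
qed

lemma word_inverse:
  assumes "set xs \<subseteq> K"
  obtains ys where "set ys \<subseteq> K" "\<And>v. word ys (word xs v) = v" "\<And>v. word xs (word ys v) = v"
proof
  let ?ys = "map uminus (rev xs)"
  show "set ?ys \<subseteq> K" using assms subspace_neg[OF subspace_K] by auto
  show "word ?ys (word xs v) = v" for v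
    by (induction xs arbitrary: v) (simp_all add: word_append ead_minus)
  show "word xs (word ?ys v) = v" for v
    by (induction xs arbitrary: v) (simp_all add: word_append ead_minus)
qed

lemma orbit_path_word:
  assumes m: "orbit_path m m'" and xs: "set xs \<subseteq> K"
  shows "orbit_path (\<lambda>s. word xs (m s)) (\<lambda>s. word xs (m' s))"
  unfolding orbit_path_def
proof (intro ballI conjI)
  fix s :: real assume s: "s \<in> {0..1}"
  with m obtain k where k: "m s \<in> orbit" "k \<in> K" "m' s = br k (m s)"
    "(m has_vector_derivative m' s) (at s within {0..1})"
    unfolding orbit_path_def by blast
  show "word xs (m s) \<in> orbit" using xs k(1) by (rule word_orbit)
  show "((\<lambda>s. word xs (m s)) has_vector_derivative word xs (m' s)) (at s within {0..1})"
    using k(4)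
    by (rule bounded_linear.has_vector_derivative[OF linear_word[unfolded linear_conv_bounded_linear]])
  show "\<exists>k\<in>K. word xs (m' s) = br k (word xs (m s))"
    using word_K[OF xs k(2)] by (auto simp: k(3) word_bracket)
qed

text \<open>
  Moving all exponents linearly from \<open>xs\<close> to \<open>ys\<close> at the same time gives a path along the orbit
  that stays close to its starting point when the exponents are close.
\<close>

lemma word_path:
  assumes "set xs \<subseteq> K" "0 < e"
  shows "\<exists>\<delta>>0. \<forall>ys. length ys = length xs \<longrightarrow> set ys \<subseteq> K \<longrightarrow>
    (\<forall>i<length xs. norm (ys ! i - xs ! i) < \<delta>) \<longrightarrow>
    (\<exists>m m'. orbit_path m m' \<and> bounded (m' ` {0..1}) \<and> m 0 = word xs base \<and> m 1 = word ys base \<and>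
      (\<forall>s\<in>{0..1}. norm (m s - word xs base) \<le> e))"
  using assms
proof (induction xs arbitrary: e)
  case (Nil e)
  have "\<exists>k\<in>K. 0 = br k base"
    using subspace_0[OF subspace_K] by (auto simp: br_simps intro!: bexI[of _ 0])
  then have "orbit_path (\<lambda>s. base) (\<lambda>s. 0)"
    by (simp add: orbit_path_def base_orbit)
  moreover have "bounded ((\<lambda>s::real. 0::'v) ` {0..1})" by (simp add: image_constant_conv)
  ultimately have "\<exists>m m'. orbit_path m m' \<and> bounded (m' ` {0..1}) \<and> m 0 = base \<and> m 1 = base \<and>
      (\<forall>s\<in>{0..1}. norm (m s - base) \<le> e)"
    using Nil(2) by (intro exI[of _ "\<lambda>s. base"] exI[of _ "\<lambda>s. 0"]) auto
  then show ?case by (intro exI[of _ 1]) simp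
next
  case (Cons X xs e)
  define w where "w = word xs base"
  let ?c = br_bound
  define L where "L = exp (?c * norm X)"
  define M where "M = exp (2 * (?c * norm X)) * (?c * (exp (?c * (norm X + 1)) * (norm w + 1)))"
  have L: "0 < L" and M: "0 \<le> M" using br_bound_pos by (auto simp: L_def M_def)
  define e' where "e' = min 1 (e / (2 * L))"
  have e': "0 < e'" "e' \<le> 1" "L * e' \<le> e / 2"
  proof -
    show "0 < e'" "e' \<le> 1" using Cons.prems(2) L by (auto simp: e'_def)
    have "L * e' \<le> L * (e / (2 * L))" using L by (intro mult_left_mono) (auto simp: e'_def)
    then show "L * e' \<le> e / 2" using L by simp
  qed
  from Cons.prems have X: "X \<in> K" and xs: "set xs \<subseteq> K" by auto
  from Cons.IH[OF xs e'(1)] obtain \<delta>1 where \<delta>1: "0 < \<delta>1" and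
    IH: "\<And>ys. length ys = length xs \<Longrightarrow> set ys \<subseteq> K \<Longrightarrow>
      (\<forall>i<length xs. norm (ys ! i - xs ! i) < \<delta>1) \<Longrightarrow>
      \<exists>m m'. orbit_path m m' \<and> bounded (m' ` {0..1}) \<and> m 0 = w \<and> m 1 = word ys base \<and>
      (\<forall>s\<in>{0..1}. norm (m s - w) \<le> e')"
    unfolding w_def by blast
  define \<delta> where "\<delta> = min \<delta>1 (min 1 (e / (2 * (M + 1))))"
  have \<delta>: "0 < \<delta>" "\<delta> \<le> \<delta>1" "\<delta> \<le> 1" using \<delta>1 M Cons.prems(2) by (auto simp: \<delta>_def)
  have "\<delta> \<le> e / (2 * (M + 1))" by (simp add: \<delta>_def)
  then have "\<delta> * (2 * (M + 1)) \<le> e" using M by (simp add: pos_le_divide_eq)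
  then have M\<delta>: "M * \<delta> \<le> e / 2" using \<delta>(1) by (simp add: algebra_simps)
  have main: "\<exists>m m'. orbit_path m m' \<and> bounded (m' ` {0..1}) \<and> m 0 = word (X # xs) base \<and>
      m 1 = word (Y # ys) base \<and> (\<forall>s\<in>{0..1}. norm (m s - word (X # xs) base) \<le> e)"
    if ys: "length ys = length xs" "set ys \<subseteq> K" "\<forall>i<length xs. norm (ys ! i - xs ! i) < \<delta>"
      and Y: "Y \<in> K" "norm (Y - X) < \<delta>" for Y ys
  proof -
    obtain m m' where m: "orbit_path m m'" "bounded (m' ` {0..1})" "m 0 = w" "m 1 = word ys base"
      and m_near: "\<And>s. s \<in> {0..1} \<Longrightarrow> norm (m s - w) \<le> e'"
      using IH[OF ys(1,2)] ys(3) \<delta>(2) by (metis order_less_le_trans)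
    define Z where "Z = (\<lambda>s. X + s *\<^sub>R (Y - X))"
    define y where "y = (\<lambda>s. ead (Z s) (m s))"
    define y' where "y' = (\<lambda>s. br (dexp (Z s) (Y - X)) (ead (Z s) (m s)) + ead (Z s) (m' s))"
    have ZX: "norm (s *\<^sub>R (Y - X)) \<le> \<delta>" if "s \<in> {0..1}" for s
      using Y(2) that mult_left_le_one_le[of "norm (Y - X)" s] by auto
    have Z_le: "norm (Z s) \<le> norm X + 1" if "s \<in> {0..1}" for s
      unfolding Z_def using norm_triangle_ineq[of X "s *\<^sub>R (Y - X)"] ZX[OF that] \<delta>(3) by simp
    have path: "orbit_path y y'"
      unfolding y_def y'_def
    proof (rule orbit_path_ead[OF m(1)])
      show "Y - X \<in> K" using X Y subspace_K by (intro subspace_diff)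
      then show "Z s \<in> K" for s
        unfolding Z_def using X subspace_K by (intro subspace_add subspace_scale)
      show "(Z has_vector_derivative Y - X) (at s within {0..1})" for s
        unfolding Z_def by (auto intro!: derivative_eq_intros)
    qed
    have near: "norm (y s - ead X w) \<le> e" if s: "s \<in> {0..1}" for s
    proof -
      have m_le: "norm (m s) \<le> norm w + 1"
        using m_near[OF s] e'(2) norm_triangle_ineq2[of "m s" w] by simp
      have "norm (y s - ead X (m s)) \<le> exp (2 * (?c * norm X)) *
          (?c * norm (s *\<^sub>R (Y - X)) * (exp (?c * norm (Z s)) * norm (m s)))"
        unfolding y_def Z_def by (rule ead_diff_norm_le)
      also have "\<dots> \<le> exp (2 * (?c * norm X)) * (?c * \<delta> * (exp (?c * (norm X + 1)) * (norm w + 1)))"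
        using br_bound_pos ZX[OF s] Z_le[OF s] m_le \<delta>(1)
        by (intro mult_left_mono mult_mono) auto
      also have "\<dots> = M * \<delta>" by (simp add: M_def mult_ac)
      finally have 1: "norm (y s - ead X (m s)) \<le> e / 2" using M\<delta> by simp
      have "norm (ead X (m s - w)) \<le> L * norm (m s - w)"
        unfolding L_def by (rule ead_norm_le)
      also have "\<dots> \<le> L * e'" using m_near[OF s] L by (intro mult_left_mono) auto
      finally have 2: "norm (ead X (m s) - ead X w) \<le> e / 2"
        using e'(3) by (simp add: linear_diff[OF linear_ead])
      show ?thesis
        using norm_triangle_ineq[of "y s - ead X (m s)" "ead X (m s) - ead X w"] 1 2 by simp
    qed
    obtain B where "\<forall>s\<in>{0..1}. norm (m' s) \<le> B"
      using m(2) unfolding bounded_iff by auto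
    then have B: "norm (m' s) \<le> B" if "s \<in> {0..1}" for s using that by blast
    have "bounded (y' ` {0..1})"
      unfolding bounded_iff
    proof (intro exI ballI, elim imageE, hypsubst)
      fix s :: real assume s: "s \<in> {0..1}"
      have 1: "norm (dexp (Z s) (Y - X)) \<le> exp (2 * (?c * (norm X + 1))) * norm (Y - X)"
      proof -
        have "norm (dexp (Z s) (Y - X)) \<le> exp (2 * (?c * norm (Z s))) * norm (Y - X)"
          by (rule dexp_norm_le)
        also have "\<dots> \<le> exp (2 * (?c * (norm X + 1))) * norm (Y - X)"
          using br_bound_pos Z_le[OF s] by (intro mult_right_mono) auto
        finally show ?thesis .
      qed
      have 2: "norm (y s) \<le> norm (ead X w) + e"
        using near[OF s] norm_triangle_ineq2[of "y s" "ead X w"] by simp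
      have 3: "norm (ead (Z s) (m' s)) \<le> exp (?c * (norm X + 1)) * B"
      proof -
        have "norm (ead (Z s) (m' s)) \<le> exp (?c * norm (Z s)) * norm (m' s)" by (rule ead_norm_le)
        also have "\<dots> \<le> exp (?c * (norm X + 1)) * B"
          using br_bound_pos Z_le[OF s] B[OF s] by (intro mult_mono) auto
        finally show ?thesis .
      qed
      show "norm (y' s) \<le> ?c * (exp (2 * (?c * (norm X + 1))) * norm (Y - X)) * (norm (ead X w) + e)
          + exp (?c * (norm X + 1)) * B"
        unfolding y'_def using 2 unfolding y_def
        by (intro norm_triangle_mono norm_br_le' 1 3)
    qed
    moreover have "y 0 = word (X # xs) base" "y 1 = word (Y # ys) base"
      by (simp_all add: y_def Z_def m w_def)
    moreover have "\<forall>s\<in>{0..1}. norm (y s - word (X # xs) base) \<le> e"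
      using near by (simp add: w_def)
    ultimately show ?thesis using path by blast
  qed
  show ?case
  proof (intro exI[of _ \<delta>] conjI allI impI \<delta>(1))
    fix zs assume zs: "length zs = length (X # xs)" "set zs \<subseteq> K"
      "\<forall>i<length (X # xs). norm (zs ! i - (X # xs) ! i) < \<delta>"
    from zs(1) obtain Y ys where zs_eq: "zs = Y # ys" "length ys = length xs"
      by (auto simp: length_Suc_conv)
    from zs(3) zs_eq have "norm (Y - X) < \<delta>" by (metis length_Cons nth_Cons_0 zero_less_Suc)
    moreover have "\<forall>i<length xs. norm (ys ! i - xs ! i) < \<delta>"
      using zs(3) unfolding zs_eq(1) by (metis Suc_less_eq length_Cons nth_Cons_Suc)
    ultimately show "\<exists>m m'. orbit_path m m' \<and> bounded (m' ` {0..1}) \<and> m 0 = word (X # xs) base \<and>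
      m 1 = word zs base \<and> (\<forall>s\<in>{0..1}. norm (m s - word (X # xs) base) \<le> e)"
      unfolding zs_eq(1) using zs(2) zs_eq by (intro main) auto
  qed
qed

text \<open>
  Uncountably many parameters use words of one and the same length \<open>n\<close>. Together with their words
  they form an uncountable subset of a second countable space, which has a limit point in itself.
\<close>

lemma recurring_word:
  assumes "uncountable T" and c: "\<And>t. t \<in> T \<Longrightarrow> c t \<in> orbit"
  obtains t xs where "t \<in> T" "set xs \<subseteq> K" "c t = word xs base"
    "\<forall>\<delta>>0. \<exists>t'\<in>T. t' \<noteq> t \<and> \<bar>t' - t\<bar> < \<delta> \<and> (\<exists>ys. set ys \<subseteq> K \<and> c t' = word ys base \<and>
        length ys = length xs \<and> (\<forall>i<length xs. norm (ys ! i - xs ! i) < \<delta>))"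
proof -
  from orbit_word[OF c] obtain w where w: "\<And>t. t \<in> T \<Longrightarrow> set (w t) \<subseteq> K \<and> c t = word (w t) base"
    by metis
  have "T = (\<Union>n. {t \<in> T. length (w t) = n})" by auto
  with assms(1) obtain n where n: "uncountable {t \<in> T. length (w t) = n}"
    by (metis (lifting) countable_UN countableI_type)
  \<comment> \<open>The entries beyond the length are a default value; they keep all words in one function space.\<close>
  define \<Phi> where "\<Phi> = (\<lambda>t. (t, \<lambda>i. if i < n then w t ! i else 0))"
  have "inj_on \<Phi> {t \<in> T. length (w t) = n}" by (auto simp: \<Phi>_def inj_on_def)
  with n have "uncountable (\<Phi> ` {t \<in> T. length (w t) = n})" using countable_image_inj_on by blast
  then obtain z where z: "z \<in> \<Phi> ` {t \<in> T. length (w t) = n}"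
    "\<And>U. open U \<Longrightarrow> z \<in> U \<Longrightarrow> \<exists>y\<in>\<Phi> ` {t \<in> T. length (w t) = n}. y \<in> U \<and> y \<noteq> z"
    by (rule uncountable_has_limit_point) blast
  from z(1) obtain t where t: "t \<in> T" "length (w t) = n" "z = \<Phi> t" by blast
  show thesis
  proof (rule that[OF t(1)])
    show "set (w t) \<subseteq> K" "c t = word (w t) base" using w[OF t(1)] by auto
    show "\<forall>\<delta>>0. \<exists>t'\<in>T. t' \<noteq> t \<and> \<bar>t' - t\<bar> < \<delta> \<and> (\<exists>ys. set ys \<subseteq> K \<and> c t' = word ys base \<and>
        length ys = length (w t) \<and> (\<forall>i<length (w t). norm (ys ! i - w t ! i) < \<delta>))"
    proof (intro allI impI)
      fix \<delta> :: real assume \<delta>: "0 < \<delta>"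
      define U where "U = ball t \<delta> \<times> (\<Inter>i<n. (\<lambda>f::nat \<Rightarrow> 'v. f i) -` ball (w t ! i) \<delta>)"
      have "open U"
        unfolding U_def
        by (intro open_Times open_ball open_INT finite_lessThan ballI open_vimage
            continuous_on_product_coordinates)
      moreover have "z \<in> U" using \<delta> by (auto simp: U_def t(3) \<Phi>_def)
      ultimately obtain t' where t': "t' \<in> T" "length (w t') = n" "\<Phi> t' \<in> U" "\<Phi> t' \<noteq> z"
        using z(2) by blast
      show "\<exists>t'\<in>T. t' \<noteq> t \<and> \<bar>t' - t\<bar> < \<delta> \<and> (\<exists>ys. set ys \<subseteq> K \<and> c t' = word ys base \<and>
          length ys = length (w t) \<and> (\<forall>i<length (w t). norm (ys ! i - w t ! i) < \<delta>))"
      proof (intro bexI[OF _ t'(1)] conjI exI[of _ "w t'"])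
        show "t' \<noteq> t" using t'(4) t(3) by blast
        show "\<bar>t' - t\<bar> < \<delta>" using t'(3) by (auto simp: U_def \<Phi>_def dist_real_def)
        show "set (w t') \<subseteq> K" "c t' = word (w t') base" using w[OF t'(1)] by auto
        show "length (w t') = length (w t)" using t'(2) t(2) by simp
        show "\<forall>i<length (w t). norm (w t' ! i - w t ! i) < \<delta>"
          using t'(3) t(2) by (auto simp: U_def \<Phi>_def dist_norm norm_minus_commute)
      qed
    qed
  qed
qed

text \<open>
  A recurring word is moved to the base point by its inverse. There, the difference quotients of
  the curve along the approaching parameters have normal parts that are arbitrarily small compared
  with their tangential parts, so the normal part of the derivative vanishes.
\<close>

lemma tangent_somewhere:
  fixes a b :: real
  assumes "a < b" and c: "\<And>t. t \<in> {a<..<b} \<Longrightarrow> c t \<in> orbit"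
    and c': "\<And>t. t \<in> {a<..<b} \<Longrightarrow> (c has_vector_derivative c' t) (at t)"
  obtains t where "t \<in> {a<..<b}" "br (c t) (br (c t) (c' t)) = - c' t"
proof -
  have unc: "uncountable {a<..<b}" using \<open>a < b\<close> by (simp add: uncountable_open_interval)
  obtain t xs where t: "t \<in> {a<..<b}" and xs: "set xs \<subseteq> K" "c t = word xs base"
    and rec: "\<forall>\<delta>>0. \<exists>t'\<in>{a<..<b}. t' \<noteq> t \<and> \<bar>t' - t\<bar> < \<delta> \<and> (\<exists>ys. set ys \<subseteq> K \<and> c t' = word ys base \<and>
        length ys = length xs \<and> (\<forall>i<length xs. norm (ys ! i - xs ! i) < \<delta>))"
    using recurring_word[OF unc, of c] c by metis
  obtain zs where zs: "set zs \<subseteq> K" "\<And>v. word zs (word xs v) = v" "\<And>v. word xs (word zs v) = v"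
    using word_inverse[OF xs(1)] by blast
  define v where "v = word zs (c' t)"
  obtain G where G: "0 < G" "\<And>u. norm (word zs u) \<le> G * norm u"
    using linear_bounded_pos[OF linear_word] by blast
  let ?L = "1 + (br_bound * norm base)\<^sup>2" and ?n = "br_bound * norm base"
  have deriv: "((\<lambda>t. word zs (c t)) has_derivative (\<lambda>h. h *\<^sub>R v)) (at t)"
    unfolding v_def has_vector_derivative_def[symmetric]
    by (rule bounded_linear.has_vector_derivative[OF linear_word[unfolded linear_conv_bounded_linear] c'[OF t]])
  have base: "word zs (c t) = base" by (simp add: xs(2) zs)
  have "norm (normal_part v) \<le> e * (?L + norm (xi v) + ?n)" if e: "0 < e" "e < 1" for e
  proof -
    obtain \<rho> where \<rho>: "0 < \<rho>" and stay: "\<And>m m'. orbit_path m m' \<Longrightarrow> bounded (m' ` {0..1}) \<Longrightarrow> m 0 = base \<Longrightarrow>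
      (\<And>s. s \<in> {0..1} \<Longrightarrow> norm (m s - base) \<le> \<rho>) \<Longrightarrow>
      norm (normal_part (m 1 - base)) \<le> e * norm (xi (m 1))"
      using orbit_path_stays_tangential[OF e(1)] by blast
    have "0 < \<rho> / G" using \<rho> G by simp
    from word_path[OF xs(1) this] obtain \<delta>1 where \<delta>1: "0 < \<delta>1" and
      path: "\<And>ys. length ys = length xs \<Longrightarrow> set ys \<subseteq> K \<Longrightarrow> (\<forall>i<length xs. norm (ys ! i - xs ! i) < \<delta>1) \<Longrightarrow>
        \<exists>m m'. orbit_path m m' \<and> bounded (m' ` {0..1}) \<and> m 0 = word xs base \<and> m 1 = word ys base \<and>
        (\<forall>s\<in>{0..1}. norm (m s - word xs base) \<le> \<rho> / G)"
      by blast
    obtain \<delta>2 where \<delta>2: "0 < \<delta>2" and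
      lin: "\<And>u. norm (u - t) < \<delta>2 \<Longrightarrow> norm (word zs (c u) - base - (u - t) *\<^sub>R v) \<le> e * norm (u - t)"
      using deriv[unfolded has_derivative_at_alt] e(1) base by metis
    from rec[rule_format, of "min \<delta>1 \<delta>2"] \<delta>1 \<delta>2 obtain t' ys where t': "t' \<noteq> t" "\<bar>t' - t\<bar> < \<delta>2"
      and ys: "set ys \<subseteq> K" "c t' = word ys base" "length ys = length xs"
        "\<forall>i<length xs. norm (ys ! i - xs ! i) < \<delta>1"
      by (metis min_less_iff_conj)
    from path[OF ys(3,1,4)] obtain m m' where m: "orbit_path m m'" "bounded (m' ` {0..1})"
      "m 0 = word xs base" "m 1 = word ys base" "\<And>s. s \<in> {0..1} \<Longrightarrow> norm (m s - word xs base) \<le> \<rho> / G"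
      by blast
    have "norm (normal_part (word zs (m 1) - base)) \<le> e * norm (xi (word zs (m 1)))"
    proof (rule stay[OF orbit_path_word[OF m(1) zs(1)]])
      have "(\<lambda>s. word zs (m' s)) ` {0..1} = word zs ` m' ` {0..1}" by (simp add: image_image)
      then show "bounded ((\<lambda>s. word zs (m' s)) ` {0..1})"
        using bounded_linear_image[OF m(2) linear_word[unfolded linear_conv_bounded_linear]] by simp
      show "word zs (m 0) = base" by (simp add: m(3) zs)
      fix s :: real assume s: "s \<in> {0..1}"
      have "norm (word zs (m s) - base) = norm (word zs (m s - word xs base))"
        by (simp add: linear_diff[OF linear_word] zs)
      also have "\<dots> \<le> G * norm (m s - word xs base)" by (rule G(2))
      also have "\<dots> \<le> G * (\<rho> / G)" using m(5)[OF s] G(1) by (intro mult_left_mono) auto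
      finally show "norm (word zs (m s) - base) \<le> \<rho>" using G(1) by simp
    qed
    then have *: "norm (normal_part (word zs (c t') - base)) \<le> e * norm (xi (word zs (c t')))"
      by (simp add: m(4) ys(2))
    define h where "h = t' - t"
    define r where "r = word zs (c t') - base - h *\<^sub>R v"
    have h: "0 < \<bar>h\<bar>" using t'(1) by (simp add: h_def)
    have r: "norm r \<le> e * \<bar>h\<bar>" using lin[of t'] t'(2) by (simp add: r_def h_def)
    have split: "word zs (c t') = base + h *\<^sub>R v + r" by (simp add: r_def)
    have "xi (word zs (c t')) = h *\<^sub>R xi v + xi r"
      unfolding split by (simp add: xi_def br_simps br_self)
    then have "norm (xi (word zs (c t'))) \<le> \<bar>h\<bar> * norm (xi v) + norm (xi r)"
      using norm_triangle_ineq[of "h *\<^sub>R xi v" "xi r"] by simp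
    also have "norm (xi r) \<le> ?n * norm r"
      using norm_br_le[of r base] by (simp add: xi_def mult_ac)
    also have "?n * norm r \<le> ?n * \<bar>h\<bar>"
    proof (rule mult_left_mono)
      show "norm r \<le> \<bar>h\<bar>" using r e mult_left_le_one_le[of "\<bar>h\<bar>" e] by simp
      show "0 \<le> ?n" using br_bound_pos by simp
    qed
    finally have xi_le: "norm (xi (word zs (c t'))) \<le> \<bar>h\<bar> * norm (xi v) + ?n * \<bar>h\<bar>" by simp
    have "h *\<^sub>R normal_part v = normal_part (word zs (c t') - base) - normal_part r"
      unfolding split by (simp add: linear_add[OF linear_normal_part] linear_scale[OF linear_normal_part])
    then have "\<bar>h\<bar> * norm (normal_part v) \<le> norm (normal_part (word zs (c t') - base)) + norm (normal_part r)"
      by (metis norm_scaleR norm_triangle_ineq4)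
    also have "\<dots> \<le> e * (\<bar>h\<bar> * norm (xi v) + ?n * \<bar>h\<bar>) + ?L * (e * \<bar>h\<bar>)"
    proof (rule add_mono)
      show "norm (normal_part (word zs (c t') - base)) \<le> e * (\<bar>h\<bar> * norm (xi v) + ?n * \<bar>h\<bar>)"
        using * mult_left_mono[OF xi_le less_imp_le[OF e(1)]] by simp
      have "norm (normal_part r) \<le> ?L * norm r" by (rule normal_part_norm_le)
      also have "\<dots> \<le> ?L * (e * \<bar>h\<bar>)" using r by (intro mult_left_mono) auto
      finally show "norm (normal_part r) \<le> ?L * (e * \<bar>h\<bar>)" .
    qed
    also have "\<dots> = \<bar>h\<bar> * (e * (?L + norm (xi v) + ?n))" by (simp add: algebra_simps)
    finally show ?thesis using h by simp
  qed
  note small = this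
  have "norm (normal_part v) = 0"
  proof (rule ccontr)
    assume "norm (normal_part v) \<noteq> 0"
    then have N: "0 < norm (normal_part v)" by simp
    define A where "A = ?L + norm (xi v) + ?n"
    have "0 \<le> ?n" using br_bound_pos by simp
    then have A: "1 \<le> A" by (simp add: A_def add_increasing2)
    define e where "e = min (1 / 2) (norm (normal_part v) / (2 * A))"
    have e: "0 < e" "e < 1" using N A by (auto simp: e_def)
    have "norm (normal_part v) \<le> e * A" unfolding A_def by (rule small[OF e])
    also have "\<dots> \<le> norm (normal_part v) / (2 * A) * A"
      using A by (intro mult_right_mono) (auto simp: e_def)
    also have "\<dots> = norm (normal_part v) / 2" using A by (simp add: field_simps)
    finally show False using N by simp
  qed
  then have "br base (br base v) = - v"
    by (simp add: normal_part_def eq_neg_iff_add_eq_0 add.commute)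
  then have "word xs (br base (br base v)) = - word xs v"
    by (simp add: linear_neg[OF linear_word])
  then have "br (c t) (br (c t) (c' t)) = - c' t"
    by (simp add: word_bracket v_def zs xs(2)[symmetric])
  with t show thesis by (rule that)
qed

text \<open>
  Parameters with tangential velocity are dense and form a closed set.
\<close>

theorem curve_in_orbit_is_tangent:
  assumes c: "\<And>t. c t \<in> orbit" and c': "\<And>t. (c has_vector_derivative c' t) (at t)"
    and cont: "continuous_on UNIV c'"
  shows "br (c t) (br (c t) (c' t)) = - c' t"
proof (rule ccontr)
  assume neq: "br (c t) (br (c t) (c' t)) \<noteq> - c' t"
  define G where "G = (\<lambda>t. br (c t) (br (c t) (c' t)) + c' t)"
  have "continuous_on UNIV c"
    using c' by (intro continuous_at_imp_continuous_on) (auto intro: has_vector_derivative_continuous)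
  then have "continuous_on UNIV G"
    unfolding G_def using cont
    by (intro continuous_on_add bounded_bilinear.continuous_on[OF bounded_bilinear_br])
  then have "open (G -` (- {0}))" by (intro open_vimage) auto
  moreover have "t \<in> G -` (- {0})" using neq by (simp add: G_def eq_neg_iff_add_eq_0)
  ultimately obtain e where e: "0 < e" "ball t e \<subseteq> G -` (- {0})" by (meson openE)
  obtain s where s: "s \<in> {t - e<..<t + e}" "br (c s) (br (c s) (c' s)) = - c' s"
    by (rule tangent_somewhere[of "t - e" "t + e" c c']) (use e c c' in auto)
  then have "s \<in> ball t e" by (auto simp: dist_real_def)
  with e have "G s \<noteq> 0" by auto
  with s(2) show False by (simp add: G_def)
qed

end

section \<open>Coordinates\<close>

text \<open>
  The space of a triple carries an arbitrary norm, while the analysis above takes place in a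
  Euclidean space. Finite dimension being a property of the type, a Euclidean space of
  coordinates can be attached to the type itself.
\<close>

definition spanning_set :: "'a::real_vector itself \<Rightarrow> 'a set" where
  "spanning_set _ = (if finite_dimensional TYPE('a) then SOME S. finite S \<and> span S = UNIV else {})"

lemma finite_spanning_set: "finite (spanning_set TYPE('a::real_vector))"
  and span_spanning_set: "finite_dimensional TYPE('a::real_vector) \<Longrightarrow> span (spanning_set TYPE('a)) = UNIV"
proof -
  have "finite (spanning_set TYPE('a)) \<and> span (spanning_set TYPE('a)) = UNIV"
    if "finite_dimensional TYPE('a)"
    using someI_ex[OF that[unfolded finite_dimensional_def]] that
    by (simp add: spanning_set_def)
  then show "finite (spanning_set TYPE('a))"
    "finite_dimensional TYPE('a) \<Longrightarrow> span (spanning_set TYPE('a)) = UNIV"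
    by (auto simp: spanning_set_def)
qed

text \<open>
  The vector 0 is included because an index type cannot be empty, not even for the zero space;
  hence \<open>from_coords\<close> is onto but not injective.
\<close>

typedef (overloaded) ('a::real_vector) coordinate_index = "insert 0 (spanning_set TYPE('a))"
  by blast

instance coordinate_index :: (real_vector) finite
proof
  show "finite (UNIV :: 'a coordinate_index set)"
    unfolding type_definition.univ[OF type_definition_coordinate_index]
    by (simp add: finite_spanning_set)
qed

definition from_coords :: "real ^ ('a::real_vector) coordinate_index \<Rightarrow> 'a" where
  "from_coords y = (\<Sum>i\<in>UNIV. (y $ i) *\<^sub>R Rep_coordinate_index i)"

lemma linear_from_coords: "linear from_coords"
  by (rule linearI) (simp_all add: from_coords_def scaleR_add_left sum.distrib scaleR_sum_right)

lemma surj_from_coords: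
  assumes "finite_dimensional TYPE('a::real_vector)"
  shows "surj (from_coords :: _ \<Rightarrow> 'a)"
proof -
  have "spanning_set TYPE('a) \<subseteq> range from_coords"
  proof
    fix x :: 'a assume "x \<in> spanning_set TYPE('a)"
    then have x: "Rep_coordinate_index (Abs_coordinate_index x) = x"
      by (simp add: Abs_coordinate_index_inverse)
    have "from_coords (axis (Abs_coordinate_index x) 1) = x"
      unfolding from_coords_def axis_def
      by (simp add: if_distrib[of "\<lambda>r. r *\<^sub>R _"] x cong: if_cong)
    then show "x \<in> range from_coords" by (metis rangeI)
  qed
  then have "span (spanning_set TYPE('a)) \<subseteq> range from_coords"
    by (intro span_minimal linear_subspace_image[OF linear_from_coords] subspace_UNIV)
  then show ?thesis using span_spanning_set[OF assms] by auto
qed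

definition to_coords :: "'a::real_vector \<Rightarrow> real ^ 'a coordinate_index" where
  "to_coords = (SOME g. linear g \<and> from_coords \<circ> g = id)"

lemma to_coords:
  assumes "finite_dimensional TYPE('a::real_vector)"
  shows "linear (to_coords :: 'a \<Rightarrow> _)" "from_coords (to_coords x) = (x :: 'a)"
proof -
  have "linear (to_coords :: 'a \<Rightarrow> _) \<and> from_coords \<circ> to_coords = (id :: 'a \<Rightarrow> 'a)"
    unfolding to_coords_def
    by (rule someI_ex[OF linear_surjective_right_inverse[OF linear_from_coords surj_from_coords[OF assms]]])
  then show "linear (to_coords :: 'a \<Rightarrow> _)" "from_coords (to_coords x) = (x :: 'a)"
    by (auto simp: fun_eq_iff)
qed

section \<open>Adjoining a derivation to a Lie algebra\<close>

text \<open>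
  The semidirect product of \<open>\<gg>\<close> with the line spanned by \<open>D\<close>: the pair \<open>(x, a)\<close> stands for
  \<open>x + a D\<close>. For a triple, \<open>ad(x, 0)\<close> is the homogenization of the affine vector field
  \<open>\<phi>(x)\<close>, and 0 in the affine space corresponds to the element \<open>D\<close>.
\<close>

definition hat_bracket :: "('a::real_vector \<Rightarrow> 'a \<Rightarrow> 'a) \<Rightarrow> ('a \<Rightarrow> 'a) \<Rightarrow> 'a \<times> real \<Rightarrow> 'a \<times> real \<Rightarrow> 'a \<times> real" where
  "hat_bracket br D = (\<lambda>(x, a) (y, b). (br x y + a *\<^sub>R D y - b *\<^sub>R D x, 0))"

lemma lie_bracket_hat_bracket:
  fixes br :: "'a::real_vector \<Rightarrow> 'a \<Rightarrow> 'a"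
  assumes lie: "lie_bracket br" and D: "linear D" and der: "\<And>x y. D (br x y) = br (D x) y + br x (D y)"
  shows "lie_bracket (hat_bracket br D)"
proof -
  have bil: "bilinear br" and self: "\<And>x. br x x = 0"
    and jac: "\<And>x y z. br x (br y z) + br y (br z x) + br z (br x y) = 0"
    using lie by (auto simp: lie_bracket_def)
  note simps = bilinear_ladd[OF bil] bilinear_radd[OF bil] bilinear_lsub[OF bil] bilinear_rsub[OF bil]
    bilinear_lmul[OF bil] bilinear_rmul[OF bil] linear_add[OF D] linear_scale[OF D] linear_diff[OF D]
  have anti: "br x y = - br y x" for x y
  proof -
    have "br x y + br y x = br (x + y) (x + y)" by (simp add: simps self[of x] self[of y])
    then show ?thesis by (simp add: self eq_neg_iff_add_eq_0)
  qed
  have "bilinear (hat_bracket br D)"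
    unfolding bilinear_def hat_bracket_def
    by (intro conjI allI linearI) (auto simp: simps algebra_simps)
  moreover have "hat_bracket br D p p = 0" for p
    by (simp add: hat_bracket_def case_prod_beta self zero_prod_def)
  moreover have "hat_bracket br D p (hat_bracket br D q r) + hat_bracket br D q (hat_bracket br D r p)
      + hat_bracket br D r (hat_bracket br D p q) = 0" for p q r
  proof -
    obtain x a y b z c where pqr: "p = (x, a)" "q = (y, b)" "r = (z, c)" by (metis surj_pair)
    show ?thesis
      unfolding pqr hat_bracket_def using jac[of x y z]
      by (simp add: simps der anti[of "D _"] algebra_simps zero_prod_def)
  qed
  ultimately show ?thesis by (simp add: lie_bracket_def)
qed

section \<open>Weak extrinsic symmetric triples\<close>

locale weak_triple =
  fixes T :: "'a::real_normed_vector triple"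
  assumes weak: "weak_extrinsic_symmetric_triple T"
begin

abbreviation "br \<equiv> bracket T"
abbreviation "B \<equiv> form T"
abbreviation "D \<equiv> der T"
abbreviation "\<theta> \<equiv> invol T"
abbreviation "gplus \<equiv> plus_space T"
abbreviation "gminus \<equiv> minus_space T"

lemma fd: "finite_dimensional TYPE('a)"
  and lie: "lie_bracket br"
  and bilinear_br: "bilinear br" and br_self: "br x x = 0"
  and jacobi: "br x (br y z) + br y (br z x) + br z (br x y) = 0"
  and bilinear_B: "bilinear B" and B_sym: "B x y = B y x"
  and B_inv: "B (br x y) z = - B y (br x z)"
  and linear_inv: "linear \<theta>" and inv_inv: "\<theta> (\<theta> x) = x"
  and inv_br: "\<theta> (br x y) = br (\<theta> x) (\<theta> y)" and B_theta: "B (\<theta> x) (\<theta> y) = B x y"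
  and linear_D: "linear D" and D_br: "D (br x y) = br (D x) y + br x (D y)"
  and B_D: "B (D x) y = - B x (D y)"
  and D_cube: "D (D (D x)) = - D x" and D_inv: "D (\<theta> x) = - \<theta> (D x)"
  and span_up_minus: "span {br x y | x y. x \<in> gplus \<inter> up_minus_space T \<and> y \<in> gplus \<inter> up_minus_space T}
       = gplus \<inter> up_plus_space T"
  and nondeg: "nondegenerate_on B {x + y | x y. x \<in> gplus \<and> y \<in> gminus \<inter> up_minus_space T}"
  using weak
  by (auto simp: weak_extrinsic_symmetric_triple_def lie_bracket_def invariant_symmetric_form_def
      involutive_isometric_automorphism_def antisymmetric_derivation_def eq_neg_iff_add_eq_0)

lemmas br_simps = bilinear_ladd[OF bilinear_br] bilinear_radd[OF bilinear_br]
  bilinear_lsub[OF bilinear_br] bilinear_rsub[OF bilinear_br]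
  bilinear_lneg[OF bilinear_br] bilinear_rneg[OF bilinear_br]
  bilinear_lmul[OF bilinear_br] bilinear_rmul[OF bilinear_br]
  bilinear_lzero[OF bilinear_br] bilinear_rzero[OF bilinear_br]

lemmas B_simps = bilinear_ladd[OF bilinear_B] bilinear_radd[OF bilinear_B]
  bilinear_lsub[OF bilinear_B] bilinear_rsub[OF bilinear_B]
  bilinear_lneg[OF bilinear_B] bilinear_rneg[OF bilinear_B]
  bilinear_lmul[OF bilinear_B] bilinear_rmul[OF bilinear_B]
  bilinear_lzero[OF bilinear_B] bilinear_rzero[OF bilinear_B]

lemmas D_simps = linear_add[OF linear_D] linear_diff[OF linear_D] linear_neg[OF linear_D]
  linear_scale[OF linear_D] linear_0[OF linear_D]

lemmas inv_simps = linear_add[OF linear_inv] linear_diff[OF linear_inv] linear_neg[OF linear_inv]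
  linear_scale[OF linear_inv] linear_0[OF linear_inv]

lemma linear_br: "linear (br x)"
  using bilinear_br by (simp add: bilinear_def)

lemma br_anti: "br x y = - br y x"
proof -
  have "br x y + br y x = br (x + y) (x + y)" by (simp add: br_simps br_self[of x] br_self[of y])
  then show ?thesis by (simp add: br_self eq_neg_iff_add_eq_0)
qed

lemma br_derivation: "br x (br y z) = br (br x y) z + br y (br x z)"
proof -
  have "br x (br y z) = - br z (br x y) - br y (br z x)"
    using jacobi[of x y z] by (simp add: algebra_simps eq_neg_iff_add_eq_0)
  then show ?thesis
    using br_anti[of z "br x y"] br_anti[of z x] by (simp add: br_simps)
qed

lemma subspace_plus: "subspace gplus" and subspace_minus: "subspace gminus"
  by (auto simp: subspace_def plus_space_def minus_space_def inv_simps)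

lemma br_plus_plus: "x \<in> gplus \<Longrightarrow> y \<in> gplus \<Longrightarrow> br x y \<in> gplus"
  and br_plus_minus: "x \<in> gplus \<Longrightarrow> y \<in> gminus \<Longrightarrow> br x y \<in> gminus"
  and br_minus_minus: "x \<in> gminus \<Longrightarrow> y \<in> gminus \<Longrightarrow> br x y \<in> gplus"
  by (simp_all add: plus_space_def minus_space_def inv_br br_simps)

lemma inv_D: "\<theta> (D x) = - D (\<theta> x)"
  using D_inv[of x] by simp

lemma D_plus: "x \<in> gplus \<Longrightarrow> D x \<in> gminus"
  and D_minus: "x \<in> gminus \<Longrightarrow> D x \<in> gplus"
  by (simp_all add: plus_space_def minus_space_def inv_D D_simps)

lemmas to_coords_T = to_coords[OF fd]

lemmas to_simps = linear_add[OF to_coords_T(1)] linear_diff[OF to_coords_T(1)]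
  linear_neg[OF to_coords_T(1)] linear_scale[OF to_coords_T(1)] linear_0[OF to_coords_T(1)]

lemmas from_simps = linear_add[OF linear_from_coords] linear_diff[OF linear_from_coords]
  linear_neg[OF linear_from_coords] linear_scale[OF linear_from_coords] linear_0[OF linear_from_coords]

definition cbr :: "real ^ 'a coordinate_index \<Rightarrow> real ^ 'a coordinate_index \<Rightarrow> real ^ 'a coordinate_index" where
  "cbr x y = to_coords (br (from_coords x) (from_coords y))"

definition cD :: "real ^ 'a coordinate_index \<Rightarrow> real ^ 'a coordinate_index" where
  "cD x = to_coords (D (from_coords x))"

abbreviation "hbr \<equiv> hat_bracket cbr cD"

lemma bilinear_cbr: "bilinear cbr"
  unfolding bilinear_def
  by (intro conjI allI linearI) (simp_all add: cbr_def br_simps to_simps from_simps)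

lemma linear_cbr: "linear (cbr x)"
  using bilinear_cbr by (simp add: bilinear_def)

lemma linear_cD: "linear cD"
  by (rule linearI) (simp_all add: cD_def D_simps to_simps from_simps)

text \<open>
  The involution extends to the semidirect product by \<open>D \<mapsto> - D\<close>, which puts \<open>D\<close> itself into
  the \<open>-1\<close>-eigenspace; \<open>ad(D)\<^sup>3 = - ad(D)\<close> is the cubic equation for \<open>D\<close>.
\<close>

sublocale hat: symmetric_lie_algebra hbr
  "(\<lambda>x. (to_coords x, 0)) ` gplus" "to_coords ` gminus \<times> UNIV" "(0, 1)"
proof
  have "lie_bracket cbr"
    unfolding lie_bracket_def using bilinear_cbr jacobi
    by (simp add: cbr_def to_coords_T br_self to_simps flip: to_simps(1))
  moreover have "cD (cbr x y) = cbr (cD x) y + cbr x (cD y)" for x y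
    by (simp add: cD_def cbr_def to_coords_T D_br to_simps)
  ultimately show "lie_bracket hbr" by (intro lie_bracket_hat_bracket linear_cD)
  have "linear (\<lambda>x::'a. (to_coords x, 0::real))" by (rule linearI) (simp_all add: to_simps)
  then show "subspace ((\<lambda>x. (to_coords x, 0::real)) ` gplus)"
    using subspace_plus by (rule linear_subspace_image)
  show "subspace (to_coords ` gminus \<times> (UNIV :: real set))"
    by (intro subspace_Times linear_subspace_image[OF to_coords_T(1) subspace_minus] subspace_UNIV)
  show "hbr p q \<in> (\<lambda>x. (to_coords x, 0)) ` gplus"
    if "p \<in> (\<lambda>x. (to_coords x, 0)) ` gplus" "q \<in> (\<lambda>x. (to_coords x, 0)) ` gplus" for p q
    using that by (auto simp: hat_bracket_def cbr_def to_coords_T intro!: br_plus_plus)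
  show "hbr p q \<in> to_coords ` gminus \<times> UNIV"
    if "p \<in> (\<lambda>x. (to_coords x, 0)) ` gplus" "q \<in> to_coords ` gminus \<times> UNIV" for p q
  proof -
    from that obtain x y b where xy: "x \<in> gplus" "y \<in> gminus" "p = (to_coords x, 0)" "q = (to_coords y, b)"
      by auto
    have "hbr p q = (to_coords (br x y - b *\<^sub>R D x), 0)"
      by (simp add: xy(3,4) hat_bracket_def cbr_def cD_def to_coords_T to_simps)
    moreover have "br x y - b *\<^sub>R D x \<in> gminus"
      using xy by (intro subspace_diff subspace_scale subspace_minus br_plus_minus D_plus)
    ultimately show ?thesis by auto
  qed
  show "hbr p q \<in> (\<lambda>x. (to_coords x, 0)) ` gplus"
    if "p \<in> to_coords ` gminus \<times> UNIV" "q \<in> to_coords ` gminus \<times> UNIV" for p q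
  proof -
    from that obtain x a y b where xy: "x \<in> gminus" "y \<in> gminus" "p = (to_coords x, a)" "q = (to_coords y, b)"
      by auto
    have "hbr p q = (to_coords (br x y + a *\<^sub>R D y - b *\<^sub>R D x), 0)"
      by (simp add: xy(3,4) hat_bracket_def cbr_def cD_def to_coords_T to_simps)
    moreover have "br x y + a *\<^sub>R D y - b *\<^sub>R D x \<in> gplus"
      using xy by (intro subspace_diff subspace_add subspace_scale subspace_plus br_minus_minus D_minus)
    ultimately show ?thesis by auto
  qed
  have "to_coords 0 \<in> to_coords ` gminus" using subspace_0[OF subspace_minus] by blast
  then show "(0, 1) \<in> to_coords ` gminus \<times> (UNIV :: real set)" by (simp add: to_simps)
  show "hbr (0, 1) (hbr (0, 1) (hbr (0, 1) p)) = - hbr (0, 1) p" for p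
    by (simp add: hat_bracket_def case_prod_beta linear_0[OF linear_cD] cD_def cbr_def from_simps
        br_simps to_simps to_coords_T D_simps D_cube)
qed

section \<open>The transvection group and its orbit\<close>

definition transvection :: "'a \<Rightarrow> 'a \<Rightarrow> 'a" where
  "transvection x v = exp_affine (phi T x) v"

definition linear_part :: "'a \<Rightarrow> 'a \<Rightarrow> 'a" where
  "linear_part x v = from_coords (exp_linear (cbr (to_coords x)) (to_coords v))"

text \<open>
  Inverses of exponentials are exponentials, so this closure is the orbit of 0 under the generated
  group.
\<close>

inductive_set orb :: "'a set" where
  zero_orb: "0 \<in> orb"
| transvection_orb: "x \<in> gplus \<Longrightarrow> v \<in> orb \<Longrightarrow> transvection x v \<in> orb"

lemma exp_cbr_range: "to_coords (linear_part x v) = exp_linear (cbr (to_coords x)) (to_coords v)"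
proof -
  have "flow (cbr (to_coords x)) 1 (to_coords v) \<in> range to_coords"
    by (rule flow_in_subspace[OF linear_cbr linear_subspace_image[OF to_coords_T(1) subspace_UNIV]])
      (auto simp: cbr_def)
  then obtain w where "exp_linear (cbr (to_coords x)) (to_coords v) = to_coords w"
    by (auto simp: flow_1)
  then show ?thesis by (simp add: linear_part_def to_coords_T)
qed

lemma snd_hat_exp: "snd (hat.ead (to_coords x, 0) (y, s)) = s"
proof -
  have "snd (hat.ead (to_coords x, 0) (y, s)) = exp_linear (\<lambda>r. 0) (snd (y, s))"
    by (rule exp_linear_intertwine[OF hat.linear_br linear_snd])
      (simp add: hat_bracket_def case_prod_beta)
  then show ?thesis by (simp add: exp_linear_zero)
qed

lemma hat_exp_linear: "hat.ead (to_coords x, 0) (to_coords v, 0) = (to_coords (linear_part x v), 0)"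
proof -
  have "linear (\<lambda>y::real ^ 'a coordinate_index. (y, 0::real))" by (rule linearI) simp_all
  from exp_linear_intertwine[OF linear_cbr this, of _ "hbr (to_coords x, 0)" "to_coords v"]
  show ?thesis by (simp add: hat_bracket_def exp_cbr_range)
qed

lemma hat_exp_affine: "hat.ead (to_coords x, 0) (to_coords v, 1) = (to_coords (transvection x v), 1)"
proof -
  define e where "e = hat.ead (to_coords x, 0) (to_coords v, 1)"
  define F where "F = (\<lambda>(y :: real ^ 'a coordinate_index, s :: real). (from_coords y, s))"
  have F: "linear F" by (rule linearI) (auto simp: F_def from_simps)
  have "F e = exp_linear (homogenize (phi T x)) (F (to_coords v, 1))"
    unfolding e_def
    by (rule exp_linear_intertwine[OF hat.linear_br F])
      (auto simp: F_def hat_bracket_def homogenize_def phi_def cbr_def cD_def to_coords_T from_simps)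
  then have "from_coords (fst e) = transvection x v"
    by (simp add: transvection_def exp_affine_def F_def to_coords_T case_prod_beta prod_eq_iff)
  moreover have "fst e \<in> range to_coords"
  proof -
    have "flow (hbr (to_coords x, 0)) 1 (to_coords v, 1) \<in> range to_coords \<times> UNIV"
      by (rule flow_in_subspace[OF hat.linear_br
            subspace_Times[OF linear_subspace_image[OF to_coords_T(1) subspace_UNIV] subspace_UNIV]])
        (auto simp: hat_bracket_def cbr_def cD_def simp flip: to_simps)
    then show ?thesis by (auto simp: e_def flow_1)
  qed
  ultimately have "fst e = to_coords (transvection x v)" by (auto simp: to_coords_T)
  moreover have "snd e = 1" unfolding e_def by (rule snd_hat_exp)
  ultimately show ?thesis by (simp add: e_def prod_eq_iff)
qed

lemma orb_hat: "v \<in> orb \<Longrightarrow> (to_coords v, 1) \<in> hat.orbit"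
proof (induction rule: orb.induct)
  case zero_orb show ?case using hat.base_orbit by (simp add: to_simps)
next
  case (transvection_orb x v)
  have "hat.ead (to_coords x, 0) (to_coords v, 1) \<in> hat.orbit"
    using transvection_orb by (intro hat.ead_orbit) auto
  then show ?case by (simp add: hat_exp_affine)
qed

lemma to_coords_inj: "to_coords x = to_coords y \<longleftrightarrow> x = (y :: 'a)"
  by (metis to_coords_T(2))

lemma orb_minus: "v \<in> orb \<Longrightarrow> v \<in> gminus"
proof -
  assume "v \<in> orb"
  from hat.orbit_P[OF orb_hat[OF this]] have "to_coords v \<in> to_coords ` gminus" by simp
  then show "v \<in> gminus" by (auto simp: to_coords_inj)
qed

lemma linear_linear_part: "linear (linear_part x)"
  unfolding linear_part_def
  using linear_flow[OF linear_cbr, of "to_coords x" 1]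
  by (intro linearI) (simp_all add: flow_1 to_simps from_simps linear_add linear_scale
      linear_flow[OF linear_cbr, of "to_coords x" 1, THEN linear_add, unfolded flow_1]
      linear_flow[OF linear_cbr, of "to_coords x" 1, THEN linear_scale, unfolded flow_1])

lemma transvection_affine: "transvection x v = linear_part x v + transvection x 0"
proof -
  have "hat.ead (to_coords x, 0) (to_coords v, 1)
      = hat.ead (to_coords x, 0) (to_coords v, 0) + hat.ead (to_coords x, 0) (to_coords 0, 1)"
    by (simp add: to_simps flip: linear_add[OF hat.linear_ead])
  then have "to_coords (transvection x v) = to_coords (linear_part x v + transvection x 0)"
    by (simp only: hat_exp_affine hat_exp_linear) (simp add: to_simps)
  then show ?thesis by (simp add: to_coords_inj)
qed

lemma linear_part_minus:
  assumes "x \<in> gplus" "v \<in> gminus"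
  shows "linear_part x v \<in> gminus"
proof -
  have "hat.ead (to_coords x, 0) (to_coords v, 0) \<in> to_coords ` gminus \<times> UNIV"
    using assms by (intro hat.ead_P) auto
  then show ?thesis by (auto simp: hat_exp_linear to_coords_inj)
qed

lemma transvection_minus:
  assumes "x \<in> gplus" "v \<in> gminus"
  shows "transvection x v \<in> gminus"
proof -
  have "hat.ead (to_coords x, 0) (to_coords v, 1) \<in> to_coords ` gminus \<times> UNIV"
    using assms by (intro hat.ead_P) auto
  then show ?thesis by (auto simp: hat_exp_affine to_coords_inj)
qed

lemma transvection_inverse: "transvection (- x) (transvection x v) = v" "transvection x (transvection (- x) v) = v"
  and linear_part_inverse: "linear_part (- x) (linear_part x v) = v" "linear_part x (linear_part (- x) v) = v"
proof -
  have neg: "(to_coords (- x), 0 :: real) = - (to_coords x, 0)" by (simp add: to_simps)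
  show "transvection (- x) (transvection x v) = v"
    using hat.ead_minus(1)[of "(to_coords x, 0)" "(to_coords v, 1)"]
    by (simp only: hat_exp_affine neg[symmetric]) (simp add: to_coords_inj)
  show "transvection x (transvection (- x) v) = v"
    using hat.ead_minus(2)[of "(to_coords x, 0)" "(to_coords v, 1)"]
    by (simp only: hat_exp_affine neg[symmetric]) (simp add: to_coords_inj)
  show "linear_part (- x) (linear_part x v) = v"
    using hat.ead_minus(1)[of "(to_coords x, 0)" "(to_coords v, 0)"]
    by (simp only: hat_exp_linear neg[symmetric]) (simp add: to_coords_inj)
  show "linear_part x (linear_part (- x) v) = v"
    using hat.ead_minus(2)[of "(to_coords x, 0)" "(to_coords v, 0)"]
    by (simp only: hat_exp_linear neg[symmetric]) (simp add: to_coords_inj)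
qed

text \<open>
  Along the flow of \<open>ad(x)\<close> the form is constant, by its invariance.
\<close>

lemma linear_part_isometry: "B (linear_part x u) (linear_part x v) = B u v"
proof -
  define b where "b = (\<lambda>p q. B (from_coords p) (from_coords q))"
  have "bilinear b"
    unfolding bilinear_def b_def
    by (intro conjI allI linearI) (simp_all add: B_simps from_simps)
  then have bb: "bounded_bilinear b" by (simp add: bilinear_conv_bounded_bilinear)
  let ?A = "cbr (to_coords x)"
  define r where "r = (\<lambda>t. b (flow ?A t (to_coords u)) (flow ?A t (to_coords v)))"
  have "(r has_vector_derivative 0) (at t within UNIV)" for t
  proof -
    have inv: "b p (?A q) + b (?A p) q = 0" for p q
      by (simp add: b_def cbr_def to_coords_T B_inv)
    show ?thesis
      using bounded_bilinear.has_vector_derivative[OF bb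
          flow_has_vector_derivative_at[OF linear_cbr, of "to_coords x" "to_coords u" t UNIV]
          flow_has_vector_derivative_at[OF linear_cbr, of "to_coords x" "to_coords v" t UNIV]]
      by (simp add: r_def inv)
  qed
  then obtain k where "\<And>t. r t = k"
    using has_vector_derivative_zero_constant[of UNIV r] by auto
  then have "r 1 = r 0" by simp
  then show ?thesis
    by (simp add: r_def b_def flow_1 flow_0[OF linear_cbr] to_coords_T linear_part_def)
qed

lemma affine_isometry_transvection:
  assumes "x \<in> gplus"
  shows "affine_isometry gminus B gminus B (transvection x)"
  unfolding affine_isometry_def
proof (intro exI conjI ballI)
  show "linear (linear_part x)" by (rule linear_linear_part)
  show "transvection x 0 \<in> gminus" using assms subspace_0[OF subspace_minus] by (rule transvection_minus)
  show "transvection x v = linear_part x v + transvection x 0" for v by (rule transvection_affine)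
  have "- x \<in> gplus" using assms subspace_neg[OF subspace_plus] by blast
  then show "bij_betw (linear_part x) gminus gminus"
    using assms by (intro bij_betw_byWitness[of _ "linear_part (- x)"]) (auto simp: linear_part_inverse linear_part_minus)
  show "B (linear_part x u) (linear_part x v) = B u v" for u v by (rule linear_part_isometry)
qed

lemma affine_isometry_restrict:
  "affine_isometry gminus B gminus B (restrict f gminus) \<longleftrightarrow> affine_isometry gminus B gminus B f"
  unfolding affine_isometry_def by simp

lemma affine_isometry_bij:
  assumes "affine_isometry gminus B gminus B f"
  shows "bij_betw f gminus gminus"
proof -
  from assms obtain L c where L: "c \<in> gminus" "\<And>v. v \<in> gminus \<Longrightarrow> f v = L v + c" "bij_betw L gminus gminus"
    unfolding affine_isometry_def by blast
  have "bij_betw (\<lambda>v. v + c) gminus gminus"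
    using L(1) subspace_minus
    by (intro bij_betw_byWitness[of _ "\<lambda>v. v - c"]) (auto intro: subspace_add subspace_diff)
  from bij_betw_trans[OF L(3) this] have "bij_betw (\<lambda>v. L v + c) gminus gminus"
    by (simp add: o_def)
  then show ?thesis using L(2) by (subst bij_betw_cong) auto
qed

text \<open>
  The transvection group is generated inside \<open>Iso\<close>; knowing this to be a group identifies the
  inverses of its generators.
\<close>

lemma subgroup_Iso: "subgroup {f \<in> extensional gminus. affine_isometry gminus B gminus B f} (BijGroup gminus)"
proof (rule group.subgroupI[OF group_BijGroup])
  let ?I = "{f \<in> extensional gminus. affine_isometry gminus B gminus B f}"
  show sub: "?I \<subseteq> carrier (BijGroup gminus)"
    by (auto simp: BijGroup_def Bij_def affine_isometry_bij)
  have "restrict (transvection 0) gminus \<in> ?I"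
    using affine_isometry_transvection subspace_0[OF subspace_plus] by (simp add: affine_isometry_restrict)
  then show "?I \<noteq> {}" by blast
  fix f assume f: "f \<in> ?I"
  then obtain L c where L: "linear L" "c \<in> gminus" "\<And>v. v \<in> gminus \<Longrightarrow> f v = L v + c"
    "bij_betw L gminus gminus" "\<And>u v. u \<in> gminus \<Longrightarrow> v \<in> gminus \<Longrightarrow> B (L u) (L v) = B u v"
    unfolding affine_isometry_def by blast
  from f have fB: "f \<in> Bij gminus" using sub by (auto simp: BijGroup_def)
  obtain L' where L': "linear L'" "\<And>v. v \<in> gminus \<Longrightarrow> L' (L v) = v"
    using linear_exists_left_inverse_on[OF L(1) subspace_minus bij_betw_imp_inj_on[OF L(4)]] by blast
  have L'_mem: "L' w \<in> gminus" "L (L' w) = w" if "w \<in> gminus" for w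
  proof -
    from that L(4) obtain v where "v \<in> gminus" "w = L v" by (auto simp: bij_betw_def)
    then show "L' w \<in> gminus" "L (L' w) = w" using L' by auto
  qed
  have inv_eq: "inv_into gminus f w = L' w + - L' c" if w: "w \<in> gminus" for w
  proof (rule inv_into_f_eq)
    show "inj_on f gminus" using fB by (auto simp: Bij_def bij_betw_def)
    show mem: "L' w + - L' c \<in> gminus"
      using L'_mem(1)[OF w] L'_mem(1)[OF L(2)] subspace_diff[OF subspace_minus] by simp
    show "f (L' w + - L' c) = w"
      using L(3)[OF mem] L'_mem(2)[OF w] L'_mem(2)[OF L(2)] by (simp add: linear_diff[OF L(1)])
  qed
  have "affine_isometry gminus B gminus B (\<lambda>w\<in>gminus. inv_into gminus f w)"
    unfolding affine_isometry_restrict unfolding affine_isometry_def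
  proof (intro exI conjI ballI)
    show "linear L'" by fact
    show "- L' c \<in> gminus" using L'_mem(1)[OF L(2)] subspace_neg[OF subspace_minus] by blast
    show "inv_into gminus f w = L' w + - L' c" if "w \<in> gminus" for w using that by (rule inv_eq)
    show "bij_betw L' gminus gminus"
      using L'_mem L'(2) L(4) by (intro bij_betw_byWitness[of _ L]) (auto simp: bij_betw_def)
    show "B (L' u) (L' v) = B u v" if "u \<in> gminus" "v \<in> gminus" for u v
      using L(5)[OF L'_mem(1)[OF that(1)] L'_mem(1)[OF that(2)]] L'_mem(2) that by simp
  qed
  then show "inv\<^bsub>BijGroup gminus\<^esub> f \<in> ?I" by (simp add: inv_BijGroup[OF fB])
  fix g assume g: "g \<in> ?I"
  then obtain M d where M: "linear M" "d \<in> gminus" "\<And>v. v \<in> gminus \<Longrightarrow> g v = M v + d"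
    "bij_betw M gminus gminus" "\<And>u v. u \<in> gminus \<Longrightarrow> v \<in> gminus \<Longrightarrow> B (M u) (M v) = B u v"
    unfolding affine_isometry_def by blast
  from g have gB: "g \<in> Bij gminus" using sub by (auto simp: BijGroup_def)
  have M_mem: "M v \<in> gminus" if "v \<in> gminus" for v using M(4) that by (auto simp: bij_betw_def)
  have L_mem: "L v \<in> gminus" if "v \<in> gminus" for v using L(4) that by (auto simp: bij_betw_def)
  have "affine_isometry gminus B gminus B (compose gminus f g)"
    unfolding affine_isometry_def
  proof (intro exI conjI ballI)
    show "linear (L \<circ> M)" using M(1) L(1) by (rule linear_compose)
    show "L d + c \<in> gminus" using L_mem[OF M(2)] L(2) by (rule subspace_add[OF subspace_minus])
    show "compose gminus f g v = (L \<circ> M) v + (L d + c)" if v: "v \<in> gminus" for v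
    proof -
      have "g v \<in> gminus" using M(3)[OF v] M_mem[OF v] M(2) subspace_add[OF subspace_minus] by simp
      then show ?thesis using v L(3) M(3) by (simp add: compose_eq linear_add[OF L(1)])
    qed
    show "bij_betw (L \<circ> M) gminus gminus" using M(4) L(4) by (rule bij_betw_trans)
    show "B ((L \<circ> M) u) ((L \<circ> M) v) = B u v" if "u \<in> gminus" "v \<in> gminus" for u v
      using that L(5) M(5) M_mem by simp
  qed
  then show "f \<otimes>\<^bsub>BijGroup gminus\<^esub> g \<in> ?I"
    using fB gB by (simp add: BijGroup_def)
qed

lemma group_Iso: "group (Iso gminus B)"
  unfolding Iso_def using subgroup_Iso group_BijGroup by (rule subgroup.subgroup_is_group)

lemma Iso_mult:
  assumes "f \<in> carrier (Iso gminus B)" "g \<in> carrier (Iso gminus B)" "v \<in> gminus"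
  shows "(f \<otimes>\<^bsub>Iso gminus B\<^esub> g) v = f (g v)"
  using assms subgroup.subset[OF subgroup_Iso] by (auto simp: Iso_def BijGroup_def compose_eq)

lemma transvection_Iso: "x \<in> gplus \<Longrightarrow> restrict (transvection x) gminus \<in> carrier (Iso gminus B)"
  by (simp add: Iso_def affine_isometry_restrict affine_isometry_transvection)

lemma inv_transvection_Iso:
  assumes "x \<in> gplus"
  shows "inv\<^bsub>Iso gminus B\<^esub> (restrict (transvection x) gminus) = restrict (transvection (- x)) gminus"
proof (rule group.inv_equality[OF group_Iso _ transvection_Iso[OF assms]])
  have x': "- x \<in> gplus" using assms subspace_neg[OF subspace_plus] by blast
  then show "restrict (transvection (- x)) gminus \<in> carrier (Iso gminus B)" by (rule transvection_Iso)
  have "restrict (transvection x) gminus \<in> Bij gminus" "restrict (transvection (- x)) gminus \<in> Bij gminus"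
    using transvection_Iso[OF assms] transvection_Iso[OF x'] subgroup.subset[OF subgroup_Iso]
    by (auto simp: Iso_def BijGroup_def)
  then show "restrict (transvection (- x)) gminus \<otimes>\<^bsub>Iso gminus B\<^esub> restrict (transvection x) gminus = \<one>\<^bsub>Iso gminus B\<^esub>"
    by (simp add: Iso_def BijGroup_def compose_def transvection_minus[OF assms] transvection_inverse fun_eq_iff)
qed

lemma transvection_group_eq:
  "transvection_group T = generate (Iso gminus B) {restrict (transvection x) gminus | x. x \<in> gplus}"
  by (simp add: transvection_group_def transvection_def[abs_def])

text \<open>
  An element of the generated group is a product of exponentials, which is the form in which the
  orbit enters the analysis.
\<close>

theorem extrinsic_orbit_eq_orb: "extrinsic_orbit T = orb"
proof
  let ?G = "Iso gminus B" and ?H = "{restrict (transvection x) gminus | x. x \<in> gplus}"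
  interpret group ?G by (rule group_Iso)
  have H: "?H \<subseteq> carrier ?G" using transvection_Iso by blast
  have zero: "0 \<in> gminus" by (rule subspace_0[OF subspace_minus])
  have "g v \<in> orb" if "g \<in> generate ?G ?H" "v \<in> orb" for g v
    using that
  proof (induction arbitrary: v rule: generate.induct)
    case one
    then show ?case by (simp add: Iso_def BijGroup_def orb_minus)
  next
    case (incl h)
    then show ?case by (auto simp: orb_minus intro: transvection_orb)
  next
    case (inv h)
    then obtain x where x: "h = restrict (transvection x) gminus" "x \<in> gplus" by blast
    then have "- x \<in> gplus" using subspace_neg[OF subspace_plus] by blast
    with inv.prems show ?case by (simp add: x inv_transvection_Iso orb_minus transvection_orb)
  next
    case (eng f g)
    have "f \<in> carrier ?G" "g \<in> carrier ?G"
      using generate_in_carrier[OF H] eng.hyps by blast+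
    then have "(f \<otimes>\<^bsub>?G\<^esub> g) v = f (g v)" using orb_minus[OF eng.prems] by (rule Iso_mult)
    with eng.IH(1)[OF eng.IH(2)[OF eng.prems]] show ?case by (simp only:)
  qed
  then show "extrinsic_orbit T \<subseteq> orb"
    using zero_orb by (auto simp: extrinsic_orbit_def transvection_group_eq)
  have "\<exists>g\<in>generate ?G ?H. v = g 0" if "v \<in> orb" for v
    using that
  proof (induction rule: orb.induct)
    case zero_orb
    have "\<one>\<^bsub>?G\<^esub> 0 = 0" using zero by (simp add: Iso_def BijGroup_def)
    then show ?case using generate.one[of ?G ?H] by (intro bexI[of _ "\<one>\<^bsub>?G\<^esub>"]) simp
  next
    case (transvection_orb x v)
    then obtain g where g: "g \<in> generate ?G ?H" "v = g 0" by blast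
    have h: "restrict (transvection x) gminus \<in> generate ?G ?H" using transvection_orb.hyps by (intro generate.incl) blast
    have "(restrict (transvection x) gminus \<otimes>\<^bsub>?G\<^esub> g) 0 = transvection x v"
      using Iso_mult[OF transvection_Iso[OF transvection_orb.hyps(1)] generate_in_carrier[OF H g(1)] zero]
        orb_minus[OF transvection_orb.hyps(2)] g(2) by simp
    then show ?case using generate.eng[OF h g(1)]
      by (intro bexI[of _ "restrict (transvection x) gminus \<otimes>\<^bsub>?G\<^esub> g"]) simp
  qed
  then show "orb \<subseteq> extrinsic_orbit T"
    by (auto simp: extrinsic_orbit_def transvection_group_eq)
qed

section \<open>The eigenspaces of the derivation\<close>

abbreviation "upm \<equiv> up_minus_space T"

lemma subspace_upm: "subspace upm"
  by (auto simp: subspace_def up_minus_space_def D_simps)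

definition ker_part :: "'a \<Rightarrow> 'a" where "ker_part x = x + D (D x)"
definition rot_part :: "'a \<Rightarrow> 'a" where "rot_part x = - D (D x)"

lemma ker_rot: "ker_part x + rot_part x = x"
  by (simp add: ker_part_def rot_part_def)

lemma D_ker_part: "D (ker_part x) = 0"
  by (simp add: ker_part_def D_simps D_cube)

lemma D_rot_part: "D (rot_part x) = D x"
  by (simp add: rot_part_def D_simps D_cube)

lemma rot_part_upm: "rot_part x \<in> upm"
  by (simp add: rot_part_def up_minus_space_def D_simps D_cube)

lemma D_upm: "D x \<in> upm"
  by (simp add: up_minus_space_def D_cube)

lemma upmD: "x \<in> upm \<Longrightarrow> D (D x) = - x"
  by (simp add: up_minus_space_def)

lemma parts_gminus: "x \<in> gminus \<Longrightarrow> ker_part x \<in> gminus" "x \<in> gminus \<Longrightarrow> rot_part x \<in> gminus"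
  unfolding ker_part_def rot_part_def
  by (intro subspace_add subspace_neg subspace_minus D_plus D_minus; simp)+

lemma parts_gplus: "x \<in> gplus \<Longrightarrow> ker_part x \<in> gplus" "x \<in> gplus \<Longrightarrow> rot_part x \<in> gplus"
  unfolding ker_part_def rot_part_def
  by (intro subspace_add subspace_neg subspace_plus D_plus D_minus; simp)+

lemma B_ker_upm: "D x = 0 \<Longrightarrow> y \<in> upm \<Longrightarrow> B x y = 0"
  using B_D[of x "D y"] upmD[of y] by (simp add: B_simps)

lemma B_plus_minus: "x \<in> gplus \<Longrightarrow> y \<in> gminus \<Longrightarrow> B x y = 0"
  using B_theta[of x y] by (simp add: plus_space_def minus_space_def B_simps)

lemma nondeg_gplus:
  assumes x: "x \<in> gplus" and orth: "\<And>y. y \<in> gplus \<Longrightarrow> B x y = 0"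
  shows "x = 0"
proof -
  have "x + 0 \<in> {x + y | x y. x \<in> gplus \<and> y \<in> gminus \<inter> upm}"
    using x subspace_0[OF subspace_minus] subspace_0[OF subspace_upm] by blast
  moreover have "B (x + 0) z = 0" if "z \<in> {x + y | x y. x \<in> gplus \<and> y \<in> gminus \<inter> upm}" for z
    using that orth B_plus_minus[OF x] by (auto simp: B_simps)
  ultimately have "x + 0 = 0" using nondeg unfolding nondegenerate_on_def by blast
  then show ?thesis by simp
qed

lemma nondeg_gminus_upm:
  assumes x: "x \<in> gminus" "x \<in> upm" and orth: "\<And>y. y \<in> gminus \<Longrightarrow> y \<in> upm \<Longrightarrow> B x y = 0"
  shows "x = 0"
proof -
  have "0 + x \<in> {x + y | x y. x \<in> gplus \<and> y \<in> gminus \<inter> upm}"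
    using x subspace_0[OF subspace_plus] by blast
  moreover have "B (0 + x) z = 0" if "z \<in> {x + y | x y. x \<in> gplus \<and> y \<in> gminus \<inter> upm}" for z
    using that orth B_plus_minus x by (auto simp: B_simps B_sym[of x])
  ultimately have "0 + x = 0" using nondeg unfolding nondegenerate_on_def by blast
  then show ?thesis by simp
qed

text \<open>
  Over the complex numbers \<open>D\<close> would have eigenvalues \<open>0, \<plusminus>2i\<close> on brackets of eigenvectors for
  \<open>\<plusminus>i\<close>, and \<open>\<plusminus>2i\<close> is excluded by \<open>D\<^sup>3 = - D\<close>.
\<close>

lemma D_br_upm:
  assumes "x \<in> upm" "y \<in> upm"
  shows "D (br x y) = 0"
proof -
  \<comment> \<open>The span of \<open>a, b, c\<close> is invariant under \<open>D\<close>, with \<open>D\<^sup>3 a = - 4 D a\<close>.\<close>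
  define a b c where "a = br x y" and "b = br (D x) (D y)" and "c = br (D x) y + br x (D y)"
  have Da: "D a = c" by (simp add: a_def c_def D_br)
  have Dc: "D c = - 2 *\<^sub>R a + 2 *\<^sub>R b"
    using upmD[OF assms(1)] upmD[OF assms(2)]
    by (simp add: a_def b_def c_def D_simps D_br br_simps scaleR_2)
  have Db: "D b = - c"
    using upmD[OF assms(1)] upmD[OF assms(2)] by (simp add: b_def c_def D_br br_simps)
  have "D (D (D a)) = (- 2) *\<^sub>R c + (- 2) *\<^sub>R c" by (simp add: Da Dc Db D_simps)
  also have "\<dots> = (- 2 + - 2) *\<^sub>R c" by (rule scaleR_add_left[symmetric])
  finally have "(- 4) *\<^sub>R c = (- 1) *\<^sub>R c" using D_cube[of a] by (simp add: Da)
  then have "c = 0" by (simp only: scaleR_cancel_right) simp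
  then show ?thesis using Da by (simp add: a_def)
qed

text \<open>
  The second fundamental form at 0 is symmetric.
\<close>

lemma second_form_sym:
  assumes "u \<in> upm" "v \<in> upm"
  shows "br (D u) v = br (D v) u"
  using D_br_upm[OF assms] br_anti[of u "D v"] by (simp add: D_br)

lemma br_ker_upm: "D x = 0 \<Longrightarrow> y \<in> upm \<Longrightarrow> br x y \<in> upm"
  by (simp add: up_minus_space_def D_br br_simps)

text \<open>
  An induction principle: \<open>\<gg>\<^sub>+\<^sup>-\<close> is the image of \<open>\<gg>\<^sub>-\<^sup>-\<close> under \<open>D\<close>, and its brackets span
  \<open>\<gg>\<^sub>+\<^sup>+\<close>.
\<close>

lemma gplus_generation:
  assumes S: "subspace S"
    and br_S: "\<And>x y. x \<in> gplus \<inter> upm \<Longrightarrow> y \<in> gplus \<inter> upm \<Longrightarrow> br x y \<in> S"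
    and up_S: "\<And>u. u \<in> gminus \<inter> upm \<Longrightarrow> D u \<in> S"
    and X: "X \<in> gplus"
  shows "X \<in> S"
proof -
  have "ker_part X \<in> gplus \<inter> up_plus_space T"
    using parts_gplus(1)[OF X] D_ker_part by (simp add: up_plus_space_def)
  then have "ker_part X \<in> span {br x y | x y. x \<in> gplus \<inter> upm \<and> y \<in> gplus \<inter> upm}"
    by (simp only: span_up_minus)
  moreover have "span {br x y | x y. x \<in> gplus \<inter> upm \<and> y \<in> gplus \<inter> upm} \<subseteq> S"
    using br_S by (intro span_minimal S) blast
  ultimately have ker: "ker_part X \<in> S" by blast
  have "- D X \<in> gminus \<inter> upm"
    using D_plus[OF X] D_upm[of X] by (simp add: subspace_neg subspace_minus subspace_upm)
  from up_S[OF this] have "rot_part X \<in> S" by (simp add: rot_part_def D_simps)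
  with ker ker_rot[of X] show ?thesis using subspace_add[OF S] by metis
qed

text \<open>
  Such an \<open>X\<close> commutes with \<open>\<gg>\<^sub>+\<^sup>-\<close> as well, hence is orthogonal to all brackets and to the image of
  \<open>D\<close>, and these span \<open>\<gg>\<^sub>+\<close>.
\<close>

lemma phi_injective:
  assumes X: "X \<in> gplus" and DX: "D X = 0" and br_X: "\<And>v. v \<in> gminus \<Longrightarrow> br X v = 0"
  shows "X = 0"
proof (rule nondeg_gplus[OF X])
  fix Y assume Y: "Y \<in> gplus"
  have br0: "br X P = 0" if P: "P \<in> gplus \<inter> upm" for P
  proof -
    have "D (br X P) = 0" using br_X[OF D_plus, of P] P by (simp add: D_br DX br_simps)
    moreover have "br X P \<in> upm" using P DX by (intro br_ker_upm) auto
    ultimately show ?thesis using upmD[of "br X P"] by (simp add: D_simps)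
  qed
  have "Y \<in> {Y. B X Y = 0}"
  proof (rule gplus_generation[OF _ _ _ Y])
    show "subspace {Y. B X Y = 0}" by (auto simp: subspace_def B_simps)
    show "br x y \<in> {Y. B X Y = 0}" if "x \<in> gplus \<inter> upm" "y \<in> gplus \<inter> upm" for x y
      using B_inv[of x X y] br0[OF that(1)] br_anti[of x X] by (simp add: B_simps)
    show "D u \<in> {Y. B X Y = 0}" for u
      using B_D[of X u] DX by (simp add: B_simps)
  qed
  then show "B X Y = 0" by simp
qed

lemma pm_decomp:
  obtains a b where "x = a + b" "a \<in> gplus" "b \<in> gminus"
proof
  show "x = (1 / 2) *\<^sub>R (x + \<theta> x) + (1 / 2) *\<^sub>R (x - \<theta> x)"
    by (simp flip: scaleR_add_right scaleR_2)
  show "(1 / 2) *\<^sub>R (x + \<theta> x) \<in> gplus"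
    by (simp add: plus_space_def inv_simps inv_inv algebra_simps)
  show "(1 / 2) *\<^sub>R (x - \<theta> x) \<in> gminus"
    by (simp add: minus_space_def inv_simps inv_inv algebra_simps)
qed

lemma pm_unique:
  assumes "a + b = 0" "a \<in> gplus" "b \<in> gminus"
  shows "a = 0" "b = 0"
proof -
  have "b = - a" using assms(1) by (simp add: eq_neg_iff_add_eq_0 add.commute)
  then have "a = - a" using assms(2,3) by (simp add: plus_space_def minus_space_def inv_simps)
  then have "2 *\<^sub>R a = 0" by (metis add.right_inverse scaleR_2)
  then show "a = 0" by simp
  with \<open>b = - a\<close> show "b = 0" by simp
qed

text \<open>
  The orbit is homogeneous: an affine isometry with linear part \<open>G\<close> that preserves the orbit moves
  the given point to 0.
\<close>

lemma move_to_zero: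
  assumes "v \<in> orb"
  shows "\<exists>G d. linear G \<and> d \<in> gminus \<and> bij_betw G gminus gminus \<and>
    (\<forall>u\<in>gminus. \<forall>w\<in>gminus. B (G u) (G w) = B u w) \<and> G v + d = 0 \<and> (\<lambda>w. G w + d) ` orb = orb"
  using assms
proof (induction rule: orb.induct)
  case zero_orb
  show ?case
    by (intro exI[of _ "\<lambda>x. x"] exI[of _ 0])
      (auto simp: linear_iff subspace_0[OF subspace_minus] bij_betw_def)
next
  case (transvection_orb x v)
  then obtain G d where G: "linear G" "d \<in> gminus" "bij_betw G gminus gminus"
    "\<And>u w. u \<in> gminus \<Longrightarrow> w \<in> gminus \<Longrightarrow> B (G u) (G w) = B u w" "G v + d = 0"
    "(\<lambda>w. G w + d) ` orb = orb" by blast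
  have x': "- x \<in> gplus" using transvection_orb.hyps(1) subspace_neg[OF subspace_plus] by blast
  define d' where "d' = G (transvection (- x) 0) + d"
  have eq: "(G \<circ> linear_part (- x)) w + d' = G (transvection (- x) w) + d" for w
    using linear_add[OF G(1), of "linear_part (- x) w" "transvection (- x) 0"] transvection_affine[of "- x" w]
    by (simp add: d'_def)
  have transvection_orb_eq: "transvection (- x) ` orb = orb"
  proof
    show "transvection (- x) ` orb \<subseteq> orb" using x' orb.transvection_orb by blast
    show "orb \<subseteq> transvection (- x) ` orb"
    proof
      fix w assume "w \<in> orb"
      then have "transvection x w \<in> orb" using transvection_orb.hyps(1) by (intro orb.transvection_orb)
      then show "w \<in> transvection (- x) ` orb" using transvection_inverse(1)[of x w] by (metis imageI)
    qed
  qed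
  have "(\<lambda>w. (G \<circ> linear_part (- x)) w + d') ` orb = (\<lambda>w. G w + d) ` transvection (- x) ` orb"
    by (simp only: eq image_image)
  then have im: "(\<lambda>w. (G \<circ> linear_part (- x)) w + d') ` orb = orb" by (simp only: transvection_orb_eq G(6))
  have "transvection (- x) 0 \<in> gminus" using x' subspace_0[OF subspace_minus] by (rule transvection_minus)
  then have d': "d' \<in> gminus"
    unfolding d'_def using G(2,3) by (intro subspace_add[OF subspace_minus]) (auto simp: bij_betw_def)
  have bij: "bij_betw (linear_part (- x)) gminus gminus"
    using transvection_orb.hyps(1) x' by (intro bij_betw_byWitness[of _ "linear_part x"]) (auto simp: linear_part_inverse linear_part_minus)
  show ?case
  proof (intro exI conjI ballI)
    show "linear (G \<circ> linear_part (- x))" using linear_linear_part G(1) by (rule linear_compose)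
    show "d' \<in> gminus" by (rule d')
    show "bij_betw (G \<circ> linear_part (- x)) gminus gminus" using bij G(3) by (rule bij_betw_trans)
    show "B ((G \<circ> linear_part (- x)) u) ((G \<circ> linear_part (- x)) w) = B u w" if "u \<in> gminus" "w \<in> gminus" for u w
      using G(4)[OF linear_part_minus[OF x' that(1)] linear_part_minus[OF x' that(2)]] by (simp add: linear_part_isometry)
    show "(G \<circ> linear_part (- x)) (transvection x v) + d' = 0" unfolding eq transvection_inverse by (rule G(5))
    show "(\<lambda>w. (G \<circ> linear_part (- x)) w + d') ` orb = orb" by (rule im)
  qed
qed

end

section \<open>From isometric orbits to isomorphic triples\<close>

locale linear_orbit_isometry = t1: weak_triple T1 + t2: weak_triple T2
  for T1 :: "'a::real_normed_vector triple" and T2 :: "'b::real_normed_vector triple" +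
  fixes L :: "'a \<Rightarrow> 'b"
  assumes linear_L: "linear L" and bij_L: "bij_betw L (minus_space T1) (minus_space T2)"
    and isometry_L: "\<And>u v. u \<in> minus_space T1 \<Longrightarrow> v \<in> minus_space T1 \<Longrightarrow> form T2 (L u) (L v) = form T1 u v"
    and orbit_L: "L ` t1.orb = t2.orb"
begin

lemmas L_simps = linear_add[OF linear_L] linear_diff[OF linear_L] linear_neg[OF linear_L]
  linear_scale[OF linear_L] linear_0[OF linear_L]

lemma L_mem: "v \<in> t1.gminus \<Longrightarrow> L v \<in> t2.gminus"
  using bij_L by (auto simp: bij_betw_def)

lemma L_surj: "w \<in> t2.gminus \<Longrightarrow> \<exists>v\<in>t1.gminus. w = L v"
  using bij_L by (auto simp: bij_betw_def)

lemma L_inj: "u \<in> t1.gminus \<Longrightarrow> v \<in> t1.gminus \<Longrightarrow> L u = L v \<Longrightarrow> u = v"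
  using bij_L by (auto simp: bij_betw_def inj_on_def)

text \<open>
  The orbit curve \<open>t \<mapsto> exp(\<phi>(t D u)) 0\<close> has velocity \<open>u\<close> and acceleration \<open>[D u, u]\<close> at 0. Its
  image under \<open>L\<close> lies in the second orbit, hence satisfies the tangency equation for all times.
  The two claims are this equation and its derivative at time 0.
\<close>

lemma tangent_and_curvature:
  assumes u: "u \<in> t1.gminus" "u \<in> t1.upm"
  shows "t2.D (t2.D (L u)) = - L u"
    and "t2.D (t2.D (L (t1.br (t1.D u) u))) + L (t1.br (t1.D u) u) = - t2.br (L u) (t2.D (L u))"
proof -
  define X where "X = t1.D u"
  have X: "X \<in> t1.gplus" using u by (simp add: X_def t1.D_minus)
  have DX: "t1.D X = - u" using t1.upmD[OF u(2)] by (simp add: X_def)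
  \<comment> \<open>The curve \<open>c\<close> is the image of the orbit curve in the extended second Lie algebra.\<close>
  define A where "A = t1.hbr (to_coords X, 0)"
  have A: "linear A" unfolding A_def by (rule t1.hat.linear_br)
  define G where "G = (\<lambda>(y :: real ^ 'a coordinate_index, s :: real). (to_coords (L (from_coords y)), s))"
  have G: "linear G"
    by (rule linearI) (auto simp: G_def t1.from_simps L_simps t2.to_simps)
  then have bG: "bounded_linear G" by (simp add: linear_conv_bounded_linear)
  define f where "f = (\<lambda>t. flow A t (0, 1))"
  define c where "c = (\<lambda>t. G (f t))"
  define c' where "c' = (\<lambda>t. G (A (f t)))"
  define c'' where "c'' = (\<lambda>t. G (A (A (f t))))"
  have f': "(f has_vector_derivative A (f t)) (at t)" for t
    unfolding f_def using flow_has_vector_derivative_at[OF A, of _ t UNIV] by simp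
  have bA: "bounded_linear A" using A by (simp add: linear_conv_bounded_linear)
  have c_deriv: "(c has_vector_derivative c' t) (at t)" for t
    unfolding c_def c'_def by (rule bounded_linear.has_vector_derivative[OF bG f'])
  have c'_deriv: "(c' has_vector_derivative c'' t) (at t)" for t
    unfolding c'_def c''_def
    by (rule bounded_linear.has_vector_derivative[OF bG bounded_linear.has_vector_derivative[OF bA f']])
  have c_orbit: "c t \<in> t2.hat.orbit" for t
  proof -
    have "(\<lambda>p. t *\<^sub>R A p) = t1.hbr (to_coords (t *\<^sub>R X), 0)"
      using t1.hat.bilinear_br bilinear_lmul[of "t1.hbr" t "(to_coords X, 0)"]
      by (simp add: fun_eq_iff A_def t1.to_simps)
    then have "f t = t1.hat.ead (to_coords (t *\<^sub>R X), 0) (to_coords 0, 1)"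
      by (simp add: f_def flow_def t1.to_simps)
    then have "f t = (to_coords (t1.transvection (t *\<^sub>R X) 0), 1)" by (simp only: t1.hat_exp_affine)
    then have "c t = (to_coords (L (t1.transvection (t *\<^sub>R X) 0)), 1)"
      by (simp add: c_def G_def t1.to_coords_T)
    moreover have "t1.transvection (t *\<^sub>R X) 0 \<in> t1.orb"
      using X t1.subspace_plus by (intro t1.transvection_orb t1.zero_orb subspace_scale)
    ultimately show ?thesis using t2.orb_hat orbit_L by (metis imageI)
  qed
  have "continuous_on UNIV c'"
    using c'_deriv by (intro continuous_at_imp_continuous_on) (auto intro: has_vector_derivative_continuous)
  then have tang: "t2.hbr (c t) (t2.hbr (c t) (c' t)) = - c' t" for t
    by (intro t2.hat.curve_in_orbit_is_tangent c_orbit c_deriv)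
  have f0: "f 0 = (0, 1)" by (simp add: f_def flow_0[OF A])
  have Af0: "A (f 0) = (to_coords u, 0)"
    by (simp add: f0 A_def hat_bracket_def bilinear_rzero[OF t1.bilinear_cbr] linear_0[OF t1.linear_cD]
        t1.cD_def t1.to_coords_T DX t1.to_simps)
  have AAf0: "A (A (f 0)) = (to_coords (t1.br X u), 0)"
    unfolding Af0 by (simp add: A_def hat_bracket_def t1.cbr_def t1.to_coords_T)
  have c0: "c 0 = (0, 1)"
    by (simp add: c_def f0 G_def t1.from_simps L_simps t2.to_simps)
  have c'0: "c' 0 = (to_coords (L u), 0)"
    by (simp add: c'_def Af0 G_def t1.to_coords_T)
  have c''0: "c'' 0 = (to_coords (L (t1.br X u)), 0)"
    by (simp add: c''_def AAf0 G_def t1.to_coords_T)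
  have base: "t2.hbr (0, 1) (to_coords w, 0) = (to_coords (t2.D w), 0)" for w
    by (simp add: hat_bracket_def bilinear_lzero[OF t2.bilinear_cbr] t2.cD_def t2.to_coords_T)
  have "to_coords (t2.D (t2.D (L u))) = to_coords (- L u)"
    using tang[of 0] by (simp add: c0 c'0 base t2.to_simps)
  then show *: "t2.D (t2.D (L u)) = - L u" by (simp only: t2.to_coords_inj)
  \<comment> \<open>The derivative of the tangency equation.\<close>
  define H where "H = (\<lambda>t. t2.hbr (c t) (t2.hbr (c t) (c' t)) + c' t)"
  note bil = bounded_bilinear.has_vector_derivative[OF t2.hat.bounded_bilinear_br]
  have "(H has_vector_derivative
      t2.hbr (c 0) (t2.hbr (c 0) (c'' 0) + t2.hbr (c' 0) (c' 0)) + t2.hbr (c' 0) (t2.hbr (c 0) (c' 0)) + c'' 0) (at 0)"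
    unfolding H_def by (intro has_vector_derivative_add bil c_deriv c'_deriv)
  moreover have "H = (\<lambda>t. 0)" by (simp add: H_def tang)
  then have "(H has_vector_derivative 0) (at 0)" by simp
  ultimately have "t2.hbr (c 0) (t2.hbr (c 0) (c'' 0) + t2.hbr (c' 0) (c' 0))
      + t2.hbr (c' 0) (t2.hbr (c 0) (c' 0)) + c'' 0 = 0"
    by (rule vector_derivative_unique_at)
  moreover have "t2.hbr (to_coords v, 0) (to_coords w, 0) = (to_coords (t2.br v w), 0)" for v w
    by (simp add: hat_bracket_def t2.cbr_def t2.to_coords_T)
  ultimately have "to_coords (t2.D (t2.D (L (t1.br X u))) + t2.br (L u) (t2.D (L u)) + L (t1.br X u)) = to_coords 0"
    by (simp add: c0 c'0 c''0 base t2.hat.br_self t2.to_simps zero_prod_def)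
  then have "t2.D (t2.D (L (t1.br X u))) + t2.br (L u) (t2.D (L u)) + L (t1.br X u) = 0"
    by (simp only: t2.to_coords_inj)
  then show "t2.D (t2.D (L (t1.br (t1.D u) u))) + L (t1.br (t1.D u) u) = - t2.br (L u) (t2.D (L u))"
    by (simp add: X_def eq_neg_iff_add_eq_0 algebra_simps)
qed

lemma L_upm: "u \<in> t1.gminus \<Longrightarrow> u \<in> t1.upm \<Longrightarrow> L u \<in> t2.upm"
  using tangent_and_curvature(1) by (simp add: up_minus_space_def)

text \<open>
  The situation is symmetric in the two triples, so that each inclusion proved for \<open>L\<close> yields the
  reverse inclusion.
\<close>

lemma inverse:
  obtains L' where "linear_orbit_isometry T2 T1 L'"
    "\<And>v. v \<in> t1.gminus \<Longrightarrow> L' (L v) = v" "\<And>w. w \<in> t2.gminus \<Longrightarrow> L (L' w) = w"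
    "\<And>w. w \<in> t2.gminus \<Longrightarrow> L' w \<in> t1.gminus"
proof -
  obtain L' where L': "linear L'" "\<And>v. v \<in> t1.gminus \<Longrightarrow> L' (L v) = v"
    using linear_exists_left_inverse_on[OF linear_L t1.subspace_minus bij_betw_imp_inj_on[OF bij_L]] by blast
  have mem: "L' w \<in> t1.gminus" "L (L' w) = w" if "w \<in> t2.gminus" for w
    using L_surj[OF that] L'(2) by auto
  have "linear_orbit_isometry T2 T1 L'"
  proof (intro linear_orbit_isometry.intro t2.weak_triple_axioms t1.weak_triple_axioms
      linear_orbit_isometry_axioms.intro)
    show "linear L'" by fact
    show "bij_betw L' t2.gminus t1.gminus"
      using mem L'(2) L_mem by (intro bij_betw_byWitness[of _ L]) auto
    show "form T1 (L' u) (L' v) = form T2 u v" if "u \<in> t2.gminus" "v \<in> t2.gminus" for u v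
      using isometry_L[OF mem(1)[OF that(1)] mem(1)[OF that(2)]] mem(2) that by simp
    have "L' ` L ` t1.orb = t1.orb"
      using L'(2) t1.orb_minus by (force simp: image_image)
    then show "L' ` t2.orb = t1.orb" by (simp add: orbit_L)
  qed
  then show thesis using L'(2) mem by (intro that)
qed

lemma L_upm_surj:
  assumes "w \<in> t2.gminus" "w \<in> t2.upm"
  obtains v where "v \<in> t1.gminus" "v \<in> t1.upm" "w = L v"
proof -
  obtain L' where L': "linear_orbit_isometry T2 T1 L'" "L (L' w) = w" "L' w \<in> t1.gminus"
    using inverse assms(1) by metis
  have "L' w \<in> t1.upm" using linear_orbit_isometry.L_upm[OF L'(1) assms] .
  with L' show thesis by (intro that[of "L' w"]) auto
qed

text \<open>
  The normal space at 0 is the orthogonal complement of the tangent space.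
\<close>

lemma D_L_ker:
  assumes x: "x \<in> t1.gminus" "t1.D x = 0"
  shows "t2.D (L x) = 0"
proof -
  have Lx: "L x \<in> t2.gminus" using x(1) by (rule L_mem)
  have "t2.rot_part (L x) = 0"
  proof (rule t2.nondeg_gminus_upm[OF t2.parts_gminus(2)[OF Lx] t2.rot_part_upm])
    fix y assume y: "y \<in> t2.gminus" "y \<in> t2.upm"
    then obtain v where v: "v \<in> t1.gminus" "v \<in> t1.upm" "y = L v" by (rule L_upm_surj)
    have "t2.B (L x) y = 0"
      using isometry_L[OF x(1) v(1)] t1.B_ker_upm[OF x(2) v(2)] v(3) by simp
    moreover have "t2.B (t2.ker_part (L x)) y = 0"
      by (rule t2.B_ker_upm[OF t2.D_ker_part y(2)])
    ultimately show "t2.B (t2.rot_part (L x)) y = 0"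
      using t2.ker_rot[of "L x"] t2.B_simps(1)[of "t2.ker_part (L x)" "t2.rot_part (L x)" y] by simp
  qed
  then show ?thesis using t2.D_rot_part[of "L x"] by (simp add: t2.D_simps)
qed

lemma second_form_diag:
  assumes u: "u \<in> t1.gminus" "u \<in> t1.upm"
  shows "L (t1.br (t1.D u) u) = t2.br (t2.D (L u)) (L u)"
proof -
  have "t1.D (t1.br (t1.D u) u) = 0" by (rule t1.D_br_upm[OF t1.D_upm u(2)])
  moreover have "t1.br (t1.D u) u \<in> t1.gminus" using u by (intro t1.br_plus_minus t1.D_minus)
  ultimately have "t2.D (L (t1.br (t1.D u) u)) = 0" by (intro D_L_ker)
  then show ?thesis
    using tangent_and_curvature(2)[OF u] t2.br_anti[of "L u" "t2.D (L u)"]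
    by (simp add: t2.D_simps)
qed

lemma second_form:
  assumes u: "u \<in> t1.gminus" "u \<in> t1.upm" and v: "v \<in> t1.gminus" "v \<in> t1.upm"
  shows "L (t1.br (t1.D u) v) = t2.br (t2.D (L u)) (L v)"
proof -
  have uv: "u + v \<in> t1.gminus" "u + v \<in> t1.upm"
    using u v t1.subspace_minus t1.subspace_upm by (simp_all add: subspace_add)
  have "2 *\<^sub>R L (t1.br (t1.D u) v) = 2 *\<^sub>R t2.br (t2.D (L u)) (L v)"
    using second_form_diag[OF uv] second_form_diag[OF u] second_form_diag[OF v]
      t1.second_form_sym[OF v(2) u(2)] t2.second_form_sym[OF L_upm[OF v] L_upm[OF u]]
    by (simp add: t1.D_simps t1.br_simps t2.D_simps t2.br_simps L_simps scaleR_2)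
  then show ?thesis by simp
qed

text \<open>
  The shape operator is the adjoint of the second fundamental form, and the form is non-degenerate
  on the tangent space.
\<close>

lemma shape_operator:
  assumes u: "u \<in> t1.gminus" "u \<in> t1.upm" and x: "x \<in> t1.gminus" "t1.D x = 0"
  shows "L (t1.br (t1.D u) x) = t2.br (t2.D (L u)) (L x)"
proof -
  define p where "p = L (t1.br (t1.D u) x) - t2.br (t2.D (L u)) (L x)"
  have Du: "t1.D u \<in> t1.gplus" using u by (intro t1.D_minus)
  have DLu: "t2.D (L u) \<in> t2.gplus" using u by (intro t2.D_minus L_mem)
  have 1: "t1.br (t1.D u) x \<in> t1.gminus" using Du x(1) by (rule t1.br_plus_minus)
  have "t1.br x (t1.D u) \<in> t1.upm" using x(2) t1.D_upm by (rule t1.br_ker_upm)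
  then have 2: "t1.br (t1.D u) x \<in> t1.upm"
    using t1.br_anti[of "t1.D u" x] subspace_neg[OF t1.subspace_upm] by metis
  have 3: "t2.br (t2.D (L u)) (L x) \<in> t2.gminus" using DLu L_mem[OF x(1)] by (rule t2.br_plus_minus)
  have "t2.br (L x) (t2.D (L u)) \<in> t2.upm" using D_L_ker[OF x] t2.D_upm by (rule t2.br_ker_upm)
  then have 4: "t2.br (t2.D (L u)) (L x) \<in> t2.upm"
    using t2.br_anti[of "t2.D (L u)" "L x"] subspace_neg[OF t2.subspace_upm] by metis
  have "p = 0"
  proof (rule t2.nondeg_gminus_upm)
    show "p \<in> t2.gminus" unfolding p_def using L_mem[OF 1] 3 by (rule subspace_diff[OF t2.subspace_minus])
    show "p \<in> t2.upm" unfolding p_def using L_upm[OF 1 2] 4 by (rule subspace_diff[OF t2.subspace_upm])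
    fix y assume y: "y \<in> t2.gminus" "y \<in> t2.upm"
    then obtain w where w: "w \<in> t1.gminus" "w \<in> t1.upm" "y = L w" by (rule L_upm_surj)
    have "t2.B (L (t1.br (t1.D u) x)) (L w) = - t1.B x (t1.br (t1.D u) w)"
      using isometry_L[OF 1 w(1)] t1.B_inv by simp
    also have "\<dots> = - t2.B (L x) (L (t1.br (t1.D u) w))"
      using isometry_L[OF x(1) t1.br_plus_minus[OF Du w(1)]] by simp
    also have "\<dots> = t2.B (t2.br (t2.D (L u)) (L x)) (L w)"
      by (simp add: second_form[OF u w(1,2)] t2.B_inv)
    finally show "t2.B p y = 0" by (simp add: p_def w(3) t2.B_simps)
  qed
  then show ?thesis by (simp add: p_def)
qed

lemma intertwines:
  assumes u: "u \<in> t1.gminus" "u \<in> t1.upm" and v: "v \<in> t1.gminus"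
  shows "L (t1.br (t1.D u) v) = t2.br (t2.D (L u)) (L v)"
proof -
  have "L (t1.br (t1.D u) (t1.ker_part v)) = t2.br (t2.D (L u)) (L (t1.ker_part v))"
    by (rule shape_operator[OF u t1.parts_gminus(1)[OF v] t1.D_ker_part])
  moreover have "L (t1.br (t1.D u) (t1.rot_part v)) = t2.br (t2.D (L u)) (L (t1.rot_part v))"
    by (rule second_form[OF u t1.parts_gminus(2)[OF v] t1.rot_part_upm])
  ultimately have "L (t1.br (t1.D u) (t1.ker_part v + t1.rot_part v))
      = t2.br (t2.D (L u)) (L (t1.ker_part v + t1.rot_part v))"
    by (simp only: t1.br_simps t2.br_simps L_simps)
  then show ?thesis by (simp only: t1.ker_rot)
qed

text \<open>
  \<open>L\<close> conjugates the affine vector field \<open>\<phi>(X)\<close> into \<open>\<phi>(X')\<close>.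
\<close>

definition corresponds :: "'a \<Rightarrow> 'b \<Rightarrow> bool" where
  "corresponds X X' \<longleftrightarrow> X \<in> t1.gplus \<and> X' \<in> t2.gplus \<and>
     (\<forall>v\<in>t1.gminus. L (t1.br X v) = t2.br X' (L v)) \<and> L (t1.D X) = t2.D X'"

lemma corresponds_add: "corresponds X X' \<Longrightarrow> corresponds Y Y' \<Longrightarrow> corresponds (X + Y) (X' + Y')"
  using subspace_add[OF t1.subspace_plus] subspace_add[OF t2.subspace_plus]
  by (auto simp: corresponds_def t1.br_simps t2.br_simps t1.D_simps t2.D_simps L_simps)

lemma corresponds_scale: "corresponds X X' \<Longrightarrow> corresponds (c *\<^sub>R X) (c *\<^sub>R X')"
  using subspace_scale[OF t1.subspace_plus] subspace_scale[OF t2.subspace_plus]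
  by (auto simp: corresponds_def t1.br_simps t2.br_simps t1.D_simps t2.D_simps L_simps)

lemma corresponds_0: "corresponds 0 0"
  using subspace_0[OF t1.subspace_plus] subspace_0[OF t2.subspace_plus]
  by (simp add: corresponds_def t1.br_simps t2.br_simps t1.D_simps t2.D_simps L_simps)

lemma corresponds_br:
  assumes "corresponds X X'" "corresponds Y Y'"
  shows "corresponds (t1.br X Y) (t2.br X' Y')"
proof -
  have X: "X \<in> t1.gplus" "X' \<in> t2.gplus" "\<And>v. v \<in> t1.gminus \<Longrightarrow> L (t1.br X v) = t2.br X' (L v)"
    "L (t1.D X) = t2.D X'" using assms(1) by (auto simp: corresponds_def)
  have Y: "Y \<in> t1.gplus" "Y' \<in> t2.gplus" "\<And>v. v \<in> t1.gminus \<Longrightarrow> L (t1.br Y v) = t2.br Y' (L v)"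
    "L (t1.D Y) = t2.D Y'" using assms(2) by (auto simp: corresponds_def)
  have "L (t1.br (t1.br X Y) v) = t2.br (t2.br X' Y') (L v)" if v: "v \<in> t1.gminus" for v
  proof -
    have "L (t1.br (t1.br X Y) v) = L (t1.br X (t1.br Y v)) - L (t1.br Y (t1.br X v))"
      using t1.br_derivation[of X Y v] by (simp add: L_simps)
    also have "\<dots> = t2.br X' (t2.br Y' (L v)) - t2.br Y' (t2.br X' (L v))"
      using v X Y by (simp add: t1.br_plus_minus)
    also have "\<dots> = t2.br (t2.br X' Y') (L v)"
      using t2.br_derivation[of X' Y' "L v"] by simp
    finally show ?thesis .
  qed
  moreover have "L (t1.D (t1.br X Y)) = t2.D (t2.br X' Y')"
  proof -
    have "L (t1.D (t1.br X Y)) = L (t1.br X (t1.D Y)) - L (t1.br Y (t1.D X))"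
      using t1.br_anti[of "t1.D X" Y] by (simp add: t1.D_br L_simps)
    also have "\<dots> = t2.br X' (t2.D Y') - t2.br Y' (t2.D X')"
      using X Y by (simp add: t1.D_plus)
    also have "\<dots> = t2.D (t2.br X' Y')"
      using t2.br_anti[of "t2.D X'" Y'] by (simp add: t2.D_br)
    finally show ?thesis .
  qed
  ultimately show ?thesis using X Y by (simp add: corresponds_def t1.br_plus_plus t2.br_plus_plus)
qed

lemma corresponds_D:
  assumes u: "u \<in> t1.gminus" "u \<in> t1.upm"
  shows "corresponds (t1.D u) (t2.D (L u))"
  using intertwines[OF u] t1.upmD[OF u(2)] t2.upmD[OF L_upm[OF u]] t1.D_minus[OF u(1)]
    t2.D_minus[OF L_mem[OF u(1)]]
  by (simp add: corresponds_def L_simps)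

lemma corresponds_exists:
  assumes "X \<in> t1.gplus"
  shows "\<exists>X'. corresponds X X'"
proof -
  have "X \<in> {X. \<exists>X'. corresponds X X'}"
  proof (rule t1.gplus_generation[OF _ _ _ assms])
    show "subspace {X. \<exists>X'. corresponds X X'}"
      unfolding subspace_def using corresponds_0 corresponds_add corresponds_scale by blast
    have up: "\<exists>x'. corresponds x x'" if x: "x \<in> t1.gplus \<inter> t1.upm" for x
    proof -
      have "- t1.D x \<in> t1.gminus" "- t1.D x \<in> t1.upm"
        using x t1.D_plus t1.D_upm by (auto intro: subspace_neg t1.subspace_minus t1.subspace_upm)
      from corresponds_D[OF this] show ?thesis using x t1.upmD[of x] by (auto simp: t1.D_simps)
    qed
    show "t1.br x y \<in> {X. \<exists>X'. corresponds X X'}" if "x \<in> t1.gplus \<inter> t1.upm" "y \<in> t1.gplus \<inter> t1.upm" for x y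
      using up[OF that(1)] up[OF that(2)] corresponds_br by blast
    show "t1.D u \<in> {X. \<exists>X'. corresponds X X'}" if "u \<in> t1.gminus \<inter> t1.upm" for u
      using corresponds_D that by blast
  qed
  then show ?thesis by simp
qed

lemma corresponds_unique:
  assumes "corresponds X X'" "corresponds X X''"
  shows "X' = X''"
proof -
  have "X' - X'' = 0"
  proof (rule t2.phi_injective)
    show "X' - X'' \<in> t2.gplus" using assms by (auto simp: corresponds_def intro: subspace_diff[OF t2.subspace_plus])
    show "t2.D (X' - X'') = 0" using assms by (simp add: corresponds_def t2.D_simps)
    fix w assume "w \<in> t2.gminus"
    then obtain v where "v \<in> t1.gminus" "w = L v" using L_surj by blast
    then show "t2.br (X' - X'') w = 0" using assms by (simp add: corresponds_def t2.br_simps)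
  qed
  then show ?thesis by simp
qed

lemma corresponds_surj:
  assumes X': "X' \<in> t2.gplus"
  shows "\<exists>X. corresponds X X'"
proof -
  obtain L' where L': "linear_orbit_isometry T2 T1 L'" "\<And>v. v \<in> t1.gminus \<Longrightarrow> L' (L v) = v"
    "\<And>w. w \<in> t2.gminus \<Longrightarrow> L (L' w) = w"
    using inverse by metis
  interpret inv: linear_orbit_isometry T2 T1 L' by (rule L'(1))
  obtain X where X: "inv.corresponds X' X" using inv.corresponds_exists[OF X'] by blast
  have "L (t1.br X v) = t2.br X' (L v)" if v: "v \<in> t1.gminus" for v
  proof -
    have "L' (t2.br X' (L v)) = t1.br X v"
      using X L_mem[OF v] L'(2)[OF v] by (simp add: inv.corresponds_def)
    then show ?thesis using L'(3)[OF t2.br_plus_minus[OF X' L_mem[OF v]]] by simp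
  qed
  moreover have "L (t1.D X) = t2.D X'"
    using X L'(3)[OF t2.D_plus[OF X']] by (simp add: inv.corresponds_def)
  ultimately show ?thesis using X by (auto simp: corresponds_def inv.corresponds_def)
qed

definition lift :: "'a \<Rightarrow> 'b" where
  "lift X = (THE X'. corresponds X X')"

lemma corresponds_lift: "X \<in> t1.gplus \<Longrightarrow> corresponds X (lift X)"
  unfolding lift_def using corresponds_exists corresponds_unique by (metis theI)

lemma liftI: "corresponds X X' \<Longrightarrow> lift X = X'"
  using corresponds_lift corresponds_unique corresponds_def by metis

lemma lift_mem: "X \<in> t1.gplus \<Longrightarrow> lift X \<in> t2.gplus"
  and lift_br: "X \<in> t1.gplus \<Longrightarrow> v \<in> t1.gminus \<Longrightarrow> L (t1.br X v) = t2.br (lift X) (L v)"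
  and lift_D: "X \<in> t1.gplus \<Longrightarrow> L (t1.D X) = t2.D (lift X)"
  using corresponds_lift by (auto simp: corresponds_def)

lemma lift_add: "X \<in> t1.gplus \<Longrightarrow> Y \<in> t1.gplus \<Longrightarrow> lift (X + Y) = lift X + lift Y"
  and lift_scale: "X \<in> t1.gplus \<Longrightarrow> lift (c *\<^sub>R X) = c *\<^sub>R lift X"
  and lift_bracket: "X \<in> t1.gplus \<Longrightarrow> Y \<in> t1.gplus \<Longrightarrow> lift (t1.br X Y) = t2.br (lift X) (lift Y)"
  by (intro liftI corresponds_add corresponds_scale corresponds_br corresponds_lift; assumption)+

lemma lift_D_minus:
  assumes "u \<in> t1.gminus"
  shows "lift (t1.D u) = t2.D (L u)"
proof -
  have "lift (t1.D (t1.rot_part u)) = t2.D (L (t1.rot_part u))"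
    using assms by (intro liftI corresponds_D t1.parts_gminus t1.rot_part_upm)
  moreover have "t2.D (L (t1.ker_part u)) = 0"
    using assms by (intro D_L_ker t1.parts_gminus t1.D_ker_part)
  then have "t2.D (L (t1.ker_part u + t1.rot_part u)) = t2.D (L (t1.rot_part u))"
    by (simp add: L_simps t2.D_simps)
  ultimately show ?thesis by (simp only: t1.ker_rot t1.D_rot_part)
qed

text \<open>
  For \<open>X = D u\<close> the form is moved to \<open>\<gg>\<^sub>-\<close>, where \<open>L\<close> is an isometry, because \<open>D\<close> is
  antisymmetric; brackets reduce to this case by invariance.
\<close>

lemma lift_isometry:
  assumes X: "X \<in> t1.gplus" and Y: "Y \<in> t1.gplus"
  shows "t2.B (lift X) (lift Y) = t1.B X Y"
proof -
  have rot: "t2.B (lift (t1.D u)) (lift Y) = t1.B (t1.D u) Y" if u: "u \<in> t1.gminus" and Y: "Y \<in> t1.gplus" for u Y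
  proof -
    have "t2.B (lift (t1.D u)) (lift Y) = - t2.B (L u) (L (t1.D Y))"
      by (simp add: lift_D_minus[OF u] lift_D[OF Y] t2.B_D)
    also have "\<dots> = t1.B (t1.D u) Y"
      using isometry_L[OF u t1.D_plus[OF Y]] by (simp add: t1.B_D)
    finally show ?thesis .
  qed
  have "X \<in> {X \<in> t1.gplus. t2.B (lift X) (lift Y) = t1.B X Y}"
  proof (rule t1.gplus_generation[OF _ _ _ X])
    show "subspace {X \<in> t1.gplus. t2.B (lift X) (lift Y) = t1.B X Y}"
      using subspace_add[OF t1.subspace_plus] subspace_scale[OF t1.subspace_plus] subspace_0[OF t1.subspace_plus]
        liftI[OF corresponds_0]
      by (auto simp: subspace_def lift_add lift_scale t1.B_simps t2.B_simps)
    show "t1.D u \<in> {X \<in> t1.gplus. t2.B (lift X) (lift Y) = t1.B X Y}" if "u \<in> t1.gminus \<inter> t1.upm" for u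
      using that rot[OF _ Y] t1.D_minus by blast
    show "t1.br x y \<in> {X \<in> t1.gplus. t2.B (lift X) (lift Y) = t1.B X Y}"
      if x: "x \<in> t1.gplus \<inter> t1.upm" and y: "y \<in> t1.gplus \<inter> t1.upm" for x y
    proof -
      have y_eq: "y = t1.D (- t1.D y)" using y t1.upmD[of y] by (simp add: t1.D_simps)
      have mem: "- t1.D y \<in> t1.gminus" "t1.br x Y \<in> t1.gplus"
        using x y Y t1.D_plus t1.br_plus_plus subspace_neg[OF t1.subspace_minus] by auto
      have "t2.B (lift (t1.br x y)) (lift Y) = - t2.B (lift y) (lift (t1.br x Y))"
        using x y Y by (simp add: lift_bracket t2.B_inv)
      also have "\<dots> = - t1.B y (t1.br x Y)"
        using rot[OF mem] y_eq by simp
      also have "\<dots> = t1.B (t1.br x y) Y" by (simp add: t1.B_inv)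
      finally show ?thesis using x y t1.br_plus_plus by auto
    qed
  qed
  then show ?thesis by simp
qed

text \<open>
  Both sides have the same products with all elements of \<open>\<gg>\<^sub>+\<close>, by invariance of the form.
\<close>

lemma lift_bracket_minus:
  assumes u: "u \<in> t1.gminus" and v: "v \<in> t1.gminus"
  shows "lift (t1.br u v) = t2.br (L u) (L v)"
proof -
  have uv: "t1.br u v \<in> t1.gplus" using u v by (rule t1.br_minus_minus)
  have "t2.br (L u) (L v) - lift (t1.br u v) = 0"
  proof (rule t2.nondeg_gplus)
    show "t2.br (L u) (L v) - lift (t1.br u v) \<in> t2.gplus"
      using t2.br_minus_minus[OF L_mem[OF u] L_mem[OF v]] lift_mem[OF uv]
      by (rule subspace_diff[OF t2.subspace_plus])
    fix Z' assume "Z' \<in> t2.gplus"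
    then obtain Z where "corresponds Z Z'" using corresponds_surj by blast
    then have Z: "Z \<in> t1.gplus" "Z' = lift Z" using liftI by (auto simp: corresponds_def)
    have "t2.B (t2.br (L u) (L v)) Z' = t2.B (L v) (t2.br (lift Z) (L u))"
      using t2.br_anti[of "L u" Z'] by (simp add: t2.B_inv t2.B_simps Z(2))
    also have "\<dots> = t2.B (L v) (L (t1.br Z u))" by (simp add: lift_br[OF Z(1) u])
    also have "\<dots> = t1.B v (t1.br Z u)" using v t1.br_plus_minus[OF Z(1) u] by (rule isometry_L)
    also have "\<dots> = t1.B (t1.br u v) Z"
      using t1.br_anti[of u Z] by (simp add: t1.B_inv t1.B_simps)
    also have "\<dots> = t2.B (lift (t1.br u v)) Z'"
      using lift_isometry[OF uv Z(1)] Z(2) by simp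
    finally show "t2.B (t2.br (L u) (L v) - lift (t1.br u v)) Z' = 0" by (simp add: t2.B_simps)
  qed
  then show ?thesis by simp
qed

definition triple_iso :: "'a \<Rightarrow> 'b" where
  "triple_iso x = lift ((1 / 2) *\<^sub>R (x + t1.\<theta> x)) + L ((1 / 2) *\<^sub>R (x - t1.\<theta> x))"

lemma triple_iso_pm:
  assumes "a \<in> t1.gplus" "b \<in> t1.gminus"
  shows "triple_iso (a + b) = lift a + L b"
proof -
  have "t1.\<theta> (a + b) = a - b" using assms by (simp add: plus_space_def minus_space_def t1.inv_simps)
  then have "(1 / 2) *\<^sub>R (a + b + t1.\<theta> (a + b)) = a" "(1 / 2) *\<^sub>R (a + b - t1.\<theta> (a + b)) = b"
    by (simp_all flip: scaleR_2)
  then show ?thesis by (simp add: triple_iso_def)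
qed

theorem isomorphic: "isomorphic_triples T1 T2"
proof -
  have lin: "linear triple_iso"
  proof
    fix x y c
    obtain a b where x: "x = a + b" "a \<in> t1.gplus" "b \<in> t1.gminus" by (rule t1.pm_decomp)
    obtain a' b' where y: "y = a' + b'" "a' \<in> t1.gplus" "b' \<in> t1.gminus" by (rule t1.pm_decomp)
    have "triple_iso ((a + a') + (b + b')) = lift (a + a') + L (b + b')"
      using x y by (intro triple_iso_pm subspace_add t1.subspace_plus t1.subspace_minus)
    then show "triple_iso (x + y) = triple_iso x + triple_iso y"
      using x y by (simp add: triple_iso_pm lift_add L_simps algebra_simps)
    have "triple_iso (c *\<^sub>R a + c *\<^sub>R b) = lift (c *\<^sub>R a) + L (c *\<^sub>R b)"
      using x by (intro triple_iso_pm subspace_scale t1.subspace_plus t1.subspace_minus)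
    then show "triple_iso (c *\<^sub>R x) = c *\<^sub>R triple_iso x"
      using x by (simp add: triple_iso_pm lift_scale L_simps scaleR_add_right)
  qed
  have "inj triple_iso"
    unfolding linear_injective_0[OF lin]
  proof (intro allI impI)
    fix x assume "triple_iso x = 0"
    obtain a b where x: "x = a + b" "a \<in> t1.gplus" "b \<in> t1.gminus" by (rule t1.pm_decomp)
    with \<open>triple_iso x = 0\<close> have "lift a + L b = 0" by (simp add: triple_iso_pm)
    from t2.pm_unique[OF this lift_mem[OF x(2)] L_mem[OF x(3)]] have 0: "lift a = 0" "L b = 0" by auto
    have "a = 0"
      using lift_isometry[OF x(2)] 0(1) by (intro t1.nondeg_gplus[OF x(2)]) (simp add: t2.B_simps)
    moreover have "b = 0"
      using L_inj[OF x(3) subspace_0[OF t1.subspace_minus]] 0(2) by (simp add: L_simps)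
    ultimately show "x = 0" by (simp add: x(1))
  qed
  moreover have "surj triple_iso"
  proof (rule surjI)
    fix y
    show "triple_iso (SOME x. triple_iso x = y) = y"
    proof (rule someI_ex)
      obtain a' b' where y: "y = a' + b'" "a' \<in> t2.gplus" "b' \<in> t2.gminus" by (rule t2.pm_decomp)
      obtain a where "corresponds a a'" using corresponds_surj[OF y(2)] by blast
      then have a: "a \<in> t1.gplus" "a' = lift a" using liftI by (auto simp: corresponds_def)
      obtain b where b: "b \<in> t1.gminus" "b' = L b" using L_surj[OF y(3)] by blast
      show "\<exists>x. triple_iso x = y" using triple_iso_pm[OF a(1) b(1)] a b y by metis
    qed
  qed
  ultimately have bij: "bij triple_iso" by (simp add: bij_def)
  have br: "triple_iso (t1.br x y) = t2.br (triple_iso x) (triple_iso y)" for x y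
  proof -
    obtain a b where x: "x = a + b" "a \<in> t1.gplus" "b \<in> t1.gminus" by (rule t1.pm_decomp)
    obtain a' b' where y: "y = a' + b'" "a' \<in> t1.gplus" "b' \<in> t1.gminus" by (rule t1.pm_decomp)
    have mem: "t1.br a a' \<in> t1.gplus" "t1.br b b' \<in> t1.gplus" "t1.br a b' \<in> t1.gminus" "t1.br a' b \<in> t1.gminus"
      using x y by (auto intro: t1.br_plus_plus t1.br_minus_minus t1.br_plus_minus)
    have "t1.br x y = (t1.br a a' + t1.br b b') + (t1.br a b' - t1.br a' b)"
      using t1.br_anti[of b a'] by (simp add: x y t1.br_simps)
    then have "triple_iso (t1.br x y) = lift (t1.br a a' + t1.br b b') + L (t1.br a b' - t1.br a' b)"
      using mem by (simp add: triple_iso_pm subspace_add[OF t1.subspace_plus] subspace_diff[OF t1.subspace_minus])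
    also have "\<dots> = t2.br (lift a) (lift a') + t2.br (L b) (L b') + (t2.br (lift a) (L b') - t2.br (lift a') (L b))"
      using x y mem by (simp add: lift_add lift_bracket lift_bracket_minus L_simps lift_br)
    also have "\<dots> = t2.br (triple_iso x) (triple_iso y)"
      using x y t2.br_anti[of "L b" "lift a'"] by (simp add: triple_iso_pm t2.br_simps)
    finally show ?thesis .
  qed
  have form: "t1.B x y = t2.B (triple_iso x) (triple_iso y)" for x y
  proof -
    obtain a b where x: "x = a + b" "a \<in> t1.gplus" "b \<in> t1.gminus" by (rule t1.pm_decomp)
    obtain a' b' where y: "y = a' + b'" "a' \<in> t1.gplus" "b' \<in> t1.gminus" by (rule t1.pm_decomp)
    have "t1.B x y = t1.B a a' + t1.B b b'"
      using x y t1.B_plus_minus t1.B_sym[of b a'] by (simp add: t1.B_simps)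
    also have "\<dots> = t2.B (lift a) (lift a') + t2.B (L b) (L b')"
      using x y by (simp add: lift_isometry isometry_L)
    also have "\<dots> = t2.B (lift a + L b) (lift a' + L b')"
      using t2.B_plus_minus[OF lift_mem[OF x(2)] L_mem[OF y(3)]]
        t2.B_plus_minus[OF lift_mem[OF y(2)] L_mem[OF x(3)]] t2.B_sym[of "L b" "lift a'"]
      by (simp add: t2.B_simps)
    also have "\<dots> = t2.B (triple_iso x) (triple_iso y)" using x y by (simp add: triple_iso_pm)
    finally show ?thesis .
  qed
  have der: "triple_iso (t1.D x) = t2.D (triple_iso x)" for x
  proof -
    obtain a b where x: "x = a + b" "a \<in> t1.gplus" "b \<in> t1.gminus" by (rule t1.pm_decomp)
    have "triple_iso (t1.D b + t1.D a) = lift (t1.D b) + L (t1.D a)"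
      using x by (intro triple_iso_pm t1.D_plus t1.D_minus)
    then show ?thesis
      using x by (simp add: triple_iso_pm t1.D_simps t2.D_simps lift_D lift_D_minus add.commute)
  qed
  have inv: "triple_iso (t1.\<theta> x) = t2.\<theta> (triple_iso x)" for x
  proof -
    obtain a b where x: "x = a + b" "a \<in> t1.gplus" "b \<in> t1.gminus" by (rule t1.pm_decomp)
    have "t1.\<theta> x = a + - b" using x by (simp add: plus_space_def minus_space_def t1.inv_simps)
    moreover have "triple_iso (a + - b) = lift a + L (- b)"
      using x by (intro triple_iso_pm subspace_neg t1.subspace_minus)
    moreover have "t2.\<theta> (lift a + L b) = lift a - L b"
      using lift_mem[OF x(2)] L_mem[OF x(3)] by (simp add: plus_space_def minus_space_def t2.inv_simps)
    ultimately show ?thesis using x by (simp add: triple_iso_pm L_simps)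
  qed
  show ?thesis
    unfolding isomorphic_triples_def
    using lin bij br form der inv
    by (intro exI[of _ triple_iso]) (simp add: fun_eq_iff surj_f_inv_f bij_is_surj)
qed

end

text \<open>
  The given isometry moves 0 to some point of the second orbit; moving it back leaves a linear
  isometry.
\<close>

lemma isometric_imp_isomorphic:
  assumes T1: "weak_extrinsic_symmetric_triple T1" and T2: "weak_extrinsic_symmetric_triple T2"
    and iso: "extrinsically_isometric
           (extrinsic_orbit T1) (minus_space T1) (form T1)
           (extrinsic_orbit T2) (minus_space T2) (form T2)"
  shows "isomorphic_triples T1 T2"
proof -
  interpret t1: weak_triple T1 by unfold_locales (rule T1)
  interpret t2: weak_triple T2 by unfold_locales (rule T2)
  from iso obtain f where f: "affine_isometry t1.gminus t1.B t2.gminus t2.B f" "f ` t1.orb = t2.orb"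
    unfolding extrinsically_isometric_def t1.extrinsic_orbit_eq_orb t2.extrinsic_orbit_eq_orb by blast
  from f(1) obtain L c where L: "linear L" "c \<in> t2.gminus" "\<And>v. v \<in> t1.gminus \<Longrightarrow> f v = L v + c"
    "bij_betw L t1.gminus t2.gminus"
    "\<And>u v. u \<in> t1.gminus \<Longrightarrow> v \<in> t1.gminus \<Longrightarrow> t2.B (L u) (L v) = t1.B u v"
    unfolding affine_isometry_def by blast
  have "f 0 = c" using L(3)[OF subspace_0[OF t1.subspace_minus]] by (simp add: linear_0[OF L(1)])
  then have "c \<in> t2.orb" using f(2) t1.zero_orb by blast
  from t2.move_to_zero[OF this] obtain G d where G: "linear G" "d \<in> t2.gminus" "bij_betw G t2.gminus t2.gminus"
    "\<forall>u\<in>t2.gminus. \<forall>v\<in>t2.gminus. t2.B (G u) (G v) = t2.B u v"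
    "G c + d = 0" "(\<lambda>w. G w + d) ` t2.orb = t2.orb" by (elim exE conjE) (rule that; assumption)
  have "G (f v) + d = (G \<circ> L) v" if "v \<in> t1.orb" for v
    using L(3)[OF t1.orb_minus[OF that]] G(5) by (simp add: linear_add[OF G(1)] add.assoc)
  then have "(G \<circ> L) ` t1.orb = (\<lambda>w. G w + d) ` f ` t1.orb"
    unfolding image_image by (intro image_cong refl) (simp only:)
  then have orb: "(G \<circ> L) ` t1.orb = t2.orb" by (simp only: f(2) G(6))
  have mem: "L v \<in> t2.gminus" if "v \<in> t1.gminus" for v using L(4) that by (auto simp: bij_betw_def)
  interpret linear_orbit_isometry T1 T2 "G \<circ> L"
  proof (intro linear_orbit_isometry.intro t2.weak_triple_axioms t1.weak_triple_axioms
      linear_orbit_isometry_axioms.intro)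
    show "linear (G \<circ> L)" using L(1) G(1) by (rule linear_compose)
    show "bij_betw (G \<circ> L) t1.gminus t2.gminus" using L(4) G(3) by (rule bij_betw_trans)
    show "t2.B ((G \<circ> L) u) ((G \<circ> L) v) = t1.B u v" if "u \<in> t1.gminus" "v \<in> t1.gminus" for u v
      using that L(5) G(4) mem by simp
    show "(G \<circ> L) ` t1.orb = t2.orb" by (rule orb)
  qed
  show ?thesis by (rule isomorphic)
qed

section \<open>From isomorphic triples to isometric orbits\<close>

text \<open>
  The isomorphism itself is the isometry. Composed with coordinates it is a linear map out of a
  Euclidean space, hence continuous, and intertwines the exponentials.
\<close>

lemma isomorphic_imp_isometric:
  assumes T1: "weak_extrinsic_symmetric_triple T1" and T2: "weak_extrinsic_symmetric_triple T2"
    and iso: "isomorphic_triples T1 T2"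
  shows "extrinsically_isometric
           (extrinsic_orbit T1) (minus_space T1) (form T1)
           (extrinsic_orbit T2) (minus_space T2) (form T2)"
proof -
  interpret t1: weak_triple T1 by unfold_locales (rule T1)
  interpret t2: weak_triple T2 by unfold_locales (rule T2)
  from iso obtain h where h: "linear h" "bij h" "\<And>x y. h (t1.br x y) = t2.br (h x) (h y)"
    "\<And>x y. t1.B x y = t2.B (h x) (h y)"
    and der: "t2.D = h \<circ> t1.D \<circ> inv_into UNIV h" and inv: "t2.\<theta> = h \<circ> t1.\<theta> \<circ> inv_into UNIV h"
    unfolding isomorphic_triples_def by blast
  have inj: "inj h" using h(2) by (rule bij_is_inj)
  have D: "t2.D (h x) = h (t1.D x)" for x by (simp add: der inv_f_f[OF inj])
  have \<theta>: "t2.\<theta> (h x) = h (t1.\<theta> x)" for x by (simp add: inv inv_f_f[OF inj])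
  have plus: "h x \<in> t2.gplus \<longleftrightarrow> x \<in> t1.gplus" for x
    by (simp add: plus_space_def \<theta> inj_eq[OF inj])
  have minus: "h x \<in> t2.gminus \<longleftrightarrow> x \<in> t1.gminus" for x
    by (simp add: minus_space_def \<theta> inj_eq[OF inj] flip: linear_neg[OF h(1)])
  have transvection_h: "t2.transvection (h x) (h v) = h (t1.transvection x v)" for x v
  proof -
    define F where "F = (\<lambda>(y :: real ^ _ coordinate_index, s :: real). (h (from_coords y), s))"
    have F: "linear F" by (rule linearI) (auto simp: F_def t1.from_simps linear_add[OF h(1)] linear_scale[OF h(1)])
    have "F (t1.hat.ead (to_coords x, 0) (to_coords v, 1))
        = exp_linear (homogenize (phi T2 (h x))) (F (to_coords v, 1))"
      by (rule exp_linear_intertwine[OF t1.hat.linear_br F])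
        (auto simp: F_def hat_bracket_def homogenize_def phi_def t1.cbr_def t1.cD_def t1.to_coords_T
          t1.from_simps h(3) D linear_diff[OF h(1)] linear_add[OF h(1)] linear_scale[OF h(1)])
    then show ?thesis
      by (simp add: t1.hat_exp_affine F_def t1.to_coords_T t2.transvection_def exp_affine_def prod_eq_iff)
  qed
  have "h ` t1.orb = t2.orb"
  proof
    have "h v \<in> t2.orb" if "v \<in> t1.orb" for v
      using that
    proof (induction rule: t1.orb.induct)
      case zero_orb show ?case using t2.zero_orb by (simp add: linear_0[OF h(1)])
    next
      case (transvection_orb x v)
      then show ?case using t2.transvection_orb[of "h x" "h v"] by (simp add: plus transvection_h)
    qed
    then show "h ` t1.orb \<subseteq> t2.orb" by blast
    have "w \<in> h ` t1.orb" if "w \<in> t2.orb" for w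
      using that
    proof (induction rule: t2.orb.induct)
      case zero_orb show ?case using t1.zero_orb linear_0[OF h(1)] by (metis imageI)
    next
      case (transvection_orb y w)
      then obtain v where v: "v \<in> t1.orb" "w = h v" by blast
      obtain x where x: "y = h x" using h(2) by (metis bij_pointE)
      with transvection_orb.hyps have "x \<in> t1.gplus" by (simp add: plus)
      then show ?case using t1.transvection_orb[OF _ v(1)] by (metis x v(2) transvection_h imageI)
    qed
    then show "t2.orb \<subseteq> h ` t1.orb" by blast
  qed
  moreover have "affine_isometry t1.gminus t1.B t2.gminus t2.B h"
    unfolding affine_isometry_def
  proof (intro exI conjI ballI)
    show "linear h" by (rule h(1))
    show "0 \<in> t2.gminus" by (rule subspace_0[OF t2.subspace_minus])
    show "h v = h v + 0" for v by simp
    have "h ` t1.gminus = t2.gminus"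
      using minus h(2) by (auto simp: image_iff) (metis bij_pointE)
    then show "bij_betw h t1.gminus t2.gminus"
      using inj by (auto simp: bij_betw_def intro: inj_on_subset)
    show "t2.B (h u) (h v) = t1.B u v" for u v by (simp add: h(4))
  qed
  ultimately show ?thesis
    unfolding extrinsically_isometric_def t1.extrinsic_orbit_eq_orb t2.extrinsic_orbit_eq_orb by blast
qed

theorem proposition4p8:
  fixes T1 :: "'a::real_normed_vector triple"
    and T2 :: "'b::real_normed_vector triple"
  assumes "weak_extrinsic_symmetric_triple T1"
    and "weak_extrinsic_symmetric_triple T2"
  shows "extrinsically_isometric
           (extrinsic_orbit T1) (minus_space T1) (form T1)
           (extrinsic_orbit T2) (minus_space T2) (form T2)
         \<longleftrightarrow> isomorphic_triples T1 T2"
  using isometric_imp_isomorphic[OF assms] isomorphic_imp_isometric[OF assms] by blast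

end
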